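(* Let $M\cong\mathbb{Z}^d$ be a lattice with $d\ge 1$. For a matrix $A\in\mathrm{Mat}_d(\mathbb{Z})$ with nonzero determinant and a lattice basis $m_1,\dots,m_d$ of $M$, let $P_A$ be the convex hull of the $2d$ points $\pm a_1,\dots,\pm a_d\in M\otimes\mathbb{R}$, where $a_j=\sum_i A_{i,j}m_i$ is the point whose coefficient vector in this basis is the $j$-th column of $A$. (1) The assignment $A\mapsto P_A$ induces a one-to-one correspondence between equivalence classes of Wirth matrices (in $\mathrm{Mat}_d(\mathbb{N})$) and isomorphism classes of $d$-dimensional reflexive cs-crosspolytopes. For the inverse map: given any facet of a reflexive cs-crosspolytope $P$, there is a lattice basis of $M$ in which the coordinate vectors of the vertices of this facet are the columns of a Wirth matrix corresponding to $P$. (2) Under this correspondence, equivalence classes of 1-minimal Wirth matrices correspond to isomorphism classes of 1-irreducible reflexive cs-crosspolytopes. Moreover, any reflexive cs-crosspolytope $P$ splits, uniquely up to isomorphism, into a 1-irreducible reflexive cs-crosspolytope $P'$ and $r$ copies of $[-1,1]$; here a 1-minimal Wirth matrix associated to $P'$ is the reduction of a Wirth matrix $A$ associated to $P$, and $r$ equals the number of rows of $A$ containing only one entry equal to $1$.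
   Context: $M\cong\mathbb{Z}^d$ and $N=\mathrm{Hom}_{\mathbb{Z}}(M,\mathbb{Z})$ are dual lattices with pairing $\langle\cdot,\cdot\rangle$; $M_{\mathbb{R}}=M\otimes\mathbb{R}$, $N_{\mathbb{R}}=N\otimes\mathbb{R}$. A Fano polytope is a $d$-dimensional lattice polytope $P\subseteq M_{\mathbb{R}}$ with $0$ in its interior and primitive vertices. Its dual is $P^*=\{x\in N_{\mathbb{R}}:\langle x,y\rangle\ge -1\ \forall y\in P\}$; $P$ is reflexive if $P^*$ is a lattice polytope. Two lattice polytopes are isomorphic if some lattice automorphism maps the vertex set of one onto that of the other. A cs-crosspolytope is the convex hull of a simplex not containing $0$ together with its negative (equivalently a $d$-dimensional simplicial polytope with $2d$ vertices having a facet $F$ with $-F$ also a facet). A Wirth matrix is a matrix $A=\begin{pmatrix}2\,\mathrm{id}_f&0\\ C&\mathrm{id}_{d-f}\end{pmatrix}\in\mathrm{Mat}_d(\mathbb{N})$ with $f\in\{0,\dots,d-1\}$ and $C\in\mathrm{Mat}_{(d-f)\times f}(\{0,1\})$ such that every column of $C$ has an odd number of $1$'s. It is 1-minimal if every row of $C$ contains a $1$. The reduction of a Wirth matrix is the 1-minimal Wirth matrix obtained by deleting each row containing only one $1$ (i.e. a row among the last $d-f$ whose part in $C$ is zero) together with the column containing that row's diagonal $1$. Two matrices in $\mathrm{Mat}_d(\mathbb{N})$ are equivalent if they differ by a permutation of columns and left multiplication by a matrix in $\mathrm{GL}_d(\mathbb{Z})$. For Fano polytopes $P_1\subseteq (M_1)_{\mathbb{R}}$,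 $P_2\subseteq (M_2)_{\mathbb{R}}$ with $\dim P_1+\dim P_2=d$, $P$ splits into factors $P_1$ and $P_2$ if $P\cong\mathrm{conv}(P_1\oplus\{0\},\{0\}\oplus P_2)$ under some isomorphism $M\cong M_1\oplus M_2$ (iterating gives splitting into several factors). $P$ is 1-irreducible if $P$ does not split into $[-1,1]$ and some $P_2$. *)

theory Defs
  imports "HOL-Analysis.Analysis" "HOL-Analysis.Finite_Function_Topology"
begin

text \<open>Points of M_R = R^d are modelled (uniformly in d) as finitely supported
  functions nat =>0 real whose support lies in {..<d}; the lattice M = Z^d
  with its standard basis; N = Hom(M,Z) is identified with Z^d via the dual basis.\<close>

type_synonym pt = "nat \<Rightarrow>\<^sub>0 real"

definition Rd :: "nat \<Rightarrow> pt set" where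
  "Rd d = {x. \<forall>i. d \<le> i \<longrightarrow> Poly_Mapping.lookup x i = 0}"

definition vec :: "nat \<Rightarrow> (nat \<Rightarrow> real) \<Rightarrow> pt" where
  "vec d f = Abs_poly_mapping (\<lambda>i. if i < d then f i else 0)"

definition lattice_pt :: "nat \<Rightarrow> pt \<Rightarrow> bool" where
  "lattice_pt d x \<longleftrightarrow> x \<in> Rd d \<and> (\<forall>i. Poly_Mapping.lookup x i \<in> \<int>)"

definition pairing :: "nat \<Rightarrow> pt \<Rightarrow> pt \<Rightarrow> real" where
  "pairing d x y = (\<Sum>i<d. Poly_Mapping.lookup x i * Poly_Mapping.lookup y i)"

definition vertices :: "pt set \<Rightarrow> pt set" where
  "vertices P = {v. v extreme_point_of P}"

definition lattice_polytope :: "nat \<Rightarrow> pt set \<Rightarrow> bool" where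
  "lattice_polytope d P \<longleftrightarrow>
     (\<exists>V. finite V \<and> V \<noteq> {} \<and> (\<forall>v\<in>V. lattice_pt d v) \<and> P = convex hull V)"

definition zero_in_interior :: "nat \<Rightarrow> pt set \<Rightarrow> bool" where
  "zero_in_interior d P \<longleftrightarrow>
     (\<exists>e>0. \<forall>x\<in>Rd d. (\<forall>i<d. \<bar>Poly_Mapping.lookup x i\<bar> < e) \<longrightarrow> x \<in> P)"

definition primitive :: "nat \<Rightarrow> pt \<Rightarrow> bool" where
  "primitive d v \<longleftrightarrow> lattice_pt d v \<and> v \<noteq> 0 \<and>
     \<not> (\<exists>k::int. k > 1 \<and> (\<exists>w. lattice_pt d w \<and> v = of_int k *\<^sub>R w))"

definition fano :: "nat \<Rightarrow> pt set \<Rightarrow> bool" where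
  "fano d P \<longleftrightarrow> P \<subseteq> Rd d \<and> lattice_polytope d P \<and> zero_in_interior d P \<and>
     (\<forall>v\<in>vertices P. primitive d v)"

definition dual :: "nat \<Rightarrow> pt set \<Rightarrow> pt set" where
  "dual d P = {x \<in> Rd d. \<forall>y\<in>P. pairing d x y \<ge> -1}"

definition reflexive :: "nat \<Rightarrow> pt set \<Rightarrow> bool" where
  "reflexive d P \<longleftrightarrow> fano d P \<and> lattice_polytope d (dual d P)"

definition cs_cross :: "nat \<Rightarrow> pt set \<Rightarrow> bool" where
  "cs_cross d P \<longleftrightarrow> (\<exists>V. V \<subseteq> Rd d \<and> card V = d \<and> \<not> affine_dependent V \<and>
      0 \<notin> convex hull V \<and> P = convex hull (V \<union> uminus ` V))"

definition is_facet :: "nat \<Rightarrow> pt set \<Rightarrow> pt set \<Rightarrow> bool" where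
  "is_facet d F P \<longleftrightarrow> F face_of P \<and> F \<noteq> P \<and>
     (\<exists>S\<subseteq>F. card S = d \<and> \<not> affine_dependent S)"

text \<open>integer d x d matrices as nat \<Rightarrow> nat \<Rightarrow> int (only entries with indices < d matter)\<close>
type_synonym imat = "nat \<Rightarrow> nat \<Rightarrow> int"

definition unimodular :: "nat \<Rightarrow> imat \<Rightarrow> bool" where
  "unimodular d U \<longleftrightarrow> (\<exists>W. \<forall>i<d. \<forall>k<d.
      (\<Sum>j<d. U i j * W j k) = (if i = k then 1 else 0) \<and>
      (\<Sum>j<d. W i j * U j k) = (if i = k then 1 else 0))"

definition lin :: "nat \<Rightarrow> imat \<Rightarrow> pt \<Rightarrow> pt" where
  "lin d U x = vec d (\<lambda>i. \<Sum>j<d. real_of_int (U i j) * Poly_Mapping.lookup x j)"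

definition iso :: "nat \<Rightarrow> pt set \<Rightarrow> pt set \<Rightarrow> bool" where
  "iso d P Q \<longleftrightarrow> (\<exists>U. unimodular d U \<and> lin d U ` vertices P = vertices Q)"

definition col :: "nat \<Rightarrow> imat \<Rightarrow> nat \<Rightarrow> pt" where
  "col d A j = vec d (\<lambda>i. real_of_int (A i j))"

definition PA :: "nat \<Rightarrow> imat \<Rightarrow> pt set" where
  "PA d A = convex hull ((col d A ` {..<d}) \<union> (uminus ` col d A ` {..<d}))"

definition wirth_f :: "nat \<Rightarrow> nat \<Rightarrow> imat \<Rightarrow> bool" where
  "wirth_f d f A \<longleftrightarrow> f < d \<and>
     (\<forall>i<d. \<forall>j<d.
        (i < f \<longrightarrow> A i j = (if i = j then 2 else 0)) \<and>
        (f \<le> i \<and> f \<le> j \<longrightarrow> A i j = (if i = j then 1 else 0)) \<and>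
        (f \<le> i \<and> j < f \<longrightarrow> A i j \<in> {0, 1})) \<and>
     (\<forall>j<f. odd (card {i. f \<le> i \<and> i < d \<and> A i j = 1}))"

definition wirth :: "nat \<Rightarrow> imat \<Rightarrow> bool" where
  "wirth d A \<longleftrightarrow> (\<exists>f. wirth_f d f A)"

definition one_minimal :: "nat \<Rightarrow> imat \<Rightarrow> bool" where
  "one_minimal d A \<longleftrightarrow> (\<exists>f. wirth_f d f A \<and>
      (\<forall>i. f \<le> i \<and> i < d \<longrightarrow> (\<exists>j<f. A i j = 1)))"

definition mat_equiv :: "nat \<Rightarrow> imat \<Rightarrow> imat \<Rightarrow> bool" where
  "mat_equiv d A B \<longleftrightarrow> (\<exists>U \<sigma>. unimodular d U \<and> \<sigma> permutes {..<d} \<and>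
      (\<forall>i<d. \<forall>j<d. B i j = (\<Sum>k<d. U i k * A k (\<sigma> j))))"

definition single_one_rows :: "nat \<Rightarrow> imat \<Rightarrow> nat set" where
  "single_one_rows d A = {i. i < d \<and> card {j. j < d \<and> A i j = 1} = 1}"

text \<open>reduction: delete those rows and the columns of their diagonal 1
  (i.e. the same indices), keeping the order of the remaining indices\<close>
definition reduction :: "nat \<Rightarrow> imat \<Rightarrow> imat" where
  "reduction d A = (let ks = sorted_list_of_set ({..<d} - single_one_rows d A)
                    in (\<lambda>i j. A (ks ! i) (ks ! j)))"

definition shift :: "nat \<Rightarrow> pt \<Rightarrow> pt" where
  "shift d1 x = Abs_poly_mapping (\<lambda>i. if d1 \<le> i then Poly_Mapping.lookup x (i - d1) else 0)"

definition dsum :: "nat \<Rightarrow> pt set \<Rightarrow> pt set \<Rightarrow> pt set" where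
  "dsum d1 P1 P2 = convex hull (P1 \<union> shift d1 ` P2)"

definition seg :: "pt set" where
  "seg = convex hull {vec 1 (\<lambda>_. 1), vec 1 (\<lambda>_. -1)}"

definition fano_factor :: "nat \<Rightarrow> pt set \<Rightarrow> bool" where
  "fano_factor n Q \<longleftrightarrow> (n = 0 \<and> Q = {0}) \<or> (n \<ge> 1 \<and> fano n Q)"

definition one_irreducible :: "nat \<Rightarrow> pt set \<Rightarrow> bool" where
  "one_irreducible d P \<longleftrightarrow>
     \<not> (\<exists>P2. d \<ge> 1 \<and> fano_factor (d - 1) P2 \<and> iso d P (dsum 1 seg P2))"

fun add_segs :: "nat \<Rightarrow> pt set \<Rightarrow> nat \<Rightarrow> pt set" where
  "add_segs n Q 0 = Q"
| "add_segs n Q (Suc r) = dsum (n + r) (add_segs n Q r) seg"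

definition irr_factor :: "nat \<Rightarrow> pt set \<Rightarrow> bool" where
  "irr_factor n Q \<longleftrightarrow> (n = 0 \<and> Q = {0}) \<or>
     (n \<ge> 1 \<and> reflexive n Q \<and> cs_cross n Q \<and> one_irreducible n Q)"

end

theory Submission
  imports Defs
begin

text \<open>A cs-crosspolytope whose vertices are the columns of \<open>V\<close> and their negatives has as dual
  vertices the solutions \<open>x\<close> of \<open>x V = e\<close> for sign vectors \<open>e\<close>. These are all integral iff
  \<open>Y = 2 V\<inverse>\<close> is integral and the sum of its rows is even. The lattice then lies between the span
  of the columns and one half of it, so it is a binary code of length \<open>d\<close>, all of whose words
  have even weight. Wirth matrices are the generator matrices in systematic form: the parity
  condition on the columns of \<open>C\<close> says that the weights are even. Sign changes of columns are
  realised by lattice automorphisms, so isomorphism of polytopes is equivalence of matrices. A copy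
  of \<open>[-1,1]\<close> splits off exactly at the coordinates that vanish on the whole code, which are the
  zero rows of \<open>C\<close>; this set is an invariant of the equivalence class.\<close>

section \<open>Crosspolytopes with dual bases\<close>

text \<open>The factor 2 comes from the dual. That polytope is a cube whose vertices are the signed
  sums of the dual basis \<open>X\<close>, and neighbouring vertices differ by \<open>2 X j\<close>;
  so \<open>Y = 2 X\<close> is integral. Conversely, changing a sign alters such a sum by a row of
  \<open>Y\<close>, so one integral vertex makes all of them integral. Even weight is the
  integrality of that one vertex \<open>h\<close>: the coordinates of \<open>Y m\<close> add up to
  twice the pairing of \<open>h\<close> with \<open>m\<close>. The code word of a lattice point
  \<open>m\<close> is \<open>Y m\<close> modulo 2, and \<open>Y m\<close> is twice the coordinate
  vector of \<open>m\<close> in the basis of columns; matrices with the same code therefore differ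
  by a unimodular factor. The dimension is a number and not a type, so matrices are functions on all
  indices, and invertibility is carried by explicit two-sided inverse identities instead of
  determinants. Dimension 0 shapes the splitting part: no Wirth matrix has size 0 and the hull of no
  points is empty, yet a polytope that consists of segments only leaves the factor
  \<open>{0}\<close>.\<close>

lemma lookup_vec: "Poly_Mapping.lookup (vec d f) i = (if i < d then f i else 0)"
proof -
  have "finite {i. (if i < d then f i else 0) \<noteq> 0}"
    by (rule finite_subset[of _ "{..<d}"]) auto
  then show ?thesis
    by (simp add: vec_def)
qed

lemma lookup_scaleR: "Poly_Mapping.lookup (c *\<^sub>R x) i = c * Poly_Mapping.lookup (x::pt) i"
  by (simp add: scaleR_poly_mapping_def)

lemmas lookup_pt = lookup_vec lookup_scaleR lookup_add lookup_minus lookup_sum lookup_uminus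

lemma lookup_shift:
  "Poly_Mapping.lookup (shift n x) i = (if n \<le> i then Poly_Mapping.lookup x (i - n) else 0)"
proof -
  have "{i. (if n \<le> i then Poly_Mapping.lookup x (i - n) else 0) \<noteq> 0}
      \<subseteq> (\<lambda>k. k + n) ` Poly_Mapping.keys x"
    by (auto simp: in_keys_iff split: if_splits intro!: image_eqI[where x = "_ - n"])
  then have "finite {i. (if n \<le> i then Poly_Mapping.lookup x (i - n) else 0) \<noteq> 0}"
    by (rule finite_subset) simp
  then show ?thesis
    by (simp add: shift_def)
qed

lemma vec_in_Rd [simp]: "vec d f \<in> Rd d"
  by (simp add: Rd_def lookup_vec)

lemma pt_eqI:
  assumes "x \<in> Rd d" "y \<in> Rd d" "\<And>i. i < d \<Longrightarrow> Poly_Mapping.lookup x i = Poly_Mapping.lookup y i"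
  shows "x = y"
proof (rule poly_mapping_eqI)
  fix i show "Poly_Mapping.lookup x i = Poly_Mapping.lookup y i"
    using assms by (cases "i < d") (auto simp: Rd_def)
qed

lemma subspace_Rd: "subspace (Rd d)"
  by (auto simp: subspace_def Rd_def lookup_pt)

lemma Rd_lincomb: "(\<And>j. j \<in> J \<Longrightarrow> v j \<in> Rd d) \<Longrightarrow> (\<Sum>j\<in>J. c j *\<^sub>R v j) \<in> Rd d"
  by (intro subspace_sum subspace_scale subspace_Rd)

lemma Rd_hull: "S \<subseteq> Rd d \<Longrightarrow> convex hull S \<subseteq> Rd d"
  by (intro hull_minimal subspace_imp_convex subspace_Rd)

lemma pairing_commute: "pairing d x y = pairing d y x"
  by (simp add: pairing_def mult.commute)

lemma linear_pairing: "linear (pairing d x)"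
  by (rule linearI) (simp_all add: pairing_def lookup_pt sum.distrib sum_distrib_left algebra_simps)

lemma linear_pairing_left: "linear (\<lambda>x. pairing d x y)"
  by (subst pairing_commute) (rule linear_pairing)

lemmas pairing_simps =
  linear_add[OF linear_pairing] linear_diff[OF linear_pairing] linear_scale[OF linear_pairing]
  linear_sum[OF linear_pairing] linear_neg[OF linear_pairing] linear_0[OF linear_pairing]
  linear_add[OF linear_pairing_left] linear_diff[OF linear_pairing_left]
  linear_scale[OF linear_pairing_left] linear_sum[OF linear_pairing_left]
  linear_neg[OF linear_pairing_left] linear_0[OF linear_pairing_left]

lemma linear_lin: "linear (lin d U)"
  by (rule linearI; rule poly_mapping_eqI)
    (simp_all add: lin_def lookup_pt sum.distrib sum_distrib_left algebra_simps)

lemma linear_shift: "linear (shift n)"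
  by (rule linearI; rule poly_mapping_eqI) (simp_all add: lookup_shift lookup_pt)

lemma lin_in_Rd [simp]: "lin d U x \<in> Rd d"
  by (simp add: lin_def)

lemma sum_delta_mult:
  fixes f :: "nat \<Rightarrow> 'a::semiring_1"
  assumes "i < d"
  shows "(\<Sum>j<d. (if i = j then 1 else 0) * f j) = f i"
    and "(\<Sum>j<d. (if j = i then 1 else 0) * f j) = f i"
    and "(\<Sum>j<d. f j * (if i = j then 1 else 0)) = f i"
    and "(\<Sum>j<d. f j * (if j = i then 1 else 0)) = f i"
proof -
  have "(if i = j then 1 else 0) * f j = (if i = j then f j else 0)"
    "(if j = i then 1 else 0) * f j = (if j = i then f j else 0)"
    "f j * (if i = j then 1 else 0) = (if i = j then f j else 0)"
    "f j * (if j = i then 1 else 0) = (if j = i then f j else 0)" for j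
    by simp_all
  note * = this
  show "(\<Sum>j<d. (if i = j then 1 else 0) * f j) = f i"
    "(\<Sum>j<d. (if j = i then 1 else 0) * f j) = f i"
    "(\<Sum>j<d. f j * (if i = j then 1 else 0)) = f i"
    "(\<Sum>j<d. f j * (if j = i then 1 else 0)) = f i"
    unfolding * using assms by simp_all
qed

text \<open>The defects \<open>1 - a\<close> and \<open>1 - b\<close> are nonnegative and their
  weighted sum is zero. Extremality of the vertices of the polytope and of its dual is reduced to
  this.\<close>

lemma convex_comb_eq_one:
  fixes a b u :: real
  assumes "0 < u" "u < 1" "a \<le> 1" "b \<le> 1" "(1 - u) * a + u * b = 1"
  shows "a = 1" "b = 1"
proof -
  have "(1 - u) * (1 - a) + u * (1 - b) = 0" using assms(5) by (simp add: algebra_simps)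
  moreover have "(1 - u) * (1 - a) \<ge> 0" "u * (1 - b) \<ge> 0" using assms by auto
  ultimately have "(1 - u) * (1 - a) = 0" "u * (1 - b) = 0" by linarith+
  then show "a = 1" "b = 1" using assms by auto
qed

text \<open>Arbitrary points replace matrix columns because the vertices of a given polytope have to
  be handled before they are known to be integral.\<close>

definition cross :: "nat \<Rightarrow> (nat \<Rightarrow> pt) \<Rightarrow> pt set" where
  "cross d v = convex hull (v ` {..<d} \<union> uminus ` v ` {..<d})"

lemma PA_cross: "PA d A = cross d (col d A)"
  by (simp add: PA_def cross_def)

text \<open>A sign change maps each antipodal pair to itself, so the generating set stays the same.
  This lets the vertices of any facet serve as the columns.\<close>

lemma cross_signed:
  assumes "\<And>j. j < d \<Longrightarrow> e j = 1 \<or> e j = -1"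
  shows "cross d (\<lambda>j. e j *\<^sub>R v j) = cross d v"
proof -
  have "(\<lambda>j. e j *\<^sub>R v j) ` {..<d} \<union> uminus ` (\<lambda>j. e j *\<^sub>R v j) ` {..<d}
      = v ` {..<d} \<union> uminus ` v ` {..<d}" (is "?L = ?R")
  proof (intro subset_antisym subsetI)
    fix x assume "x \<in> ?L"
    then obtain j where "j < d" "x = e j *\<^sub>R v j \<or> x = - (e j *\<^sub>R v j)" by auto
    then show "x \<in> ?R" using assms[of j] by force
  next
    fix x assume "x \<in> ?R"
    then obtain j where "j < d" "x = v j \<or> x = - v j" by auto
    then have "x = e j *\<^sub>R v j \<or> x = - (e j *\<^sub>R v j)" using assms[of j] by force
    then show "x \<in> ?L" using \<open>j < d\<close> by blast
  qed
  then show ?thesis by (simp add: cross_def)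
qed

text \<open>\<open>pair\<close> says that the \<open>X i\<close> are the rows of a left inverse of
  the matrix with columns \<open>v j\<close>, and \<open>expand\<close> that they also form a right
  inverse. Having both as assumptions avoids any dimension count inside the locale.\<close>

locale dual_bases =
  fixes d :: nat and v X :: "nat \<Rightarrow> pt"
  assumes d_pos: "d \<ge> 1"
    and v_Rd: "\<And>j. j < d \<Longrightarrow> v j \<in> Rd d"
    and X_Rd: "\<And>j. j < d \<Longrightarrow> X j \<in> Rd d"
    and pair: "\<And>i j. i < d \<Longrightarrow> j < d \<Longrightarrow> pairing d (X i) (v j) = (if i = j then 1 else 0)"
    and expand: "\<And>x. x \<in> Rd d \<Longrightarrow> x = (\<Sum>j<d. pairing d (X j) x *\<^sub>R v j)"
begin

lemma pair_comb: "i < d \<Longrightarrow> pairing d (X i) (\<Sum>j<d. t j *\<^sub>R v j) = t i"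
proof -
  assume i: "i < d"
  have "pairing d (X i) (\<Sum>j<d. t j *\<^sub>R v j) = (\<Sum>j<d. t j * (if i = j then 1 else 0))"
    unfolding pairing_simps by (rule sum.cong) (use i in \<open>auto simp: pair\<close>)
  then show ?thesis using i by (simp only: sum_delta_mult)
qed

lemma dual_pair_comb: "i < d \<Longrightarrow> pairing d (\<Sum>j<d. t j *\<^sub>R X j) (v i) = t i"
proof -
  assume i: "i < d"
  have "pairing d (\<Sum>j<d. t j *\<^sub>R X j) (v i) = (\<Sum>j<d. t j * (if j = i then 1 else 0))"
    unfolding pairing_simps by (rule sum.cong) (use i in \<open>auto simp: pair\<close>)
  then show ?thesis using i by (simp only: sum_delta_mult)
qed

lemma eq_if_pair:
  assumes "x \<in> Rd d" "y \<in> Rd d" "\<And>j. j < d \<Longrightarrow> pairing d (X j) x = pairing d (X j) y"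
  shows "x = y"
proof -
  have "x = (\<Sum>j<d. pairing d (X j) x *\<^sub>R v j)" by (rule expand[OF assms(1)])
  also have "\<dots> = (\<Sum>j<d. pairing d (X j) y *\<^sub>R v j)" using assms(3) by simp
  also have "\<dots> = y" by (rule expand[OF assms(2), symmetric])
  finally show ?thesis .
qed

text \<open>The difference of the two sides pairs to zero with every \<open>v i\<close>, hence by
  \<open>expand\<close> with itself, and the pairing is positive definite on
  \<open>Rd d\<close>.\<close>

lemma dual_expand:
  assumes x: "x \<in> Rd d"
  shows "x = (\<Sum>j<d. pairing d x (v j) *\<^sub>R X j)"
proof -
  define z where "z = x - (\<Sum>j<d. pairing d x (v j) *\<^sub>R X j)"
  have zR: "z \<in> Rd d"
    unfolding z_def by (intro subspace_diff subspace_Rd x Rd_lincomb X_Rd) auto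
  have "pairing d z (v i) = 0" if "i < d" for i
    using that by (simp add: z_def linear_diff[OF linear_pairing_left] dual_pair_comb)
  then have "pairing d z z = 0"
    by (subst (2) expand[OF zR]) (simp add: pairing_simps)
  then have "(\<Sum>i<d. (Poly_Mapping.lookup z i)\<^sup>2) = 0"
    by (simp add: pairing_def power2_eq_square)
  then have "Poly_Mapping.lookup z i = 0" if "i < d" for i
    using that by (simp add: sum_nonneg_eq_0_iff)
  then have "z = 0"
    using zR by (intro pt_eqI[of _ d]) (auto simp: subspace_0[OF subspace_Rd])
  then show ?thesis by (simp add: z_def)
qed

lemma v_inj: "inj_on v {..<d}"
proof (rule inj_onI)
  fix i j assume "i \<in> {..<d}" "j \<in> {..<d}" "v i = v j"
  then show "i = j" using pair[of i i] pair[of i j] by (simp split: if_splits)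
qed

lemma v_signed_eq:
  assumes "i < d" "j < d" "e \<noteq> 0" "v i = e *\<^sub>R v j"
  shows "i = j" "e = 1"
proof -
  have "(if j = i then 1 else 0) = e"
    using pair[of j i] pair[of j j] assms by (simp add: linear_scale[OF linear_pairing])
  then show "i = j" "e = 1" using assms(3) by (auto split: if_splits)
qed

lemma comb_in_cross:
  assumes "(\<Sum>j<d. \<bar>t j\<bar>) \<le> 1"
  shows "(\<Sum>j<d. t j *\<^sub>R v j) \<in> cross d v"
proof -
  let ?C = "cross d v"
  have conv: "convex ?C" by (simp add: cross_def)
  have mem: "v j \<in> ?C" "- v j \<in> ?C" if "j < d" for j
    using that unfolding cross_def by (auto intro!: hull_inc)
  have "0 = (1/2) *\<^sub>R v 0 + (1/2) *\<^sub>R (- v 0)" by simp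
  then have zero: "0 \<in> ?C"
    using convexD[OF conv mem[of 0], of "1/2" "1/2"] d_pos by simp
  define w where "w j = sgn (t j) *\<^sub>R v j" for j
  have w: "w j \<in> ?C" if "j < d" for j
    using that mem zero by (auto simp: w_def sgn_if)
  have "t j *\<^sub>R v j = \<bar>t j\<bar> *\<^sub>R w j" for j
    by (simp add: w_def abs_mult_sgn)
  then have "(\<Sum>j<d. t j *\<^sub>R v j) = (\<Sum>j<d. \<bar>t j\<bar> *\<^sub>R w j)" by simp
  \<comment> \<open>The missing weight is put on the point 0 under the extra index \<open>d\<close>,
    which turns the sum into a convex combination.\<close>
  also have "\<dots> = (\<Sum>j\<in>insert d {..<d}. (if j = d then 1 - (\<Sum>j<d. \<bar>t j\<bar>) else \<bar>t j\<bar>) *\<^sub>R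
                    (if j = d then 0 else w j))"
    by (subst sum.insert) auto
  also have "\<dots> \<in> ?C"
    using assms w zero by (intro convex_sum conv) auto
  finally show ?thesis .
qed

lemma cross_subset_Rd: "cross d v \<subseteq> Rd d"
  unfolding cross_def using v_Rd by (intro Rd_hull) (auto intro!: subspace_neg[OF subspace_Rd])

text \<open>In the coordinates given by \<open>X\<close> this is the unit ball of the l1-norm: the
  triangle inequality gives one inclusion, \<open>comb_in_cross\<close> the other.\<close>

lemma cross_eq: "cross d v = {x \<in> Rd d. (\<Sum>j<d. \<bar>pairing d (X j) x\<bar>) \<le> 1}" (is "_ = ?R")
proof
  have "convex ?R"
  proof (rule convexI)
    fix x y and a b :: real
    assume x: "x \<in> ?R" and y: "y \<in> ?R" and ab: "0 \<le> a" "0 \<le> b" "a + b = 1"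
    have "(\<Sum>j<d. \<bar>pairing d (X j) (a *\<^sub>R x + b *\<^sub>R y)\<bar>)
        \<le> (\<Sum>j<d. a * \<bar>pairing d (X j) x\<bar> + b * \<bar>pairing d (X j) y\<bar>)"
      by (rule sum_mono) (use ab in \<open>simp add: pairing_simps abs_mult abs_triangle_ineq[THEN order_trans]\<close>)
    also have "\<dots> = a * (\<Sum>j<d. \<bar>pairing d (X j) x\<bar>) + b * (\<Sum>j<d. \<bar>pairing d (X j) y\<bar>)"
      by (simp add: sum.distrib sum_distrib_left)
    also have "\<dots> \<le> 1"
      using x y ab by (intro convex_bound_le) auto
    finally show "a *\<^sub>R x + b *\<^sub>R y \<in> ?R"
      using x y by (auto intro!: subspace_add subspace_scale subspace_Rd)
  qed
  moreover have "v i \<in> ?R" "- v i \<in> ?R" if "i < d" for i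
  proof -
    have "(\<Sum>j<d. \<bar>pairing d (X j) (v i)\<bar>) = (\<Sum>j<d. if j = i then 1 else 0)"
      using that by (intro sum.cong) (auto simp: pair)
    then show "v i \<in> ?R" "- v i \<in> ?R"
      using that v_Rd by (auto simp: pairing_simps intro: subspace_neg[OF subspace_Rd])
  qed
  ultimately show "cross d v \<subseteq> ?R"
    unfolding cross_def by (intro hull_minimal) auto
next
  show "?R \<subseteq> cross d v"
  proof
    fix x assume x: "x \<in> ?R"
    then have "(\<Sum>j<d. pairing d (X j) x *\<^sub>R v j) \<in> cross d v"
      by (intro comb_in_cross) auto
    then show "x \<in> cross d v" using expand[of x] x by simp
  qed
qed

text \<open>The functional \<open>e * X j\<close> is at most 1 on the l1-ball. Where it equals 1,
  coordinate \<open>j\<close> uses up the whole norm, which leaves only the point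
  \<open>e v j\<close>.\<close>

lemma extreme_point_cross:
  assumes j: "j < d" and e: "e = 1 \<or> e = -1"
  shows "(e *\<^sub>R v j) extreme_point_of cross d v"
  unfolding extreme_point_of_def
proof (intro conjI ballI)
  show "e *\<^sub>R v j \<in> cross d v"
    using j e unfolding cross_def by (auto intro!: hull_inc)
  fix a b assume ab: "a \<in> cross d v" "b \<in> cross d v"
  show "e *\<^sub>R v j \<notin> open_segment a b"
  proof
    assume "e *\<^sub>R v j \<in> open_segment a b"
    then obtain u where u: "0 < u" "u < 1" "e *\<^sub>R v j = (1 - u) *\<^sub>R a + u *\<^sub>R b" and "a \<noteq> b"
      by (auto simp: in_segment)
    have one: "e * pairing d (X j) x \<le> 1" "(e * pairing d (X j) x = 1 \<Longrightarrow> x = e *\<^sub>R v j)"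
      if x: "x \<in> cross d v" for x
    proof -
      have s: "(\<Sum>i<d. \<bar>pairing d (X i) x\<bar>) \<le> 1" and xR: "x \<in> Rd d"
        using x by (auto simp: cross_eq)
      have split: "(\<Sum>i<d. \<bar>pairing d (X i) x\<bar>)
          = \<bar>pairing d (X j) x\<bar> + (\<Sum>i\<in>{..<d} - {j}. \<bar>pairing d (X i) x\<bar>)"
        using j by (simp add: sum.remove)
      have nn: "(\<Sum>i\<in>{..<d} - {j}. \<bar>pairing d (X i) x\<bar>) \<ge> 0" by (simp add: sum_nonneg)
      have "\<bar>pairing d (X j) x\<bar> \<le> 1" using s nn split by linarith
      then show "e * pairing d (X j) x \<le> 1" using e by (auto simp: abs_le_iff)
      assume eq: "e * pairing d (X j) x = 1"
      then have "\<bar>pairing d (X j) x\<bar> = 1" using e by auto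
      then have "(\<Sum>i\<in>{..<d} - {j}. \<bar>pairing d (X i) x\<bar>) = 0"
        using s nn split by linarith
      then have "pairing d (X i) x = 0" if "i < d" "i \<noteq> j" for i
        using that by (simp add: sum_nonneg_eq_0_iff)
      moreover have "pairing d (X j) x = e" using eq e by auto
      ultimately show "x = e *\<^sub>R v j"
        using xR j by (intro eq_if_pair subspace_scale subspace_Rd v_Rd) (auto simp: pairing_simps pair)
    qed
    have "e * pairing d (X j) (e *\<^sub>R v j) = 1"
      using e j by (auto simp: pairing_simps pair)
    then have "(1 - u) * (e * pairing d (X j) a) + u * (e * pairing d (X j) b) = 1"
      unfolding u(3) by (simp add: pairing_simps algebra_simps)
    then have "e * pairing d (X j) a = 1" "e * pairing d (X j) b = 1"
      using convex_comb_eq_one[OF u(1,2) one(1)[OF ab(1)] one(1)[OF ab(2)]] by auto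
    then have "a = e *\<^sub>R v j" "b = e *\<^sub>R v j" using one(2) ab by auto
    then show False using \<open>a \<noteq> b\<close> by simp
  qed
qed

lemma vertices_cross: "vertices (cross d v) = v ` {..<d} \<union> uminus ` v ` {..<d}"
proof
  show "vertices (cross d v) \<subseteq> v ` {..<d} \<union> uminus ` v ` {..<d}"
    unfolding vertices_def cross_def by (auto dest: extreme_point_of_convex_hull)
  show "v ` {..<d} \<union> uminus ` v ` {..<d} \<subseteq> vertices (cross d v)"
    using extreme_point_cross[of _ 1] extreme_point_cross[of _ "-1"] by (auto simp: vertices_def)
qed

lemma zero_in_interior_cross: "zero_in_interior d (cross d v)"
proof -
  \<comment> \<open>\<open>B - 1\<close> is the sum of the absolute values of all entries of all
    \<open>X j\<close>, so small coordinates below \<open>1/B\<close> give an l1-norm of at most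
    \<open>(B - 1)/B\<close>. The summand 1 keeps \<open>B\<close> positive.\<close>
  define B where "B = (\<Sum>j<d. \<Sum>i<d. \<bar>Poly_Mapping.lookup (X j) i\<bar>) + 1"
  have B: "B > 0" unfolding B_def by (intro add_nonneg_pos sum_nonneg) auto
  show ?thesis
    unfolding zero_in_interior_def
  proof (intro exI[of _ "1/B"] conjI ballI impI)
    show "1/B > 0" using B by simp
    fix x assume x: "x \<in> Rd d" and small: "\<forall>i<d. \<bar>Poly_Mapping.lookup x i\<bar> < 1/B"
    have "(\<Sum>j<d. \<bar>pairing d (X j) x\<bar>) \<le> (\<Sum>j<d. \<Sum>i<d. \<bar>Poly_Mapping.lookup (X j) i\<bar> * (1/B))"
    proof (rule sum_mono)
      fix j
      have "\<bar>pairing d (X j) x\<bar> \<le> (\<Sum>i<d. \<bar>Poly_Mapping.lookup (X j) i\<bar> * \<bar>Poly_Mapping.lookup x i\<bar>)"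
        unfolding pairing_def abs_mult[symmetric] by (rule sum_abs)
      also have "\<dots> \<le> (\<Sum>i<d. \<bar>Poly_Mapping.lookup (X j) i\<bar> * (1/B))"
        using small by (intro sum_mono mult_left_mono) (auto intro: less_imp_le)
      finally show "\<bar>pairing d (X j) x\<bar> \<le> (\<Sum>i<d. \<bar>Poly_Mapping.lookup (X j) i\<bar> * (1/B))" .
    qed
    also have "\<dots> = (B - 1) * (1/B)" by (simp add: B_def sum_distrib_right sum_divide_distrib)
    also have "\<dots> \<le> 1" using B by (simp add: field_simps)
    finally show "x \<in> cross d v" using x by (simp add: cross_eq)
  qed
qed

text \<open>A half-space that contains all \<open>v j\<close> and \<open>- v j\<close> contains
  their hull. The polar of the l1-ball is thus a cube in the coordinates
  \<open>pairing d x (v j)\<close>.\<close>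

lemma dual_cross: "dual d (cross d v) = {x \<in> Rd d. \<forall>j<d. \<bar>pairing d x (v j)\<bar> \<le> 1}"
proof (intro subset_antisym subsetI)
  fix x assume x: "x \<in> dual d (cross d v)"
  have "v j \<in> cross d v" "- v j \<in> cross d v" if "j < d" for j
    using that unfolding cross_def by (auto intro!: hull_inc)
  then have "pairing d x (v j) \<ge> -1" "pairing d x (- v j) \<ge> -1" if "j < d" for j
    using x that unfolding dual_def by blast+
  then show "x \<in> {x \<in> Rd d. \<forall>j<d. \<bar>pairing d x (v j)\<bar> \<le> 1}"
    using x by (auto simp: dual_def pairing_simps abs_le_iff minus_le_iff)
next
  fix x assume x: "x \<in> {x \<in> Rd d. \<forall>j<d. \<bar>pairing d x (v j)\<bar> \<le> 1}"
  have "cross d v \<subseteq> {y. pairing d x y \<ge> -1}"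
    unfolding cross_def
  proof (rule hull_minimal)
    show "convex {y. pairing d x y \<ge> -1}"
      using convex_linear_vimage[OF linear_pairing, of "{-1..}" d x] by (simp add: vimage_def)
  qed (use x in \<open>auto simp: pairing_simps abs_le_iff\<close>)
  then show "x \<in> dual d (cross d v)" using x by (auto simp: dual_def)
qed

text \<open>A cube is the hull of its corners. The induction pushes the coordinates to 1 or -1 one
  at a time; \<open>n\<close> bounds the indices at which this is still to be done.\<close>

lemma dual_cross_eq_hull:
  "dual d (cross d v) = convex hull {\<Sum>j<d. e j *\<^sub>R X j |e. \<forall>j<d. e j = 1 \<or> e j = -1}"
  (is "_ = convex hull ?T")
proof
  have "(\<Sum>j<d. t j *\<^sub>R X j) \<in> convex hull ?T"
    if "\<forall>j<n. \<bar>t j\<bar> \<le> 1" "\<forall>j. n \<le> j \<and> j < d \<longrightarrow> t j = 1 \<or> t j = -1" for t n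
    using that
  proof (induction n arbitrary: t)
    case 0
    then show ?case by (auto intro!: hull_inc)
  next
    case (Suc n)
    \<comment> \<open>This weight solves \<open>p * 1 + (1 - p) * (-1) = t n\<close>.\<close>
    define p where "p = (1 + t n) / 2"
    have p: "0 \<le> p" "p \<le> 1" using Suc.prems(1)[rule_format, of n] by (auto simp: p_def abs_le_iff)
    have a: "(\<Sum>j<d. (t(n := 1)) j *\<^sub>R X j) \<in> convex hull ?T"
      by (rule Suc.IH) (use Suc.prems in \<open>auto simp: less_Suc_eq Suc_le_eq\<close>)
    have b: "(\<Sum>j<d. (t(n := -1)) j *\<^sub>R X j) \<in> convex hull ?T"
      by (rule Suc.IH) (use Suc.prems in \<open>auto simp: less_Suc_eq Suc_le_eq\<close>)
    have "p *\<^sub>R (\<Sum>j<d. (t(n := 1)) j *\<^sub>R X j) + (1 - p) *\<^sub>R (\<Sum>j<d. (t(n := -1)) j *\<^sub>R X j) \<in> convex hull ?T"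
      using convexD[OF convex_convex_hull a b, of p "1 - p"] p by simp
    also have "p *\<^sub>R (\<Sum>j<d. (t(n := 1)) j *\<^sub>R X j) + (1 - p) *\<^sub>R (\<Sum>j<d. (t(n := -1)) j *\<^sub>R X j)
        = (\<Sum>j<d. t j *\<^sub>R X j)"
      unfolding scaleR_right.sum sum.distrib[symmetric] scaleR_scaleR scaleR_left_distrib[symmetric]
      by (rule sum.cong) (auto simp: p_def field_simps)
    finally show ?case .
  qed
  note comb = this
  show "dual d (cross d v) \<subseteq> convex hull ?T"
  proof
    fix x assume x: "x \<in> dual d (cross d v)"
    have "(\<Sum>j<d. pairing d x (v j) *\<^sub>R X j) \<in> convex hull ?T"
      by (rule comb[of d]) (use x in \<open>auto simp: dual_cross\<close>)
    then show "x \<in> convex hull ?T" using dual_expand[of x] x by (simp add: dual_cross)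
  qed
  have "?T \<subseteq> dual d (cross d v)"
  proof
    fix x assume "x \<in> ?T"
    then obtain e where e: "x = (\<Sum>j<d. e j *\<^sub>R X j)" "\<forall>j<d. e j = 1 \<or> e j = -1" by auto
    have "pairing d x (v i) = e i" if "i < d" for i
      using that by (simp add: e(1) dual_pair_comb)
    then show "x \<in> dual d (cross d v)"
      unfolding dual_cross using e X_Rd by (auto intro!: Rd_lincomb)
  qed
  moreover have "convex (dual d (cross d v))"
  proof -
    have "dual d (cross d v) = Rd d \<inter> (\<Inter>y\<in>cross d v. (\<lambda>x. pairing d x y) -` {-1..})"
      by (auto simp: dual_def)
    moreover have "convex (Rd d \<inter> (\<Inter>y\<in>cross d v. (\<lambda>x. pairing d x y) -` {-1..}))"
      by (intro convex_Int convex_INT convex_linear_vimage linear_pairing_left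
          subspace_imp_convex[OF subspace_Rd] convex_real_interval)
    ultimately show ?thesis by simp
  qed
  ultimately show "convex hull ?T \<subseteq> dual d (cross d v)" by (rule hull_minimal)
qed

text \<open>At a corner every coordinate is extremal, hence constant along any segment through it.
  Extreme points belong to every generating set, which is how the lattice condition on the dual
  reaches each signed sum.\<close>

lemma extreme_point_dual:
  assumes e: "\<And>j. j < d \<Longrightarrow> e j = 1 \<or> e j = -1"
  shows "(\<Sum>j<d. e j *\<^sub>R X j) extreme_point_of dual d (cross d v)"
  unfolding extreme_point_of_def
proof (intro conjI ballI)
  show "(\<Sum>j<d. e j *\<^sub>R X j) \<in> dual d (cross d v)"
    unfolding dual_cross_eq_hull using e by (intro hull_inc) auto
  fix a b assume ab: "a \<in> dual d (cross d v)" "b \<in> dual d (cross d v)"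
  show "(\<Sum>j<d. e j *\<^sub>R X j) \<notin> open_segment a b"
  proof
    assume "(\<Sum>j<d. e j *\<^sub>R X j) \<in> open_segment a b"
    then obtain u where u: "0 < u" "u < 1" "(\<Sum>j<d. e j *\<^sub>R X j) = (1 - u) *\<^sub>R a + u *\<^sub>R b" and "a \<noteq> b"
      by (auto simp: in_segment)
    have "pairing d a (v i) = pairing d b (v i)" if "i < d" for i
    proof -
      have le: "e i * pairing d x (v i) \<le> 1" if "x \<in> dual d (cross d v)" for x
        using that e[of i] \<open>i < d\<close> by (auto simp: dual_cross abs_le_iff)
      have "pairing d (\<Sum>j<d. e j *\<^sub>R X j) (v i) = e i"
        using that by (simp add: dual_pair_comb)
      then have "e i * ((1 - u) * pairing d a (v i) + u * pairing d b (v i)) = e i * e i"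
        unfolding u(3) by (simp add: pairing_simps)
      also have "e i * e i = 1" using e[OF that] by auto
      finally have "(1 - u) * (e i * pairing d a (v i)) + u * (e i * pairing d b (v i)) = 1"
        by (simp add: algebra_simps)
      then have "e i * pairing d a (v i) = 1" "e i * pairing d b (v i) = 1"
        using convex_comb_eq_one[OF u(1,2) le[OF ab(1)] le[OF ab(2)]] by auto
      then show ?thesis using e[OF that] by auto
    qed
    then have "(\<Sum>j<d. pairing d a (v j) *\<^sub>R X j) = (\<Sum>j<d. pairing d b (v j) *\<^sub>R X j)" by simp
    moreover have "a \<in> Rd d" "b \<in> Rd d" using ab by (auto simp: dual_def)
    ultimately show False using dual_expand[of a] dual_expand[of b] \<open>a \<noteq> b\<close> by simp
  qed
qed

end

section \<open>Facets and reflexivity\<close>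

text \<open>If a generator \<open>w\<close> outside \<open>F\<close> had positive weight in
  \<open>x\<close>, then \<open>x\<close> would lie strictly between \<open>w\<close> and the
  renormalised remainder \<open>y\<close>, and the face property would force \<open>w\<close> into
  \<open>F\<close>.\<close>

lemma face_subset_hull:
  assumes F: "F face_of convex hull W" and W: "finite W"
  shows "F \<subseteq> convex hull (W \<inter> F)"
proof
  fix x assume x: "x \<in> F"
  then have "x \<in> convex hull W" using F face_of_imp_subset by blast
  then obtain u where u: "\<And>w. w \<in> W \<Longrightarrow> 0 \<le> u w" "sum u W = 1" "(\<Sum>w\<in>W. u w *\<^sub>R w) = x"
    using W by (auto simp: convex_hull_finite)
  have zero: "u w = 0" if w: "w \<in> W - F" for w
  proof (rule ccontr)
    assume "u w \<noteq> 0"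
    then have pos: "u w > 0" using u(1) w by force
    have "w \<in> W" using w by simp
    have rest: "sum u (W - {w}) = 1 - u w"
      using u(2) sum.remove[OF W \<open>w \<in> W\<close>, of u] by simp
    have split: "x = u w *\<^sub>R w + (\<Sum>z\<in>W - {w}. u z *\<^sub>R z)"
      using u(3) sum.remove[OF W \<open>w \<in> W\<close>, of "\<lambda>z. u z *\<^sub>R z"] by simp
    have "x \<noteq> w" using x w by blast
    have "sum u (W - {w}) \<noteq> 0"
    proof
      assume 0: "sum u (W - {w}) = 0"
      then have "\<forall>z\<in>W - {w}. u z = 0" using u(1) W by (subst (asm) sum_nonneg_eq_0_iff) auto
      then show False using split 0 rest \<open>x \<noteq> w\<close> by simp
    qed
    moreover have "sum u (W - {w}) \<ge> 0" using u(1) by (intro sum_nonneg) auto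
    ultimately have lt: "1 - u w > 0" using rest by linarith
    define y where "y = (\<Sum>z\<in>W - {w}. (u z / (1 - u w)) *\<^sub>R z)"
    have "y \<in> convex hull W"
      unfolding y_def
    proof (rule convex_sum)
      show "(\<Sum>z\<in>W - {w}. u z / (1 - u w)) = 1"
        using rest lt by (simp add: sum_divide_distrib[symmetric])
    qed (use W u(1) lt in \<open>auto intro: hull_inc\<close>)
    moreover have xy: "x = u w *\<^sub>R w + (1 - u w) *\<^sub>R y"
      using split lt by (simp add: y_def scaleR_right.sum)
    moreover have "w \<noteq> y"
    proof
      assume "w = y"
      then have "x = w" using xy by (simp add: algebra_simps)
      then show False using \<open>x \<noteq> w\<close> by simp
    qed
    moreover have "x \<in> open_segment y w"
      unfolding in_segment using xy pos lt \<open>w \<noteq> y\<close> by (auto intro!: exI[of _ "u w"])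
    ultimately have "w \<in> F"
      using face_ofD[OF F, of x y w] x w hull_inc[of w W convex] by blast
    then show False using w by blast
  qed
  have "x = (\<Sum>w\<in>W \<inter> F. u w *\<^sub>R w)"
    unfolding u(3)[symmetric] using W zero by (intro sum.mono_neutral_right) auto
  moreover have "sum u (W \<inter> F) = 1"
    unfolding u(2)[symmetric] using W zero by (intro sum.mono_neutral_left) auto
  ultimately show "x \<in> convex hull (W \<inter> F)"
    using W u(1) by (auto intro!: convex_sum convex_convex_hull intro: hull_inc)
qed

text \<open>Translating by a point of \<open>S\<close> and by a point of \<open>G\<close> turns this
  into the linear bound of an independent set by a spanning set; both cardinalities drop by one. It
  bounds the number of vertices of a facet from below.\<close>

lemma card_le_if_affine_independent_in_hull:
  fixes S G :: "'a::real_vector set"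
  assumes S: "\<not> affine_dependent S" "S \<noteq> {}" "S \<subseteq> convex hull G" and G: "finite G"
  shows "card S \<le> card G"
proof -
  obtain s where s: "s \<in> S" using S by auto
  then have "G \<noteq> {}" using S(3) by auto
  then obtain a where a: "a \<in> G" by auto
  let ?T = "(\<lambda>x. - a + x) ` (G - {a})"
  have "affine hull G = (\<lambda>x. a + x) ` span ?T"
    using affine_hull_insert_span_gen[of a "G - {a}"] a by (simp add: insert_absorb)
  then have span: "x - a \<in> span ?T" if "x \<in> S" for x
    using that S(3) convex_hull_subset_affine_hull[of G] by fastforce
  have sub: "(\<lambda>x. - s + x) ` (S - {s}) \<subseteq> span ?T"
  proof
    fix y assume "y \<in> (\<lambda>x. - s + x) ` (S - {s})"
    then obtain x where x: "x \<in> S" "y = - s + x" by auto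
    have "y = (x - a) - (s - a)" using x by simp
    then show "y \<in> span ?T" using span x s by (simp only: span_diff)
  qed
  have ind: "independent ((\<lambda>x. - s + x) ` (S - {s}))"
    using S(1) s affine_dependent_iff_dependent2 by blast
  have "finite ((\<lambda>x. - s + x) ` (S - {s})) \<and> card ((\<lambda>x. - s + x) ` (S - {s})) \<le> card ?T"
    using independent_span_bound[OF _ ind sub] G by simp
  then have "finite (S - {s})" "card (S - {s}) \<le> card (G - {a})"
    using card_image_le[of "G - {a}" "\<lambda>x. - a + x"] G
    by (auto simp: finite_image_iff card_image inj_on_def)
  then show ?thesis
    using s a G by (simp add: card_Diff_singleton) (metis G a card_gt_0_iff empty_iff le_diff_iff Suc_leI One_nat_def finite_Diff_insert infinite_remove finite_insert)
qed

context dual_bases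
begin

text \<open>By central symmetry a face through 0 is the whole polytope. A facet thus misses 0 and
  contains at most one point of each antipodal pair, while its \<open>d\<close> affinely independent
  points need \<open>d\<close> generators; so it takes exactly one from each pair.\<close>

lemma facet_vertices:
  assumes F: "is_facet d F (cross d v)"
  obtains e :: "nat \<Rightarrow> int" where "\<And>j. j < d \<Longrightarrow> e j = 1 \<or> e j = -1"
    and "vertices F = (\<lambda>j. e j *\<^sub>R v j) ` {..<d}"
proof -
  let ?P = "cross d v" and ?W = "v ` {..<d} \<union> uminus ` v ` {..<d}"
  obtain S where face: "F face_of ?P" and ne: "F \<noteq> ?P" and S: "S \<subseteq> F" "card S = d" "\<not> affine_dependent S"
    using F by (auto simp: is_facet_def)
  have sub: "F \<subseteq> ?P" using face face_of_imp_subset by blast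
  have zero: "0 \<notin> F"
  proof
    assume "0 \<in> F"
    have "x \<in> F" if x: "x \<in> ?P" for x
    proof (cases "x = 0")
      case False
      have "- x \<in> ?P" using x by (auto simp: cross_eq pairing_simps intro!: subspace_neg[OF subspace_Rd])
      moreover have "0 \<in> open_segment x (- x)"
      proof -
        have "x \<noteq> - x"
        proof
          assume "x = - x"
          then have "2 *\<^sub>R x = 0" unfolding scaleR_2 by (metis add.left_inverse)
          then show False using False by simp
        qed
        then have "midpoint x (- x) \<in> open_segment x (- x)" by simp
        then show ?thesis by (simp add: midpoint_def)
      qed
      ultimately show ?thesis using face_ofD[OF face, of 0 x "- x"] x \<open>0 \<in> F\<close> by blast
    qed (use \<open>0 \<in> F\<close> in simp)
    then show False using ne sub by blast
  qed
  have not_both: "- v j \<notin> F" if "v j \<in> F" for j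
  proof
    assume "- v j \<in> F"
    then have "(1/2) *\<^sub>R v j + (1/2) *\<^sub>R (- v j) \<in> F"
      using that face_of_imp_convex[OF face] by (intro convexD) auto
    then show False using zero by simp
  qed
  define J where "J = {j. j < d \<and> (v j \<in> F \<or> - v j \<in> F)}"
  define e :: "nat \<Rightarrow> int" where "e j = (if v j \<in> F then 1 else -1)" for j
  have Jd: "J \<subseteq> {..<d}" by (auto simp: J_def)
  have G: "?W \<inter> F = (\<lambda>j. e j *\<^sub>R v j) ` J"
  proof (intro subset_antisym subsetI)
    fix x assume "x \<in> ?W \<inter> F"
    then obtain j where "j < d" "x = v j \<or> x = - v j" "x \<in> F" by auto
    then have "j \<in> J" "x = e j *\<^sub>R v j" using not_both[of j] by (auto simp: J_def e_def)
    then show "x \<in> (\<lambda>j. e j *\<^sub>R v j) ` J" by blast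
  next
    fix x assume "x \<in> (\<lambda>j. e j *\<^sub>R v j) ` J"
    then show "x \<in> ?W \<inter> F" by (auto simp: J_def e_def)
  qed
  have "F \<subseteq> convex hull (?W \<inter> F)"
    using face unfolding cross_def by (rule face_subset_hull) auto
  then have "d \<le> card (?W \<inter> F)"
    using card_le_if_affine_independent_in_hull[of S "?W \<inter> F"] S d_pos by fastforce
  also have "\<dots> \<le> card J"
    unfolding G using Jd by (intro card_image_le) (auto intro: finite_subset)
  finally have "J = {..<d}"
    using Jd by (intro card_subset_eq) (auto intro: order_antisym card_mono[of "{..<d}" J, simplified])
  have "vertices F = ?W \<inter> F"
    using vertices_cross extreme_point_of_face[OF face] unfolding vertices_def by blast
  with G \<open>J = {..<d}\<close> have "vertices F = (\<lambda>j. e j *\<^sub>R v j) ` {..<d}" by simp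
  then show thesis by (intro that[of e]) (auto simp: e_def)
qed

lemma independent_v: "independent (v ` {..<d})"
proof (rule independent_if_scalars_zero)
  fix f x assume 0: "(\<Sum>x\<in>v ` {..<d}. f x *\<^sub>R x) = 0" and "x \<in> v ` {..<d}"
  then obtain i where i: "i < d" "x = v i" by auto
  have "(\<Sum>j<d. f (v j) *\<^sub>R v j) = 0"
    using 0 by (simp add: sum.reindex[OF v_inj])
  then show "f x = 0" using pair_comb[of i "\<lambda>j. f (v j)"] i by (simp add: pairing_simps)
qed simp

lemma cs_cross_cross: "cs_cross d (cross d v)"
  unfolding cs_cross_def
proof (intro exI[of _ "v ` {..<d}"] conjI)
  show "v ` {..<d} \<subseteq> Rd d" using v_Rd by auto
  show "card (v ` {..<d}) = d" by (simp add: card_image v_inj)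
  show "\<not> affine_dependent (v ` {..<d})"
    using independent_v affine_dependent_imp_dependent by blast
  show "0 \<notin> convex hull (v ` {..<d})"
  proof
    \<comment> \<open>This functional takes the value 1 on every \<open>v j\<close>, so its level
      set separates the hull from 0.\<close>
    define s where "s = (\<Sum>j<d. X j)"
    have "pairing d s (v j) = 1" if "j < d" for j
      using dual_pair_comb[OF that, of "\<lambda>_. 1"] by (simp add: s_def)
    then have "convex hull (v ` {..<d}) \<subseteq> pairing d s -` {1}"
      by (intro hull_minimal convex_linear_vimage linear_pairing) auto
    moreover assume "0 \<in> convex hull (v ` {..<d})"
    ultimately show False by (auto simp: pairing_simps)
  qed
qed (simp add: cross_def)

end

text \<open>\<open>2 * h\<close> is the sum of the rows of \<open>Y\<close>, so \<open>h\<close> is the vertex of the dual polytope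
  that belongs to the facet spanned by the columns of \<open>V\<close>.\<close>

definition half_inverse :: "nat \<Rightarrow> imat \<Rightarrow> imat \<Rightarrow> bool" where
  "half_inverse d V Y \<longleftrightarrow> (\<forall>i<d. \<forall>k<d.
      (\<Sum>j<d. V i j * Y j k) = (if i = k then 2 else 0) \<and>
      (\<Sum>j<d. Y i j * V j k) = (if i = k then 2 else 0))"

definition reflexive_mat :: "nat \<Rightarrow> imat \<Rightarrow> bool" where
  "reflexive_mat d V \<longleftrightarrow> (\<exists>Y h. half_inverse d V Y \<and> (\<forall>k<d. (\<Sum>j<d. Y j k) = 2 * h k))"

lemma dual_bases_half_inverse:
  assumes d: "d \<ge> 1" and Y: "half_inverse d V Y"
  shows "dual_bases d (col d V) (\<lambda>j. vec d (\<lambda>k. Y j k / 2))"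
proof
  fix i j assume ij: "i < d" "j < d"
  have "pairing d (vec d (\<lambda>k. Y i k / 2)) (col d V j) = (\<Sum>k<d. real_of_int (Y i k * V k j)) / 2"
    by (simp add: pairing_def col_def lookup_vec sum_divide_distrib)
  also have "\<dots> = (if i = j then 1 else 0)"
    using Y ij unfolding half_inverse_def of_int_sum[symmetric] by simp
  finally show "pairing d (vec d (\<lambda>k. Y i k / 2)) (col d V j) = (if i = j then 1 else 0)" .
next
  fix x assume x: "x \<in> Rd d"
  show "x = (\<Sum>j<d. pairing d (vec d (\<lambda>k. Y j k / 2)) x *\<^sub>R col d V j)"
  proof (rule pt_eqI[OF x])
    fix i assume i: "i < d"
    have "Poly_Mapping.lookup (\<Sum>j<d. pairing d (vec d (\<lambda>k. Y j k / 2)) x *\<^sub>R col d V j) i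
        = (\<Sum>j<d. \<Sum>k<d. V i j * Y j k * (Poly_Mapping.lookup x k / 2))"
      using i by (simp add: lookup_pt pairing_def col_def sum_distrib_right sum_distrib_left mult_ac)
    also have "\<dots> = (\<Sum>k<d. real_of_int (\<Sum>j<d. V i j * Y j k) * (Poly_Mapping.lookup x k / 2))"
      by (subst sum.swap) (simp add: sum_distrib_right sum_divide_distrib)
    also have "\<dots> = (\<Sum>k<d. (if i = k then 1 else 0) * Poly_Mapping.lookup x k)"
      by (rule sum.cong) (use Y i in \<open>auto simp: half_inverse_def\<close>)
    also have "\<dots> = Poly_Mapping.lookup x i" using i by (rule sum_delta_mult)
    finally show "Poly_Mapping.lookup x i =
        Poly_Mapping.lookup (\<Sum>j<d. pairing d (vec d (\<lambda>k. Y j k / 2)) x *\<^sub>R col d V j) i" ..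
  qed (auto intro!: Rd_lincomb simp: col_def)
qed (use d in \<open>auto simp: col_def\<close>)

lemma lattice_pt_col: "lattice_pt d (col d V j)"
  by (auto simp: lattice_pt_def col_def lookup_vec)

lemma lattice_pt_uminus: "lattice_pt d x \<Longrightarrow> lattice_pt d (- x)"
  by (auto simp: lattice_pt_def lookup_uminus intro: subspace_neg[OF subspace_Rd])

lemma primitive_uminus: "primitive d x \<Longrightarrow> primitive d (- x)"
  unfolding primitive_def using lattice_pt_uminus
  by (metis add.inverse_inverse neg_equal_0_iff_equal scaleR_minus_right)

text \<open>All dual vertices are congruent modulo the integral rows of \<open>Y\<close>, and the
  one with all signs positive is \<open>h\<close>, so all of them are lattice points.\<close>

lemma reflexive_PA:
  assumes d: "d \<ge> 1" and V: "reflexive_mat d V"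
  shows "reflexive d (PA d V)" "cs_cross d (PA d V)"
proof -
  obtain Y h where Y: "half_inverse d V Y" and h: "\<And>k. k < d \<Longrightarrow> (\<Sum>j<d. Y j k) = 2 * h k"
    using V by (auto simp: reflexive_mat_def)
  define X where "X j = vec d (\<lambda>k. Y j k / 2)" for j
  interpret dual_bases d "col d V" X
    unfolding X_def by (rule dual_bases_half_inverse[OF d Y])
  show "cs_cross d (PA d V)" unfolding PA_cross by (rule cs_cross_cross)
  have prim: "primitive d (col d V j)" if j: "j < d" for j
    unfolding primitive_def
  proof (intro conjI notI)
    show "col d V j = 0 \<Longrightarrow> False"
      using pair[OF j j] by (simp add: pairing_simps)
    assume "\<exists>k::int. k > 1 \<and> (\<exists>w. lattice_pt d w \<and> col d V j = of_int k *\<^sub>R w)"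
    then obtain k :: int and w where k: "k > 1" "lattice_pt d w" "col d V j = of_int k *\<^sub>R w" by auto
    \<comment> \<open>The integral dual vertex, equal to 1 on each column. A column divisible by
      \<open>k > 1\<close> would make 1 a multiple of \<open>k\<close>, so columns are
      primitive.\<close>
    define hh where "hh = vec d (\<lambda>k. real_of_int (h k))"
    have "hh = (\<Sum>j<d. 1 *\<^sub>R X j)"
    proof (rule pt_eqI[of _ d])
      fix k assume "k < d"
      then show "Poly_Mapping.lookup hh k = Poly_Mapping.lookup (\<Sum>j<d. 1 *\<^sub>R X j) k"
        using h[of k] by (simp add: hh_def X_def lookup_pt sum_divide_distrib[symmetric] flip: of_int_sum)
    qed (simp add: hh_def, rule Rd_lincomb, simp add: X_Rd)
    then have "1 = pairing d hh (col d V j)"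
      using dual_pair_comb[OF j, of "\<lambda>_. 1"] by simp
    also have "\<dots> = of_int k * pairing d hh w" by (simp add: k(3) pairing_simps)
    finally have 1: "1 = of_int k * pairing d hh w" .
    have "pairing d hh w \<in> \<int>"
      using k(2) by (auto simp: pairing_def hh_def lookup_vec lattice_pt_def)
    then obtain z where "pairing d hh w = of_int z" by (auto simp: Ints_def)
    then have "real_of_int (k * z) = real_of_int 1" using 1 by simp
    then have "k * z = 1" by (simp only: of_int_eq_iff)
    then show False using k(1) zmult_eq_1_iff by auto
  qed (rule lattice_pt_col)
  let ?T = "{\<Sum>j<d. e j *\<^sub>R X j |e. \<forall>j<d. e j = 1 \<or> e j = -1}"
  \<comment> \<open>Indexing sign vectors by subsets of \<open>{..<d}\<close> makes the generating
    set visibly finite.\<close>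
  have T: "?T = (\<lambda>E. \<Sum>j<d. (if j \<in> E then 1 else -1) *\<^sub>R X j) ` Pow {..<d}" (is "_ = ?T'")
  proof (intro subset_antisym subsetI)
    fix x assume "x \<in> ?T"
    then obtain e where e: "x = (\<Sum>j<d. e j *\<^sub>R X j)" "\<forall>j<d. e j = 1 \<or> e j = -1" by auto
    have "x = (\<Sum>j<d. (if j \<in> {j. j < d \<and> e j = 1} then 1 else -1) *\<^sub>R X j)"
      unfolding e(1) by (rule sum.cong) (use e(2) in auto)
    then show "x \<in> ?T'" by blast
  next
    fix x assume "x \<in> ?T'"
    then obtain E where E: "x = (\<Sum>j<d. (if j \<in> E then 1 else -1) *\<^sub>R X j)" by auto
    show "x \<in> ?T"
      unfolding E by (intro CollectI exI[of _ "\<lambda>j. if j \<in> E then 1 else -1"] conjI) auto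
  qed
  have lat: "lattice_pt d (\<Sum>j<d. (if j \<in> E then 1 else -1) *\<^sub>R X j)" (is "lattice_pt d ?x") for E
    unfolding lattice_pt_def
  proof (intro conjI allI)
    show R: "?x \<in> Rd d" by (intro Rd_lincomb X_Rd) auto
    fix k
    show "Poly_Mapping.lookup ?x k \<in> \<int>"
    proof (cases "k < d")
      case True
      have "Poly_Mapping.lookup ?x k = (\<Sum>j<d. Y j k / 2 - (if j \<in> E then 0 else real_of_int (Y j k)))"
        unfolding lookup_sum X_def by (rule sum.cong) (use True in \<open>auto simp: lookup_pt\<close>)
      also have "\<dots> = real_of_int (\<Sum>j<d. Y j k) / 2 - (\<Sum>j<d. if j \<in> E then 0 else real_of_int (Y j k))"
        by (simp add: sum_subtractf sum_divide_distrib)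
      also have "\<dots> = real_of_int (h k) - (\<Sum>j<d. if j \<in> E then 0 else real_of_int (Y j k))"
        using h[OF True] by simp
      also have "\<dots> \<in> \<int>" by (intro Ints_diff Ints_sum) auto
      finally show ?thesis .
    qed (use R in \<open>auto simp: Rd_def\<close>)
  qed
  have "lattice_polytope d (dual d (cross d (col d V)))"
    unfolding lattice_polytope_def dual_cross_eq_hull T
    by (intro exI[of _ "?T'"] conjI) (use lat in auto)
  moreover have "lattice_polytope d (cross d (col d V))"
    unfolding lattice_polytope_def cross_def
    by (rule exI[of _ "col d V ` {..<d} \<union> uminus ` col d V ` {..<d}"])
      (use d lattice_pt_col lattice_pt_uminus in \<open>auto simp: lessThan_empty_iff\<close>)
  moreover have "\<forall>v\<in>vertices (cross d (col d V)). primitive d v"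
    unfolding vertices_cross using prim primitive_uminus by auto
  ultimately show "reflexive d (PA d V)"
    unfolding reflexive_def fano_def PA_cross using cross_subset_Rd zero_in_interior_cross by blast
qed

text \<open>The interior condition makes the \<open>d\<close> generators a basis, with a real dual
  basis at first. Integrality comes afterwards: for the generators because they are vertices, for
  \<open>2 X j\<close> as a difference of two vertices of the dual.\<close>

lemma reflexive_cs_crossE:
  assumes d: "d \<ge> 1" and P: "reflexive d P" "cs_cross d P"
  obtains V where "reflexive_mat d V" "P = PA d V"
proof -
  obtain B where B: "B \<subseteq> Rd d" "card B = d" and PB: "P = convex hull (B \<union> uminus ` B)"
    using P(2) by (auto simp: cs_cross_def)
  have finB: "finite B" using B(2) d card.infinite by fastforce
  obtain v where "bij_betw v {0..<d} B"
    using ex_bij_betw_nat_finite[OF finB] B(2) by auto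
  then have v: "inj_on v {..<d}" "v ` {..<d} = B"
    by (auto simp: bij_betw_def atLeast0LessThan)
  \<comment> \<open>Coordinate unit vectors. A small multiple of each lies in \<open>P\<close>, so
    they lie in the span of \<open>B\<close>; these \<open>d\<close> independent vectors leave no
    room for a dependency among the \<open>d\<close> points of \<open>B\<close>.\<close>
  define u where "u k = vec d (\<lambda>i. if i = k then 1 else 0)" for k
  have Rd_u: "x = (\<Sum>k<d. Poly_Mapping.lookup x k *\<^sub>R u k)" if "x \<in> Rd d" for x
  proof (rule pt_eqI[OF that])
    show "(\<Sum>k<d. Poly_Mapping.lookup x k *\<^sub>R u k) \<in> Rd d" by (rule Rd_lincomb) (simp add: u_def)
    show "Poly_Mapping.lookup x i = Poly_Mapping.lookup (\<Sum>k<d. Poly_Mapping.lookup x k *\<^sub>R u k) i" if "i < d" for i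
      using that by (simp add: u_def lookup_pt sum_delta_mult)
  qed
  have PspanB: "P \<subseteq> span B"
    unfolding PB by (intro hull_minimal subspace_imp_convex subspace_span) (auto intro: span_base span_neg)
  obtain e where e: "e > 0" "\<And>x. x \<in> Rd d \<Longrightarrow> (\<forall>i<d. \<bar>Poly_Mapping.lookup x i\<bar> < e) \<Longrightarrow> x \<in> P"
    using P(1) by (auto simp: reflexive_def fano_def zero_in_interior_def)
  have u_span: "u k \<in> span B" for k
  proof -
    have "(e/2) *\<^sub>R u k \<in> P"
      using e(1) by (intro e(2)) (auto simp: u_def lookup_pt intro!: subspace_scale subspace_Rd)
    then have "(2/e) *\<^sub>R ((e/2) *\<^sub>R u k) \<in> span B" using PspanB span_scale by blast
    then show ?thesis using e(1) by simp
  qed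
  have u_inj: "inj_on u {..<d}"
  proof (rule inj_onI)
    fix i j assume "i \<in> {..<d}" "j \<in> {..<d}" "u i = u j"
    then have "Poly_Mapping.lookup (u i) i = Poly_Mapping.lookup (u j) i" "i < d" by auto
    then show "i = j" by (simp add: u_def lookup_vec split: if_splits)
  qed
  have u_ind: "independent (u ` {..<d})"
  proof (rule independent_if_scalars_zero)
    fix f x assume 0: "(\<Sum>x\<in>u ` {..<d}. f x *\<^sub>R x) = 0" and "x \<in> u ` {..<d}"
    then obtain i where i: "i < d" "x = u i" by auto
    have "Poly_Mapping.lookup (\<Sum>j<d. f (u j) *\<^sub>R u j) i = 0"
      using 0 by (simp add: sum.reindex[OF u_inj])
    then show "f x = 0" using i by (simp add: u_def lookup_pt sum_delta_mult)
  qed simp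
  have ind: "independent B"
  proof
    assume "dependent B"
    then obtain a where a: "a \<in> B" "a \<in> span (B - {a})" by (auto simp: dependent_def)
    then have "span (B - {a}) = span B" by (metis insert_Diff span_redundant)
    then have "u ` {..<d} \<subseteq> span (B - {a})" using u_span by auto
    then have "card (u ` {..<d}) \<le> card (B - {a})"
      using independent_span_bound[OF _ u_ind] finB by blast
    then show False using a finB B(2) d by (simp add: card_image u_inj)
  qed
  have spanB: "x \<in> span B" if "x \<in> Rd d" for x
    by (subst Rd_u[OF that]) (intro span_sum span_scale u_span)
  \<comment> \<open>Entry \<open>k\<close> is the value of the coordinate functional of
    \<open>v j\<close> at the unit vector \<open>u k\<close>, so pairing with \<open>X j\<close>
    reads off that coordinate.\<close>
  define X where "X j = vec d (\<lambda>k. representation B (u k) (v j))" for j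
  have pairX: "pairing d (X j) x = representation B x (v j)" if x: "x \<in> Rd d" for j x
  proof -
    have "representation B x (v j) = representation B (\<Sum>k<d. Poly_Mapping.lookup x k *\<^sub>R u k) (v j)"
      using Rd_u[OF x] by simp
    also have "\<dots> = (\<Sum>k<d. Poly_Mapping.lookup x k * representation B (u k) (v j))"
      by (simp add: representation_sum[OF ind] representation_scale[OF ind] u_span span_scale)
    finally show ?thesis by (simp add: pairing_def X_def lookup_vec mult.commute)
  qed
  interpret dual_bases d v X
  proof
    show vR: "v j \<in> Rd d" if "j < d" for j using that v B by auto
    show "pairing d (X i) (v j) = (if i = j then 1 else 0)" if "i < d" "j < d" for i j
    proof -
      have "v j \<in> B" using that v by auto
      then show ?thesis
        using that inj_onD[OF v(1), of i j] by (auto simp: pairX[OF vR] representation_basis[OF ind])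
    qed
    show "x = (\<Sum>j<d. pairing d (X j) x *\<^sub>R v j)" if x: "x \<in> Rd d" for x
    proof -
      have "x = (\<Sum>b\<in>B. representation B x b *\<^sub>R b)"
        using sum_representation_eq[OF ind spanB[OF x] finB] by simp
      also have "\<dots> = (\<Sum>j<d. representation B x (v j) *\<^sub>R v j)"
        using sum.reindex[OF v(1)] v(2) by (simp add: o_def)
      finally show ?thesis using pairX[OF x] by simp
    qed
  qed (use d in \<open>auto simp: X_def\<close>)
  have Pv: "P = cross d v" unfolding PB cross_def v(2) ..
  have v_lat: "lattice_pt d (v j)" if "j < d" for j
    using P(1) that vertices_cross unfolding reflexive_def fano_def primitive_def Pv by blast
  \<comment> \<open>The dual vertex with sign -1 exactly on \<open>E\<close>. The difference
    \<open>x {} - x {j}\<close> yields \<open>2 X j\<close>, and \<open>x {}\<close> becomes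
    \<open>h\<close>.\<close>
  define x where "x E = (\<Sum>j<d. (if j \<in> E then -1 else 1) *\<^sub>R X j)" for E :: "nat set"
  have x_lat: "lattice_pt d (x E)" for E
  proof -
    obtain T where T: "\<forall>t\<in>T. lattice_pt d t" "dual d P = convex hull T"
      using P(1) by (auto simp: reflexive_def lattice_polytope_def)
    have "x E extreme_point_of dual d (cross d v)"
      unfolding x_def by (rule extreme_point_dual) auto
    then have "x E \<in> T" using T(2) extreme_point_of_convex_hull unfolding Pv by metis
    then show ?thesis using T(1) by blast
  qed
  have X2: "2 *\<^sub>R X j = x {} - x {j}" if "j < d" for j
  proof -
    have "x {} - x {j} = (\<Sum>i<d. (if j = i then 1 else 0) *\<^sub>R (2 *\<^sub>R X i))"
      unfolding x_def sum_subtractf[symmetric] by (rule sum.cong) (auto simp: scaleR_2)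
    also have "\<dots> = (\<Sum>i<d. if j = i then 2 *\<^sub>R X i else 0)"
      by (rule sum.cong) auto
    finally show ?thesis using that by simp
  qed
  have X_int: "2 * Poly_Mapping.lookup (X j) k \<in> \<int>" if "j < d" for j k
  proof -
    have "2 * Poly_Mapping.lookup (X j) k = Poly_Mapping.lookup (2 *\<^sub>R X j) k"
      by (simp add: lookup_pt)
    also have "\<dots> = Poly_Mapping.lookup (x {}) k - Poly_Mapping.lookup (x {j}) k"
      unfolding X2[OF that] by (simp add: lookup_pt)
    also have "\<dots> \<in> \<int>" using x_lat unfolding lattice_pt_def by (intro Ints_diff) auto
    finally show ?thesis .
  qed
  \<comment> \<open>The floors only convert to type \<open>int\<close>; for column and row indices
    below \<open>d\<close> the values are integers already.\<close>
  define V :: imat where "V i j = \<lfloor>Poly_Mapping.lookup (v j) i\<rfloor>" for i j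
  define Y :: imat where "Y j k = \<lfloor>2 * Poly_Mapping.lookup (X j) k\<rfloor>" for j k
  define h :: "nat \<Rightarrow> int" where "h k = \<lfloor>Poly_Mapping.lookup (x {}) k\<rfloor>" for k
  have V: "real_of_int (V i j) = Poly_Mapping.lookup (v j) i" if "j < d" for i j
    using v_lat[OF that] by (simp add: V_def lattice_pt_def)
  have Y: "real_of_int (Y j k) = 2 * Poly_Mapping.lookup (X j) k" if "j < d" for j k
    using X_int[OF that, of k] by (simp add: Y_def)
  have h: "real_of_int (h k) = Poly_Mapping.lookup (x {}) k" for k
    using x_lat[of "{}"] by (simp add: h_def lattice_pt_def)
  have "half_inverse d V Y"
    unfolding half_inverse_def
  proof (intro allI impI conjI)
    fix i k assume ik: "i < d" "k < d"
    have "real_of_int (\<Sum>j<d. Y i j * V j k) = 2 * pairing d (X i) (v k)"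
      using ik by (simp add: V Y pairing_def sum_distrib_left mult_ac)
    also have "\<dots> = real_of_int (if i = k then 2 else 0)" using ik by (simp add: pair)
    finally show "(\<Sum>j<d. Y i j * V j k) = (if i = k then 2 else 0)" by (simp only: of_int_eq_iff)
    have "real_of_int (\<Sum>j<d. V i j * Y j k) = 2 * Poly_Mapping.lookup (\<Sum>j<d. pairing d (X j) (u k) *\<^sub>R v j) i"
    proof -
      have "pairing d (X j) (u k) = Poly_Mapping.lookup (X j) k" for j
        using ik(2) by (simp add: pairing_def u_def lookup_vec sum_delta_mult)
      then show ?thesis by (simp add: V Y lookup_pt sum_distrib_left mult_ac)
    qed
    also have "\<dots> = 2 * Poly_Mapping.lookup (u k) i"
      using expand[of "u k"] by (simp add: u_def)
    also have "\<dots> = real_of_int (if i = k then 2 else 0)" using ik by (simp add: u_def lookup_vec)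
    finally show "(\<Sum>j<d. V i j * Y j k) = (if i = k then 2 else 0)" by (simp only: of_int_eq_iff)
  qed
  moreover have "(\<Sum>j<d. Y j k) = 2 * h k" for k
  proof -
    have "real_of_int (\<Sum>j<d. Y j k) = real_of_int (2 * h k)"
      by (simp add: Y h x_def lookup_pt sum_distrib_left)
    then show ?thesis by (simp only: of_int_eq_iff)
  qed
  ultimately have "reflexive_mat d V" by (auto simp: reflexive_mat_def)
  moreover have "col d V j = v j" if "j < d" for j
    using that v_Rd by (intro pt_eqI[of _ d]) (auto simp: col_def lookup_vec V)
  then have "col d V ` {..<d} = v ` {..<d}" by (intro image_cong) auto
  then have "P = PA d V" unfolding Pv PA_cross cross_def by simp
  ultimately show thesis by (rule that)
qed

section \<open>Equivalence of integer matrices\<close>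

definition mmul :: "nat \<Rightarrow> imat \<Rightarrow> imat \<Rightarrow> imat" where
  "mmul d A B = (\<lambda>i j. \<Sum>k<d. A i k * B k j)"

definition idm :: imat where
  "idm = (\<lambda>i j. if i = j then 1 else 0)"

text \<open>Entries with an index of at least \<open>d\<close> are arbitrary, so laws that involve
  \<open>idm\<close> hold only in this sense, whereas \<open>mmul_assoc\<close> is a genuine
  equation.\<close>

definition eqm :: "nat \<Rightarrow> imat \<Rightarrow> imat \<Rightarrow> bool" where
  "eqm d A B \<longleftrightarrow> (\<forall>i<d. \<forall>j<d. A i j = B i j)"

lemma mmul_assoc: "mmul d (mmul d A B) C = mmul d A (mmul d B C)"
proof (intro ext)
  fix i j
  have "(\<Sum>k<d. \<Sum>l<d. A i l * B l k * C k j) = (\<Sum>l<d. \<Sum>k<d. A i l * B l k * C k j)"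
    by (rule sum.swap)
  then show "mmul d (mmul d A B) C i j = mmul d A (mmul d B C) i j"
    by (simp add: mmul_def sum_distrib_left sum_distrib_right mult.assoc)
qed

lemma mmul_cong: "eqm d A A' \<Longrightarrow> eqm d B B' \<Longrightarrow> eqm d (mmul d A B) (mmul d A' B')"
  by (simp add: eqm_def mmul_def)

lemma mmul_id: "eqm d (mmul d idm A) A" "eqm d (mmul d A idm) A"
  by (auto simp: eqm_def mmul_def idm_def sum_delta_mult)

lemma mmul_scale:
  "mmul d (\<lambda>i j. c * A i j) B = (\<lambda>i j. c * mmul d A B i j)"
  "mmul d A (\<lambda>i j. c * B i j) = (\<lambda>i j. c * mmul d A B i j)"
  by (simp_all add: mmul_def sum_distrib_left mult_ac)

lemma eqm_refl [simp]: "eqm d A A" by (simp add: eqm_def)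
lemma eqm_sym: "eqm d A B \<Longrightarrow> eqm d B A" by (simp add: eqm_def)
lemma eqm_trans [trans]: "eqm d A B \<Longrightarrow> eqm d B C \<Longrightarrow> eqm d A C" by (simp add: eqm_def)

lemma mmul_cancel:
  assumes "eqm d (mmul d W U) idm"
  shows "eqm d (mmul d W (mmul d U A)) A"
  unfolding mmul_assoc[symmetric] using mmul_cong[OF assms eqm_refl] mmul_id(1) eqm_trans by blast

section \<open>Unimodular matrices and matrix equivalence as a calculus of products\<close>

lemma unimodular_iff:
  "unimodular d U \<longleftrightarrow> (\<exists>W. eqm d (mmul d U W) idm \<and> eqm d (mmul d W U) idm)"
  unfolding unimodular_def eqm_def mmul_def idm_def by (rule ex_cong1) blast

lemma half_inverse_iff:
  "half_inverse d V Y \<longleftrightarrow>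
    eqm d (mmul d V Y) (\<lambda>i j. 2 * idm i j) \<and> eqm d (mmul d Y V) (\<lambda>i j. 2 * idm i j)"
  by (auto simp: half_inverse_def eqm_def mmul_def idm_def)

lemma unimodular_mmul:
  assumes "unimodular d U" "unimodular d U'"
  shows "unimodular d (mmul d U U')"
proof -
  obtain W W' where W: "eqm d (mmul d U W) idm" "eqm d (mmul d W U) idm"
    and W': "eqm d (mmul d U' W') idm" "eqm d (mmul d W' U') idm"
    using assms unfolding unimodular_iff by blast
  have "eqm d (mmul d (mmul d U U') (mmul d W' W)) (mmul d U W)"
    unfolding mmul_assoc by (intro mmul_cong eqm_refl mmul_cancel W')
  moreover have "eqm d (mmul d (mmul d W' W) (mmul d U U')) (mmul d W' U')"
    unfolding mmul_assoc by (intro mmul_cong eqm_refl mmul_cancel W)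
  ultimately show ?thesis
    unfolding unimodular_iff using W W' eqm_trans by blast
qed

lemma mat_equiv_iff:
  "mat_equiv d A B \<longleftrightarrow> (\<exists>U \<sigma>. unimodular d U \<and> \<sigma> permutes {..<d} \<and>
      eqm d B (mmul d U (\<lambda>i j. A i (\<sigma> j))))"
  by (simp add: mat_equiv_def eqm_def mmul_def)

lemma unimodular_idm: "unimodular d idm"
  unfolding unimodular_iff using mmul_id by blast

lemma mat_equiv_mmul:
  assumes "unimodular d U" "eqm d B (mmul d U A)"
  shows "mat_equiv d A B"
  unfolding mat_equiv_iff using assms by (intro exI[of _ U] exI[of _ id]) (simp add: permutes_id)

lemma mat_equiv_permute_cols:
  assumes "\<sigma> permutes {..<d}" "\<And>i j. i < d \<Longrightarrow> j < d \<Longrightarrow> B i j = A i (\<sigma> j)"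
  shows "mat_equiv d A B"
proof -
  have "eqm d B (\<lambda>i j. A i (\<sigma> j))" using assms(2) by (simp add: eqm_def)
  then show ?thesis
    unfolding mat_equiv_iff using unimodular_idm assms(1) mmul_id(1) eqm_sym eqm_trans by blast
qed

lemma permutes_less: "\<sigma> permutes {..<d} \<Longrightarrow> \<sigma> j < d \<longleftrightarrow> j < d" for j :: nat
  using permutes_in_image[of \<sigma> "{..<d}" j] by simp

lemma mat_equiv_sym:
  assumes "mat_equiv d A B"
  shows "mat_equiv d B A"
proof -
  obtain U \<sigma> W where \<sigma>: "\<sigma> permutes {..<d}" and B: "eqm d B (mmul d U (\<lambda>i j. A i (\<sigma> j)))"
    and W: "eqm d (mmul d U W) idm" "eqm d (mmul d W U) idm"
    using assms unfolding mat_equiv_iff unimodular_iff by blast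
  have "eqm d (mmul d W B) (\<lambda>i j. A i (\<sigma> j))"
    using mmul_cong[OF eqm_refl B] mmul_cancel[OF W(2)] eqm_trans by blast
  then have "mmul d W B i (inv \<sigma> j) = A i j" if "i < d" "j < d" for i j
    using that permutes_inverses(1)[OF \<sigma>] permutes_less[OF permutes_inv[OF \<sigma>]]
    by (simp add: eqm_def)
  then have "eqm d A (mmul d W (\<lambda>i j. B i (inv \<sigma> j)))"
    by (simp add: eqm_def mmul_def)
  then show ?thesis
    unfolding mat_equiv_iff using permutes_inv[OF \<sigma>] W unimodular_iff by blast
qed

lemma mat_equiv_trans:
  assumes "mat_equiv d A B" "mat_equiv d B C"
  shows "mat_equiv d A C"
proof -
  obtain U \<sigma> U' \<sigma>' where U: "unimodular d U" "unimodular d U'"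
    and \<sigma>: "\<sigma> permutes {..<d}" "\<sigma>' permutes {..<d}"
    and B: "eqm d B (mmul d U (\<lambda>i j. A i (\<sigma> j)))" and C: "eqm d C (mmul d U' (\<lambda>i j. B i (\<sigma>' j)))"
    using assms unfolding mat_equiv_iff by blast
  have "eqm d (\<lambda>i j. B i (\<sigma>' j)) (mmul d U (\<lambda>i j. A i (\<sigma> (\<sigma>' j))))"
    using B permutes_less[OF \<sigma>(2)] by (simp add: eqm_def mmul_def)
  then have "eqm d C (mmul d (mmul d U' U) (\<lambda>i j. A i ((\<sigma> \<circ> \<sigma>') j)))"
    unfolding mmul_assoc using C mmul_cong[OF eqm_refl] eqm_trans by fastforce
  then show ?thesis
    unfolding mat_equiv_iff using unimodular_mmul[OF U(2,1)] permutes_compose[OF \<sigma>(2,1)] by blast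
qed

lemma mat_equiv_refl: "mat_equiv d A A"
  by (rule mat_equiv_mmul[OF unimodular_idm]) (rule eqm_sym[OF mmul_id(1)])

text \<open>Permuting the rows is left multiplication by the permutation matrix \<open>U\<close>,
  with \<open>W\<close> as its inverse; the columns may be permuted anyway.\<close>

lemma mat_equiv_permute:
  assumes \<pi>: "\<pi> permutes {..<d}" and B: "\<And>i j. i < d \<Longrightarrow> j < d \<Longrightarrow> B i j = A (\<pi> i) (\<pi> j)"
  shows "mat_equiv d A B"
proof -
  define U :: imat where "U i k = (if \<pi> i = k then 1 else 0)" for i k
  define W :: imat where "W i k = (if i = \<pi> k then 1 else 0)" for i k
  have UA: "mmul d U C i j = C (\<pi> i) j" if "i < d" for C i j
    using that permutes_less[OF \<pi>] by (simp add: mmul_def U_def sum_delta_mult)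
  have "eqm d (mmul d U W) idm"
    using permutes_inj[OF \<pi>] by (auto simp: eqm_def UA W_def idm_def inj_eq)
  moreover have "eqm d (mmul d W U) idm"
    unfolding eqm_def
  proof (intro allI impI)
    fix i k assume ik: "i < d" "k < d"
    have "(\<Sum>j<d. W i j * U j k) = (\<Sum>j<d. (if inv \<pi> i = j then 1 else 0) * U j k)"
      using permutes_inv_eq[OF \<pi>] by (intro sum.cong) (auto simp: W_def)
    also have "\<dots> = U (inv \<pi> i) k"
      using ik permutes_less[OF permutes_inv[OF \<pi>]] by (simp add: sum_delta_mult)
    finally show "mmul d W U i k = idm i k"
      using permutes_inverses(1)[OF \<pi>] by (simp add: mmul_def U_def idm_def)
  qed
  ultimately have "unimodular d U" unfolding unimodular_iff by blast
  moreover have "eqm d B (mmul d U (\<lambda>i j. A i (\<pi> j)))" by (simp add: eqm_def UA B)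
  ultimately show ?thesis unfolding mat_equiv_iff using \<pi> by blast
qed

text \<open>Multiplying \<open>y V = 0\<close> by \<open>Y\<close> from the right gives
  \<open>2 y = 0\<close>. This does the work of a nonzero determinant.\<close>

lemma half_inverse_kernel:
  assumes Y: "half_inverse d V Y" and y: "\<And>j. j < d \<Longrightarrow> (\<Sum>k<d. y k * V k j) = 0" and i: "i < d"
  shows "y i = 0"
proof -
  have "0 = (\<Sum>j<d. (\<Sum>k<d. y k * V k j) * Y j i)" using y by simp
  \<comment> \<open>The row vector \<open>y\<close> is encoded as a matrix with constant rows, of
    which row 0 is read, so that \<open>mmul_assoc\<close> applies.\<close>
  also have "\<dots> = mmul d (mmul d (\<lambda>_. y) V) Y 0 i" by (simp add: mmul_def)
  also have "\<dots> = (\<Sum>k<d. y k * mmul d V Y k i)" unfolding mmul_assoc by (simp add: mmul_def)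
  also have "\<dots> = (\<Sum>k<d. (2 * y k) * (if k = i then 1 else 0))"
    using Y i by (intro sum.cong) (auto simp: half_inverse_def mmul_def)
  also have "\<dots> = 2 * y i" using i by (rule sum_delta_mult)
  finally show ?thesis by simp
qed

text \<open>The new half inverse is \<open>Y\<close> with permuted rows, times the inverse
  \<open>W\<close> of \<open>U\<close>. A permutation leaves the sum of the rows unchanged, so this
  sum becomes \<open>2 h W\<close>.\<close>

lemma reflexive_mat_equiv:
  assumes V: "reflexive_mat d V" and equiv: "mat_equiv d V V'"
  shows "reflexive_mat d V'"
proof -
  obtain Y h where Y: "half_inverse d V Y" and h: "\<And>k. k < d \<Longrightarrow> (\<Sum>j<d. Y j k) = 2 * h k"
    using V by (auto simp: reflexive_mat_def)
  obtain U \<sigma> W where \<sigma>: "\<sigma> permutes {..<d}" and V': "eqm d V' (mmul d U (\<lambda>i j. V i (\<sigma> j)))"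
    and W: "eqm d (mmul d U W) idm" "eqm d (mmul d W U) idm"
    using equiv unfolding mat_equiv_iff unimodular_iff by blast
  define V\<sigma> where "V\<sigma> = (\<lambda>i j. V i (\<sigma> j))"
  define Y\<sigma> where "Y\<sigma> = (\<lambda>i j. Y (\<sigma> i) j)"
  have perm: "(\<Sum>j<d. g (\<sigma> j)) = (\<Sum>j<d. g j)" for g :: "nat \<Rightarrow> int"
    using sum.permute[OF \<sigma>, of g] by (simp add: o_def)
  have 1: "eqm d (mmul d V\<sigma> Y\<sigma>) (\<lambda>i j. 2 * idm i j)"
    using Y perm[of "\<lambda>j. V _ j * Y j _"] unfolding half_inverse_iff
    by (simp add: eqm_def mmul_def V\<sigma>_def Y\<sigma>_def)
  have 2: "eqm d (mmul d Y\<sigma> V\<sigma>) (\<lambda>i j. 2 * idm i j)"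
    using Y permutes_less[OF \<sigma>] permutes_inj[OF \<sigma>] unfolding half_inverse_iff
    by (simp add: eqm_def mmul_def V\<sigma>_def Y\<sigma>_def idm_def inj_eq)
  have V': "eqm d V' (mmul d U V\<sigma>)" using V' by (simp add: V\<sigma>_def)
  define Y' where "Y' = mmul d Y\<sigma> W"
  have "eqm d (mmul d V' Y') (mmul d U (mmul d (mmul d V\<sigma> Y\<sigma>) W))"
    unfolding Y'_def mmul_assoc using mmul_cong[OF V' eqm_refl, of "mmul d Y\<sigma> W"] by (simp only: mmul_assoc)
  also have "eqm d (mmul d U (mmul d (mmul d V\<sigma> Y\<sigma>) W)) (mmul d U (mmul d (\<lambda>i j. 2 * idm i j) W))"
    by (intro mmul_cong eqm_refl 1)
  also have "eqm d (mmul d U (mmul d (\<lambda>i j. 2 * idm i j) W)) (\<lambda>i j. 2 * idm i j)"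
    using W(1) mmul_cong[OF eqm_refl mmul_id(1), of d U W] by (simp add: mmul_scale eqm_def)
  finally have 3: "eqm d (mmul d V' Y') (\<lambda>i j. 2 * idm i j)" .
  have "eqm d (mmul d Y' V') (mmul d Y\<sigma> (mmul d W (mmul d U V\<sigma>)))"
    unfolding Y'_def mmul_assoc by (intro mmul_cong eqm_refl V')
  also have "eqm d \<dots> (mmul d Y\<sigma> V\<sigma>)" by (intro mmul_cong eqm_refl mmul_cancel W)
  also note 2
  finally have 4: "eqm d (mmul d Y' V') (\<lambda>i j. 2 * idm i j)" .
  have "(\<Sum>j<d. Y' j k) = 2 * (\<Sum>l<d. h l * W l k)" for k
  proof -
    have "(\<Sum>j<d. Y' j k) = (\<Sum>l<d. (\<Sum>j<d. Y (\<sigma> j) l) * W l k)"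
      unfolding Y'_def mmul_def Y\<sigma>_def by (subst sum.swap) (simp add: sum_distrib_right)
    also have "\<dots> = (\<Sum>l<d. 2 * (h l * W l k))"
      by (rule sum.cong) (use h perm[of "\<lambda>j. Y j _"] in auto)
    finally show ?thesis by (simp add: sum_distrib_left)
  qed
  then show ?thesis
    unfolding reflexive_mat_def half_inverse_iff using 3 4 by (intro exI[of _ Y'] exI[of _ "\<lambda>k. \<Sum>l<d. h l * W l k"]) auto
qed

text \<open>Flipping the signs of columns is multiplication from the left by the integral involution
  \<open>id - V E Y\<close>, where \<open>E\<close> is the diagonal projection onto the flipped columns.\<close>

lemma mat_equiv_flip:
  assumes Y: "half_inverse d V Y" and e: "\<And>j. j < d \<Longrightarrow> e j = 1 \<or> e j = -1"
  shows "mat_equiv d V (\<lambda>i j. V i j * e j)"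
proof -
  define E :: "nat \<Rightarrow> int" where "E j = (if e j = 1 then 0 else 1)" for j
  have EE: "E j * E j = E j" for j by (simp add: E_def)
  define N where "N = mmul d V (\<lambda>j k. E j * Y j k)"
  define U where "U = (\<lambda>i k. idm i k - N i k)"
  have NV: "mmul d N V i k = 2 * (V i k * E k)" if "i < d" "k < d" for i k
  proof -
    have "mmul d N V i k = (\<Sum>j<d. V i j * (E j * mmul d Y V j k))"
      unfolding N_def mmul_assoc by (simp add: mmul_def sum_distrib_left mult_ac)
    also have "\<dots> = (\<Sum>j<d. (2 * (V i j * E j)) * (if j = k then 1 else 0))"
      using Y that by (intro sum.cong) (auto simp: half_inverse_def mmul_def)
    finally show ?thesis using that(2) by (simp only: sum_delta_mult)
  qed
  \<comment> \<open>\<open>N N = 2 N\<close> is what makes \<open>id - N\<close> an involution; its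
    factor 2 comes from \<open>Y V = 2 id\<close>.\<close>
  have NN: "mmul d N N i k = 2 * N i k" if "i < d" "k < d" for i k
  proof -
    have "mmul d N N i k = (\<Sum>j<d. mmul d N V i j * (E j * Y j k))"
      by (subst (2) N_def, subst mmul_assoc[symmetric]) (simp add: mmul_def)
    also have "\<dots> = (\<Sum>j<d. 2 * (V i j * (E j * Y j k)))"
      using that EE by (intro sum.cong) (auto simp: NV E_def)
    finally show ?thesis by (simp add: N_def mmul_def sum_distrib_left)
  qed
  have UA: "mmul d U A i k = A i k - mmul d N A i k" if "i < d" for A i k
    using that by (simp add: U_def mmul_def idm_def left_diff_distrib sum_subtractf sum_delta_mult)
  have NU: "mmul d N U i k = N i k - mmul d N N i k" if "k < d" for i k
    using that by (simp add: U_def mmul_def idm_def right_diff_distrib sum_subtractf sum_delta_mult)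
  have "eqm d (mmul d U U) idm"
    unfolding eqm_def by (auto simp: UA NU NN) (simp_all add: U_def)
  then have "unimodular d U" unfolding unimodular_iff by blast
  moreover have "eqm d (\<lambda>i j. V i j * e j) (mmul d U V)"
    unfolding eqm_def
  proof (intro allI impI)
    fix i j assume "i < d" "j < d"
    then show "V i j * e j = mmul d U V i j"
      using e[of j] by (auto simp: UA NV E_def)
  qed
  ultimately show ?thesis by (rule mat_equiv_mmul)
qed

section \<open>Lattice automorphisms acting on columns and polytopes\<close>

lemma lin_col: "lin d U (col d A j) = col d (mmul d U A) j"
  unfolding lin_def col_def
  by (rule pt_eqI[of _ d]) (auto simp: lookup_vec mmul_def)

lemma lin_mmul: "lin d W (lin d U x) = lin d (mmul d W U) x"
proof (rule pt_eqI[of _ d])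
  fix i assume "i < d"
  then show "Poly_Mapping.lookup (lin d W (lin d U x)) i = Poly_Mapping.lookup (lin d (mmul d W U) x) i"
    by (simp add: lin_def lookup_vec mmul_def sum_distrib_left sum_distrib_right mult.assoc)
      (rule sum.swap)
qed auto

lemma lin_eqm_idm: "eqm d U idm \<Longrightarrow> x \<in> Rd d \<Longrightarrow> lin d U x = x"
  by (rule pt_eqI[of _ d]) (auto simp: lin_def lookup_vec eqm_def idm_def if_distrib[of real_of_int] sum_delta_mult cong: if_cong)

lemma col_cong: "eqm d A B \<Longrightarrow> j < d \<Longrightarrow> col d A j = col d B j"
  by (rule pt_eqI[of _ d]) (auto simp: col_def lookup_vec eqm_def)

lemma PA_cong: "eqm d A B \<Longrightarrow> PA d A = PA d B"
  unfolding PA_def using col_cong image_cong[of "{..<d}" "{..<d}" "col d A" "col d B"] by simp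

lemma col_permute: "col d (\<lambda>i j. A i (\<sigma> j)) j = col d A (\<sigma> j)"
  by (simp add: col_def)

lemma col_image_equiv:
  assumes "\<sigma> permutes {..<d}" "eqm d B (mmul d U (\<lambda>i j. A i (\<sigma> j)))"
  shows "col d B ` {..<d} = lin d U ` col d A ` {..<d}"
proof -
  have "col d B j = lin d U (col d A (\<sigma> j))" if "j < d" for j
    using col_cong[OF assms(2) that] by (simp add: lin_col[symmetric] col_permute)
  then have "col d B ` {..<d} = (\<lambda>j. lin d U (col d A j)) ` \<sigma> ` {..<d}"
    unfolding image_image by (intro image_cong) auto
  then show ?thesis by (simp add: permutes_image[OF assms(1)] image_image)
qed

lemma PA_equiv:
  assumes "\<sigma> permutes {..<d}" "eqm d B (mmul d U (\<lambda>i j. A i (\<sigma> j)))"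
  shows "lin d U ` PA d A = PA d B"
  unfolding PA_def convex_hull_linear_image[OF linear_lin] image_Un col_image_equiv[OF assms]
  by (simp add: image_image linear_neg[OF linear_lin])

lemma reflexive_mat_dual_bases:
  assumes "d \<ge> 1" "reflexive_mat d V"
  obtains X where "dual_bases d (col d V) X"
  using assms dual_bases_half_inverse unfolding reflexive_mat_def by blast

lemma vertices_PA:
  assumes "d \<ge> 1" "reflexive_mat d V"
  shows "vertices (PA d V) = col d V ` {..<d} \<union> uminus ` col d V ` {..<d}"
proof -
  obtain X where "dual_bases d (col d V) X" using reflexive_mat_dual_bases[OF assms] .
  then show ?thesis unfolding PA_cross by (rule dual_bases.vertices_cross)
qed

lemma col_signed_eq:
  assumes "d \<ge> 1" "reflexive_mat d V" "i < d" "j < d" "c \<noteq> 0" "col d V i = c *\<^sub>R col d V j"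
  shows "i = j"
proof -
  obtain X where "dual_bases d (col d V) X" using reflexive_mat_dual_bases[OF assms(1,2)] .
  then show ?thesis by (rule dual_bases.v_signed_eq(1)) (use assms in auto)
qed

text \<open>An isomorphism matches the vertices, hence the columns up to order and sign. The order
  is absorbed by the column permutation, and the signs are removed by
  \<open>mat_equiv_flip\<close>.\<close>

lemma iso_PA_iff:
  assumes d: "d \<ge> 1" and A: "reflexive_mat d A" and B: "reflexive_mat d B"
  shows "iso d (PA d A) (PA d B) \<longleftrightarrow> mat_equiv d A B"
proof
  assume "mat_equiv d A B"
  then obtain U \<sigma> where U: "unimodular d U" and \<sigma>: "\<sigma> permutes {..<d}"
    and eq: "eqm d B (mmul d U (\<lambda>i j. A i (\<sigma> j)))"
    unfolding mat_equiv_iff by blast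
  have "lin d U ` vertices (PA d A) = vertices (PA d B)"
    unfolding vertices_PA[OF d A] vertices_PA[OF d B] col_image_equiv[OF \<sigma> eq]
    by (simp add: image_Un image_image linear_neg[OF linear_lin])
  then show "iso d (PA d A) (PA d B)" unfolding iso_def using U by blast
next
  assume "iso d (PA d A) (PA d B)"
  then obtain U where U: "unimodular d U" and eq: "lin d U ` vertices (PA d A) = vertices (PA d B)"
    unfolding iso_def by blast
  have "\<exists>t s. t < d \<and> (s = 1 \<or> s = (-1::int)) \<and> lin d U (col d A t) = of_int s *\<^sub>R col d B j" if "j < d" for j
  proof -
    have "col d B j \<in> lin d U ` vertices (PA d A)"
      unfolding eq vertices_PA[OF d B] using that by blast
    then obtain t where t: "t < d" "col d B j = lin d U (col d A t) \<or> col d B j = lin d U (- col d A t)"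
      unfolding vertices_PA[OF d A] by auto
    then have "lin d U (col d A t) = of_int 1 *\<^sub>R col d B j \<or> lin d U (col d A t) = of_int (-1) *\<^sub>R col d B j"
      by (auto simp: linear_neg[OF linear_lin])
    then show ?thesis using t(1) by blast
  qed
  then obtain t s where t: "\<And>j. j < d \<Longrightarrow> t j < d" and s: "\<And>j. j < d \<Longrightarrow> s j = 1 \<or> s j = (-1::int)"
    and ts: "\<And>j. j < d \<Longrightarrow> lin d U (col d A (t j)) = of_int (s j) *\<^sub>R col d B j"
    by metis
  have inj: "inj_on t {..<d}"
  proof (rule inj_onI)
    fix i j assume ij: "i \<in> {..<d}" "j \<in> {..<d}" "t i = t j"
    then have eq: "of_int (s i) *\<^sub>R col d B i = of_int (s j) *\<^sub>R col d B j"
      using ts[of i] ts[of j] by simp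
    have "col d B i = (of_int (s i) * of_int (s i)) *\<^sub>R col d B i" using s[of i] ij by auto
    also have "\<dots> = (of_int (s i) * of_int (s j)) *\<^sub>R col d B j"
      by (simp only: scaleR_scaleR[symmetric] eq)
    finally have "col d B i = (of_int (s i) * of_int (s j)) *\<^sub>R col d B j" .
    moreover have "real_of_int (s i) * of_int (s j) \<noteq> 0" using ij s[of i] s[of j] by auto
    ultimately show "i = j"
      using ij col_signed_eq[OF d B] by blast
  qed
  \<comment> \<open>Beyond the index range \<open>t\<close> is unknown, whereas
    \<open>permutes\<close> demands the identity there.\<close>
  define \<sigma> where "\<sigma> j = (if j < d then t j else j)" for j
  have "inj_on \<sigma> {..<d}" using inj by (simp add: \<sigma>_def inj_on_def)
  moreover have "\<sigma> ` {..<d} \<subseteq> {..<d}" using t by (auto simp: \<sigma>_def)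
  ultimately have "bij_betw \<sigma> {..<d} {..<d}"
    by (simp add: bij_betw_def endo_inj_surj)
  then have \<sigma>: "\<sigma> permutes {..<d}" by (rule bij_imp_permutes) (simp add: \<sigma>_def)
  have "eqm d (\<lambda>i j. B i j * s j) (mmul d U (\<lambda>i j. A i (\<sigma> j)))"
    unfolding eqm_def
  proof (intro allI impI)
    fix i j assume ij: "i < d" "j < d"
    have "col d (mmul d U A) (t j) = of_int (s j) *\<^sub>R col d B j" using ts[OF ij(2)] by (simp add: lin_col)
    then have "Poly_Mapping.lookup (col d (mmul d U A) (t j)) i = Poly_Mapping.lookup (of_int (s j) *\<^sub>R col d B j) i"
      by simp
    then have "real_of_int (mmul d U A i (t j)) = real_of_int (B i j * s j)"
      using ij by (simp add: col_def lookup_pt mult.commute)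
    then have "mmul d U A i (t j) = B i j * s j" by (simp only: of_int_eq_iff)
    then show "B i j * s j = mmul d U (\<lambda>i j. A i (\<sigma> j)) i j"
      using ij by (simp add: mmul_def \<sigma>_def)
  qed
  then have "mat_equiv d A (\<lambda>i j. B i j * s j)" unfolding mat_equiv_iff using U \<sigma> by blast
  moreover obtain Y where "half_inverse d B Y" using B by (auto simp: reflexive_mat_def)
  then have "mat_equiv d B (\<lambda>i j. B i j * s j)" using s by (rule mat_equiv_flip)
  ultimately show "mat_equiv d A B" using mat_equiv_sym mat_equiv_trans by blast
qed

text \<open>Twice the inverse of \<open>A\<close>, with block rows \<open>id, 0\<close> and
  \<open>-C, 2 id\<close>. Modulo 2 its first \<open>f\<close> columns are the systematic generator
  words and the others vanish.\<close>

definition wirth_inv :: "nat \<Rightarrow> imat \<Rightarrow> imat" where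
  "wirth_inv f A i j =
    (if i < f then if i = j then 1 else 0 else if j < f then - A i j else if i = j then 2 else 0)"

lemma wirth_fD:
  assumes "wirth_f d f A"
  shows "f < d"
    and "\<And>i j. i < d \<Longrightarrow> j < d \<Longrightarrow> i < f \<Longrightarrow> A i j = (if i = j then 2 else 0)"
    and "\<And>i j. i < d \<Longrightarrow> j < d \<Longrightarrow> f \<le> i \<Longrightarrow> f \<le> j \<Longrightarrow> A i j = (if i = j then 1 else 0)"
    and "\<And>i j. i < d \<Longrightarrow> j < f \<Longrightarrow> f \<le> i \<Longrightarrow> A i j = 0 \<or> A i j = 1"
    and "\<And>j. j < f \<Longrightarrow> odd (card {i. f \<le> i \<and> i < d \<and> A i j = 1})"
  using assms unfolding wirth_f_def by auto

lemma half_inverse_wirth: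
  assumes A: "wirth_f d f A"
  shows "half_inverse d A (wirth_inv f A)"
  unfolding half_inverse_def
proof (intro allI impI conjI)
  note D = wirth_fD[OF A]
  fix i k assume ik: "i < d" "k < d"
  show "(\<Sum>j<d. A i j * wirth_inv f A j k) = (if i = k then 2 else 0)"
  proof (cases "i < f")
    case True
    have "(\<Sum>j<d. A i j * wirth_inv f A j k) = (\<Sum>j<d. if j = i then 2 * wirth_inv f A i k else 0)"
      using ik True by (intro sum.cong) (auto simp: D(2))
    then show ?thesis using ik True by (simp add: wirth_inv_def)
  next
    case False
    have "(\<Sum>j<d. A i j * wirth_inv f A j k) =
        (\<Sum>j<d. (if j = i then wirth_inv f A i k else 0) + (if j = k then (if k < f then A i k else 0) else 0))"
      using ik False D(1) by (intro sum.cong) (auto simp: D(3) wirth_inv_def)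
    also have "\<dots> = wirth_inv f A i k + (if k < f then A i k else 0)"
      using ik by (simp add: sum.distrib)
    finally show ?thesis using ik False by (auto simp: wirth_inv_def)
  qed
  show "(\<Sum>j<d. wirth_inv f A i j * A j k) = (if i = k then 2 else 0)"
  proof (cases "i < f")
    case True
    have "(\<Sum>j<d. wirth_inv f A i j * A j k) = (\<Sum>j<d. if j = i then A i k else 0)"
      using ik True by (intro sum.cong) (auto simp: wirth_inv_def)
    then show ?thesis using ik True by (simp add: D(2))
  next
    case False
    have "(\<Sum>j<d. wirth_inv f A i j * A j k) =
        (\<Sum>j<d. (if j = i then 2 * A i k else 0) + (if j = k then (if k < f then - 2 * A i k else 0) else 0))"
      using ik False by (intro sum.cong) (auto simp: D(2) wirth_inv_def)
    also have "\<dots> = 2 * A i k + (if k < f then - 2 * A i k else 0)"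
      using ik by (simp add: sum.distrib)
    finally show ?thesis using ik False by (auto simp: D(3))
  qed
qed

text \<open>Column \<open>k < f\<close> of the half inverse sums to 1 minus the number of ones in
  column \<open>k\<close> of \<open>C\<close>, which is even by the parity condition. The remaining
  columns have only even entries.\<close>

lemma reflexive_mat_wirth:
  assumes "wirth d A"
  shows "reflexive_mat d A"
proof -
  obtain f where A: "wirth_f d f A" using assms by (auto simp: wirth_def)
  note D = wirth_fD[OF A]
  have "even (\<Sum>j<d. wirth_inv f A j k)" if k: "k < d" for k
  proof (cases "k < f")
    case True
    let ?S = "{i. f \<le> i \<and> i < d \<and> A i k = 1}"
    have "(\<Sum>j<d. wirth_inv f A j k) = (\<Sum>j<d. (if j = k then 1 else 0) - (if j \<in> ?S then 1 else 0))"
    proof (rule sum.cong)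
      fix j assume "j \<in> {..<d}"
      then show "wirth_inv f A j k = (if j = k then 1 else 0) - (if j \<in> ?S then 1 else 0)"
        using True D(4)[of j k] by (auto simp: wirth_inv_def)
    qed simp
    also have "\<dots> = 1 - int (card ({..<d} \<inter> ?S))"
      using k by (simp add: sum_subtractf sum.If_cases del: mem_Collect_eq)
    also have "{..<d} \<inter> ?S = ?S" by auto
    finally show ?thesis using D(5)[OF True] by simp
  next
    case False
    have "even (wirth_inv f A j k)" for j using False by (auto simp: wirth_inv_def)
    then show ?thesis by (simp add: dvd_sum)
  qed
  then show ?thesis
    unfolding reflexive_mat_def using half_inverse_wirth[OF A]
    by (intro exI[of _ "wirth_inv f A"] exI[of _ "\<lambda>k. (\<Sum>j<d. wirth_inv f A j k) div 2"]) auto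
qed

text \<open>Since \<open>Y\<close> and \<open>Z\<close> are twice the inverses,
  \<open>V Z / 2\<close> and \<open>A Y / 2\<close> are the transition matrices between
  \<open>A\<close> and \<open>V\<close>. They are mutually inverse, so once integral they are
  unimodular. The two parity conditions compare the codes.\<close>

lemma mat_equiv_if_even:
  assumes Y: "half_inverse d V Y" and Z: "half_inverse d A Z"
    and VZ: "\<And>i k. i < d \<Longrightarrow> k < d \<Longrightarrow> even (mmul d V Z i k)"
    and AY: "\<And>i k. i < d \<Longrightarrow> k < d \<Longrightarrow> even (mmul d A Y i k)"
  shows "mat_equiv d A V"
proof -
  define U :: imat where "U i k = mmul d V Z i k div 2" for i k
  define W :: imat where "W i k = mmul d A Y i k div 2" for i k
  have U2: "eqm d (\<lambda>i j. 2 * U i j) (mmul d V Z)" using VZ by (simp add: eqm_def U_def)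
  have W2: "eqm d (\<lambda>i j. 2 * W i j) (mmul d A Y)" using AY by (simp add: eqm_def W_def)
  \<comment> \<open>Generic in the matrices because it is applied a second time with the two sides
    exchanged. The 4 collects the two halves.\<close>
  have inv: "eqm d (\<lambda>i j. 4 * mmul d U W i j) (\<lambda>i j. 4 * idm i j)"
    if U2: "eqm d (\<lambda>i j. 2 * U i j) (mmul d V Z)" and W2: "eqm d (\<lambda>i j. 2 * W i j) (mmul d A Y)"
      and Y: "half_inverse d V Y" and Z: "half_inverse d A Z" for U W V Z A Y :: imat
  proof -
    have "eqm d (\<lambda>i j. 4 * mmul d U W i j) (mmul d (mmul d V Z) (mmul d A Y))"
      using mmul_cong[OF U2 W2] by (simp add: mmul_scale)
    also have "mmul d (mmul d V Z) (mmul d A Y) = mmul d V (mmul d (mmul d Z A) Y)"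
      by (simp only: mmul_assoc)
    also have "eqm d \<dots> (mmul d V (mmul d (\<lambda>i j. 2 * idm i j) Y))"
      using Z unfolding half_inverse_iff by (intro mmul_cong eqm_refl) auto
    also have "mmul d V (mmul d (\<lambda>i j. 2 * idm i j) Y) = (\<lambda>i j. 2 * mmul d V (mmul d idm Y) i j)"
      by (simp add: mmul_scale)
    also have "eqm d \<dots> (\<lambda>i j. 2 * mmul d V Y i j)"
      using mmul_cong[OF eqm_refl mmul_id(1), of d V Y] by (simp add: eqm_def)
    also have "eqm d \<dots> (\<lambda>i j. 4 * idm i j)"
      using Y unfolding half_inverse_iff by (simp add: eqm_def)
    finally show ?thesis .
  qed
  have "eqm d (mmul d U W) idm" using inv[OF U2 W2 Y Z] by (simp add: eqm_def)
  moreover have "eqm d (mmul d W U) idm" using inv[OF W2 U2 Z Y] by (simp add: eqm_def)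
  ultimately have "unimodular d U" unfolding unimodular_iff by blast
  moreover have "eqm d V (mmul d U A)"
  proof -
    have "eqm d (\<lambda>i j. 2 * mmul d U A i j) (mmul d (mmul d V Z) A)"
      using mmul_cong[OF U2 eqm_refl] by (simp add: mmul_scale)
    also have "mmul d (mmul d V Z) A = mmul d V (mmul d Z A)" by (rule mmul_assoc)
    also have "eqm d \<dots> (mmul d V (\<lambda>i j. 2 * idm i j))"
      using Z unfolding half_inverse_iff by (intro mmul_cong eqm_refl) auto
    also have "eqm d \<dots> (\<lambda>i j. 2 * V i j)"
      using mmul_id(2)[of d V] by (simp add: mmul_scale eqm_def)
    finally show ?thesis by (simp add: eqm_def)
  qed
  ultimately show ?thesis by (rule mat_equiv_mmul)
qed

section \<open>Wirth normal form\<close>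

text \<open>Moves \<open>J\<close> to the front. It serves for the systematic coordinates of the
  code and for the indices kept by \<open>reduction\<close>; the latter use needs the increasing
  order.\<close>

lemma sorting_permutation:
  assumes J: "J \<subseteq> {..<d::nat}"
  obtains \<pi> where "\<pi> permutes {..<d}" "\<And>k. k < card J \<Longrightarrow> \<pi> k = sorted_list_of_set J ! k"
    "\<And>k. k < d \<Longrightarrow> \<pi> k \<in> J \<longleftrightarrow> k < card J"
proof -
  let ?K = "{..<d} - J"
  have fin: "finite J" using J finite_subset by blast
  define xs where "xs = sorted_list_of_set J @ sorted_list_of_set ?K"
  have set: "set xs = {..<d}" using fin J by (auto simp: xs_def)
  have dist: "distinct xs" using fin by (auto simp: xs_def)
  have len: "length xs = d" using distinct_card[OF dist] set by simp
  define \<pi> where "\<pi> k = (if k < d then xs ! k else k)" for k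
  have "bij_betw ((!) xs) {..<d} {..<d}"
    by (rule bij_betw_nth) (use dist len set in auto)
  then have "bij_betw \<pi> {..<d} {..<d}"
    by (rule bij_betw_cong[THEN iffD1, rotated]) (simp add: \<pi>_def)
  then have 1: "\<pi> permutes {..<d}" by (rule bij_imp_permutes) (simp add: \<pi>_def)
  have cJ: "card J \<le> d" using card_mono[OF _ J] by simp
  have 2: "\<pi> k = sorted_list_of_set J ! k" if "k < card J" for k
    using that cJ by (simp add: \<pi>_def xs_def nth_append)
  have 3: "\<pi> k \<in> J \<longleftrightarrow> k < card J" if k: "k < d" for k
  proof (cases "k < card J")
    case True
    then show ?thesis using 2 fin nth_mem[of k "sorted_list_of_set J"] by simp
  next
    case False
    have "k - card J < length (sorted_list_of_set ?K)"
      using False k J fin by (simp add: card_Diff_subset)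
    then have "sorted_list_of_set ?K ! (k - card J) \<in> ?K"
      using nth_mem set_sorted_list_of_set[of ?K] by blast
    then show ?thesis using False k by (simp add: \<pi>_def xs_def nth_append)
  qed
  show thesis by (rule that[OF 1 2 3])
qed

text \<open>The residues modulo 2 of the vectors \<open>Y m\<close> form a binary code in which every word has even
  weight. If \<open>T\<close> is maximal among the coordinate sets that support no nonzero word, then every
  coordinate outside \<open>T\<close> is the only one outside \<open>T\<close> in the support of some word. These words put
  the code into systematic form, and their restrictions to \<open>T\<close> are the columns of the block \<open>C\<close>.\<close>

lemma reflexive_mat_wirth_form:
  assumes d: "d \<ge> 1" and V: "reflexive_mat d V"
  obtains A where "wirth d A" "mat_equiv d A V"
proof -
  obtain Y h where Y: "half_inverse d V Y" and h: "\<And>k. k < d \<Longrightarrow> (\<Sum>j<d. Y j k) = 2 * h k"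
    using V by (auto simp: reflexive_mat_def)
  \<comment> \<open>\<open>q m l\<close> is coordinate \<open>l\<close> of \<open>Y m\<close>, and
    \<open>supp m\<close> is the support of the code word of \<open>m\<close>.\<close>
  define q where "q m l = (\<Sum>k<d. Y l k * m k)" for m :: "nat \<Rightarrow> int" and l
  define supp where "supp m = {l\<in>{..<d}. odd (q m l)}" for m
  have even_supp: "even (card (supp m))" for m
  proof -
    have "(\<Sum>l<d. q m l) = (\<Sum>k<d. (\<Sum>l<d. Y l k) * m k)"
      unfolding q_def by (subst sum.swap) (simp add: sum_distrib_right)
    also have "\<dots> = (\<Sum>k<d. 2 * (h k * m k))" using h by (intro sum.cong) auto
    also have "even \<dots>" by (simp add: sum_distrib_left[symmetric])
    finally show ?thesis unfolding supp_def by (simp add: even_sum_iff)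
  qed
  define ok where "ok T \<longleftrightarrow> T \<subseteq> {..<d} \<and> (\<forall>m. supp m \<subseteq> T \<longrightarrow> supp m = {})" for T
  have "finite {T. ok T}" by (rule finite_subset[of _ "Pow {..<d}"]) (auto simp: ok_def)
  moreover have "ok {}" by (auto simp: ok_def)
  ultimately obtain T where T: "ok T" and max: "\<And>T'. ok T' \<Longrightarrow> T \<subseteq> T' \<Longrightarrow> T = T'"
    using finite_has_maximal[of "{T. ok T}"] by blast
  define J where "J = {..<d} - T"
  have "\<exists>m. supp m \<subseteq> insert j T \<and> j \<in> supp m" if jJ: "j \<in> J" for j
  proof -
    have "\<not> ok (insert j T)" using max[of "insert j T"] jJ by (auto simp: J_def)
    then obtain m where m: "supp m \<subseteq> insert j T" "supp m \<noteq> {}"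
      using T jJ by (auto simp: ok_def J_def)
    then have "j \<in> supp m" using T by (auto simp: ok_def)
    then show ?thesis using m by blast
  qed
  then obtain M where M: "\<And>j. j \<in> J \<Longrightarrow> supp (M j) \<subseteq> insert j T" "\<And>j. j \<in> J \<Longrightarrow> j \<in> supp (M j)"
    by metis
  define f where "f = card J"
  have "J \<subseteq> {..<d}" by (auto simp: J_def)
  from sorting_permutation[OF this]
  obtain \<pi> where \<pi>: "\<pi> permutes {..<d}" and \<pi>J: "\<And>k. k < d \<Longrightarrow> \<pi> k \<in> J \<longleftrightarrow> k < f"
    unfolding f_def by metis
  have \<pi>d: "\<pi> k < d \<longleftrightarrow> k < d" for k using permutes_less[OF \<pi>] .
  have \<pi>inj: "\<pi> i = \<pi> j \<longleftrightarrow> i = j" for i j using permutes_inj[OF \<pi>] by (simp add: inj_eq)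
  \<comment> \<open>If \<open>T\<close> were empty, the word that belongs to coordinate 0 would have
    weight one, against even weights.\<close>
  have fd: "f < d"
  proof -
    have "T \<noteq> {}"
    proof
      assume "T = {}"
      then have "supp (M 0) = {0}" using M[of 0] d by (auto simp: J_def)
      then show False using even_supp[of "M 0"] by simp
    qed
    then have "J \<subset> {..<d}" using T by (auto simp: J_def ok_def)
    then show ?thesis unfolding f_def using psubset_card_mono[of "{..<d}" J] by simp
  qed
  have supp_J: "\<pi> i \<in> supp (M (\<pi> j)) \<longleftrightarrow> i = j" if "i < f" "j < f" for i j
    using M[of "\<pi> j"] \<pi>J[of i] \<pi>J[of j] that fd \<pi>inj by (auto simp: J_def)
  define A :: imat where "A i j = (if i < f then if i = j then 2 else 0
      else if j < f then if \<pi> i \<in> supp (M (\<pi> j)) then 1 else 0 else if i = j then 1 else 0)" for i j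
  have A: "wirth_f d f A"
    unfolding wirth_f_def
  proof (intro conjI allI impI)
    fix j assume j: "j < f"
    \<comment> \<open>Column \<open>j\<close> of \<open>C\<close> is a code word without its own
      systematic coordinate: an even weight less one is odd.\<close>
    have "\<pi> ` {i. f \<le> i \<and> i < d \<and> A i j = 1} = supp (M (\<pi> j)) - {\<pi> j}"
    proof (intro subset_antisym subsetI)
      fix l assume l: "l \<in> supp (M (\<pi> j)) - {\<pi> j}"
      then have "l \<in> {..<d}" by (auto simp: supp_def)
      then obtain i where i: "i < d" "l = \<pi> i" using permutes_image[OF \<pi>] by blast
      then have "f \<le> i" using supp_J[of i j] l j by (auto simp: not_less[symmetric])
      then show "l \<in> \<pi> ` {i. f \<le> i \<and> i < d \<and> A i j = 1}"
        using i l j by (intro image_eqI[of _ _ i]) (auto simp: A_def)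
    qed (use j \<pi>inj in \<open>auto simp: A_def split: if_splits\<close>)
    then have "card {i. f \<le> i \<and> i < d \<and> A i j = 1} = card (supp (M (\<pi> j)) - {\<pi> j})"
      using card_image[of \<pi> "{i. f \<le> i \<and> i < d \<and> A i j = 1}"] inj_on_subset[OF permutes_inj[OF \<pi>]] by simp
    also have "\<dots> = card (supp (M (\<pi> j))) - 1"
      using M(2)[of "\<pi> j"] \<pi>J[of j] j fd by simp
    also have "odd \<dots>"
    proof -
      have "\<pi> j \<in> supp (M (\<pi> j))" using M(2)[of "\<pi> j"] \<pi>J[of j] j fd by simp
      then have "card (supp (M (\<pi> j))) > 0" unfolding card_gt_0_iff by (auto simp: supp_def)
      then show ?thesis using even_supp[of "M (\<pi> j)"] by simp
    qed
    finally show "odd (card {i. f \<le> i \<and> i < d \<and> A i j = 1})" .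
  qed (use fd in \<open>auto simp: A_def\<close>)
  define Z where "Z = wirth_inv f A"
  have Z: "half_inverse d A Z" unfolding Z_def by (rule half_inverse_wirth[OF A])
  define V\<pi> where "V\<pi> = (\<lambda>i j. V i (\<pi> j))"
  define Y\<pi> where "Y\<pi> = (\<lambda>i j. Y (\<pi> i) j)"
  have perm: "(\<Sum>j<d. g (\<pi> j)) = (\<Sum>j<d. g j)" for g :: "nat \<Rightarrow> int"
    using sum.permute[OF \<pi>, of g] by (simp add: o_def)
  have VY\<pi>: "half_inverse d V\<pi> Y\<pi>"
    using Y perm[of "\<lambda>j. V _ j * Y j _"] \<pi>d \<pi>inj
    by (simp add: half_inverse_def V\<pi>_def Y\<pi>_def)
  \<comment> \<open>Modulo 2 the sign of \<open>-C\<close> disappears, so column \<open>k\<close> of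
    \<open>Z\<close> is the reordered word of \<open>M (\<pi> k)\<close>.\<close>
  have parity: "even (Z j k - q (M (\<pi> k)) (\<pi> j))" if "j < d" "k < f" for j k
  proof -
    have "odd (Z j k) \<longleftrightarrow> \<pi> j \<in> supp (M (\<pi> k))"
      using that supp_J[of j k] by (auto simp: Z_def wirth_inv_def A_def)
    then show ?thesis using that \<pi>d by (simp add: supp_def)
  qed
  have "mat_equiv d A V\<pi>"
  proof (rule mat_equiv_if_even[OF VY\<pi> Z])
    fix i k assume ik: "i < d" "k < d"
    show "even (mmul d V\<pi> Z i k)"
    proof (cases "k < f")
      case True
      \<comment> \<open>Modulo 2 column \<open>k\<close> of \<open>Z\<close> may be replaced by
        \<open>Y ?m\<close>, and \<open>V Y ?m = 2 ?m\<close> is even.\<close>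
      let ?m = "M (\<pi> k)"
      have "(\<Sum>j<d. V\<pi> i j * q ?m (\<pi> j)) = (\<Sum>l<d. V i l * q ?m l)"
        using perm[of "\<lambda>j. V i j * q ?m j"] by (simp add: V\<pi>_def)
      also have "\<dots> = mmul d V (mmul d Y (\<lambda>l _. ?m l)) i 0" by (simp add: mmul_def q_def)
      also have "\<dots> = (\<Sum>l<d. mmul d V Y i l * ?m l)"
        unfolding mmul_assoc[symmetric] by (simp add: mmul_def)
      also have "even \<dots>"
        using Y ik(1) by (intro dvd_sum dvd_mult2) (simp add: half_inverse_def mmul_def)
      finally have 1: "even (\<Sum>j<d. V\<pi> i j * q ?m (\<pi> j))" .
      have "mmul d V\<pi> Z i k - (\<Sum>j<d. V\<pi> i j * q ?m (\<pi> j)) = (\<Sum>j<d. V\<pi> i j * (Z j k - q ?m (\<pi> j)))"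
        by (simp add: mmul_def right_diff_distrib sum_subtractf)
      also have "even \<dots>" using parity True by (intro dvd_sum dvd_mult) auto
      finally show ?thesis using 1 by simp
    next
      case False
      \<comment> \<open>From \<open>f\<close> on, the columns of \<open>Z\<close> have only the
        entries 0 and 2.\<close>
      then show ?thesis
        unfolding mmul_def by (intro dvd_sum dvd_mult) (auto simp: Z_def wirth_inv_def)
    qed
    show "even (mmul d A Y\<pi> i k)"
    proof (cases "i < f")
      case True
      then show ?thesis
        unfolding mmul_def by (intro dvd_sum dvd_mult2) (auto simp: A_def)
    next
      case False
      \<comment> \<open>The unit vector \<open>k\<close> minus the combination of the
        \<open>M (\<pi> j)\<close> that cancels its word outside \<open>T\<close>. The remaining
        word is supported in \<open>T\<close>, hence zero: the chosen words generate the
        code.\<close>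
      define m where "m = (\<lambda>l. (if l = k then 1 else 0) - (\<Sum>j<f. Y (\<pi> j) k * M (\<pi> j) l))"
      have qm: "q m l = Y l k - (\<Sum>j<f. Y (\<pi> j) k * q (M (\<pi> j)) l)" for l
      proof -
        have "(\<Sum>x<d. Y l x * (\<Sum>j<f. Y (\<pi> j) k * M (\<pi> j) x)) = (\<Sum>j<f. Y (\<pi> j) k * q (M (\<pi> j)) l)"
          unfolding q_def sum_distrib_left by (subst sum.swap) (simp add: mult_ac)
        moreover have "q m l = (\<Sum>x<d. Y l x * (if x = k then 1 else 0))
            - (\<Sum>x<d. Y l x * (\<Sum>j<f. Y (\<pi> j) k * M (\<pi> j) x))"
          unfolding q_def m_def right_diff_distrib sum_subtractf ..
        ultimately show ?thesis using ik(2) by (simp only: sum_delta_mult)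
      qed
      have "supp m \<subseteq> T"
      proof
        fix l assume l: "l \<in> supp m"
        then have "l \<in> {..<d}" by (auto simp: supp_def)
        then obtain i' where i': "i' < d" "l = \<pi> i'" using permutes_image[OF \<pi>] by blast
        show "l \<in> T"
        proof (rule ccontr)
          assume "l \<notin> T"
          then have f': "i' < f" using i' \<pi>J[of i'] \<pi>d by (simp add: J_def)
          have "(\<Sum>j<f. Y (\<pi> j) k * (if i' = j then 1 else 0)) = Y l k"
            using f' i' by (simp only: sum_delta_mult)
          then have "q m l = (\<Sum>j<f. Y (\<pi> j) k * ((if i' = j then 1 else 0) - q (M (\<pi> j)) l))"
            unfolding qm by (simp only: right_diff_distrib sum_subtractf)
          also have "even \<dots>"
          proof (intro dvd_sum dvd_mult)
            fix j assume "j \<in> {..<f}"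
            then have "odd (q (M (\<pi> j)) l) \<longleftrightarrow> i' = j"
              using supp_J[of i' j] f' i' \<pi>d by (simp add: supp_def)
            then show "even ((if i' = j then 1 else 0) - q (M (\<pi> j)) l)" by auto
          qed
          finally show False using l by (simp add: supp_def)
        qed
      qed
      then have "supp m = {}" using T by (simp add: ok_def)
      then have 1: "even (q m (\<pi> i))" using ik(1) \<pi>d by (auto simp: supp_def)
      have "mmul d A Y\<pi> i k = (\<Sum>j<f. A i j * Y\<pi> j k) + (\<Sum>j\<in>{f..<d}. A i j * Y\<pi> j k)"
        using fd sum.union_disjoint[of "{..<f}" "{f..<d}" "\<lambda>j. A i j * Y\<pi> j k"]
        by (simp add: mmul_def ivl_disj_un ivl_disj_int)
      also have "(\<Sum>j\<in>{f..<d}. A i j * Y\<pi> j k) = (\<Sum>j\<in>{f..<d}. if j = i then Y\<pi> i k else 0)"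
        using False by (intro sum.cong) (auto simp: A_def)
      also have "\<dots> = Y (\<pi> i) k" using False ik by (simp add: Y\<pi>_def)
      \<comment> \<open>Row \<open>i\<close> of \<open>A Y\<close> and the even number
        \<open>q m (\<pi> i)\<close> have an even sum, since \<open>C\<close> agrees modulo 2 with
        the words of the \<open>M (\<pi> j)\<close>.\<close>
      finally have "mmul d A Y\<pi> i k + q m (\<pi> i)
          = 2 * Y (\<pi> i) k + (\<Sum>j<f. Y (\<pi> j) k * (A i j - q (M (\<pi> j)) (\<pi> i)))"
        by (simp add: qm Y\<pi>_def right_diff_distrib sum_subtractf mult.commute)
      also have "even \<dots>"
      proof (rule dvd_add[OF dvd_triv_left], intro dvd_sum dvd_mult)
        fix j assume "j \<in> {..<f}"
        then show "even (A i j - q (M (\<pi> j)) (\<pi> i))"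
          using parity[of i j] ik False by (simp add: Z_def wirth_inv_def)
      qed
      finally show ?thesis using 1 by simp
    qed
  qed
  moreover have "mat_equiv d V V\<pi>"
    by (rule mat_equiv_permute_cols[OF \<pi>]) (simp add: V\<pi>_def)
  ultimately have "mat_equiv d A V" using mat_equiv_sym mat_equiv_trans by blast
  then show thesis using that A by (auto simp: wirth_def)
qed

section \<open>Splitting off segments\<close>

text \<open>Continued by the identity without bound, so that one matrix serves in every dimension
  from \<open>n\<close> on and \<open>dg_dg\<close> is an equation.\<close>

definition dg :: "nat \<Rightarrow> imat \<Rightarrow> imat" where
  "dg n B i j = (if i < n \<and> j < n then B i j else if i = j then 1 else 0)"

text \<open>The segment comes first here, as in \<open>one_irreducible\<close>; \<open>dg\<close>
  puts it last, as in \<open>add_segs\<close>.\<close>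

definition dg1 :: "imat \<Rightarrow> imat" where
  "dg1 B i j = (if i = 0 \<or> j = 0 then if i = j then 1 else 0 else B (i - 1) (j - 1))"

lemma dg_dg: "n \<le> m \<Longrightarrow> dg m (dg n B) = dg n B"
  by (intro ext) (auto simp: dg_def)

lemma convex_hull_Un_hulls:
  "convex hull (convex hull S \<union> convex hull T) = convex hull (S \<union> T)"
  by (simp only: hull_Un_left[symmetric] hull_Un_right[symmetric])

lemma seg_shift: "shift n ` seg = convex hull {shift n (vec 1 (\<lambda>_. 1)), - shift n (vec 1 (\<lambda>_. 1))}"
proof -
  have "vec 1 (\<lambda>_. -1) = - vec 1 (\<lambda>_. 1)" by (rule poly_mapping_eqI) (simp add: lookup_pt)
  then show ?thesis
    unfolding seg_def convex_hull_linear_image[OF linear_shift]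
    by (simp add: linear_neg[OF linear_shift])
qed

lemma dsum_PA_seg: "dsum m (PA m B) seg = PA (Suc m) (dg m B)"
proof -
  have 1: "col (Suc m) (dg m B) j = col m B j" if "j < m" for j
    using that by (intro poly_mapping_eqI) (auto simp: col_def lookup_vec dg_def)
  have 2: "col (Suc m) (dg m B) m = shift m (vec 1 (\<lambda>_. 1))"
    by (intro poly_mapping_eqI) (auto simp: col_def lookup_vec dg_def lookup_shift)
  have 3: "col (Suc m) (dg m B) ` {..<Suc m} = insert (shift m (vec 1 (\<lambda>_. 1))) (col m B ` {..<m})"
    unfolding lessThan_Suc image_insert 2 using image_cong[OF refl 1, of "{..<m}"] by simp
  show ?thesis
    unfolding dsum_def PA_def seg_shift convex_hull_Un_hulls 3
    by (rule arg_cong[of _ _ "(hull) convex"]) auto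
qed

lemma dsum_seg_PA: "dsum 1 seg (PA m B) = PA (Suc m) (dg1 B)"
proof -
  have 1: "col (Suc m) (dg1 B) (Suc j) = shift 1 (col m B j)" for j
    by (intro poly_mapping_eqI) (auto simp: col_def lookup_vec dg1_def lookup_shift)
  have 2: "col (Suc m) (dg1 B) 0 = vec 1 (\<lambda>_. 1)"
    by (intro poly_mapping_eqI) (auto simp: col_def lookup_vec dg1_def)
  have 3: "col (Suc m) (dg1 B) ` {..<Suc m} = insert (vec 1 (\<lambda>_. 1)) (shift 1 ` col m B ` {..<m})"
    unfolding lessThan_Suc_eq_insert_0 image_insert 2 image_image 1 by simp
  have 4: "vec 1 (\<lambda>_. -1) = - vec 1 (\<lambda>_. 1)" by (rule poly_mapping_eqI) (simp add: lookup_pt)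
  show ?thesis
    unfolding dsum_def PA_def seg_def convex_hull_linear_image[OF linear_shift] convex_hull_Un_hulls 3 4
    by (rule arg_cong[of _ _ "(hull) convex"]) (simp add: image_Un image_image linear_neg[OF linear_shift] insert_commute)
qed

lemma zero_in_seg: "0 \<in> seg"
proof -
  have "(1/2) *\<^sub>R vec 1 (\<lambda>_. 1) + (1/2) *\<^sub>R vec 1 (\<lambda>_. -1) \<in> seg"
    unfolding seg_def by (rule convexD) (auto intro: hull_inc)
  also have "(1/2) *\<^sub>R vec 1 (\<lambda>_. 1) + (1/2) *\<^sub>R vec 1 (\<lambda>_. -1) = 0"
    by (rule poly_mapping_eqI) (simp add: lookup_pt)
  finally show ?thesis .
qed

lemma shift_zero: "shift n 0 = 0"
  by (rule linear_0[OF linear_shift])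

lemma zero_in_seg_shift: "0 \<in> shift n ` seg"
  using image_eqI[of 0 "shift n" 0 seg] zero_in_seg by (simp add: shift_zero)

text \<open>The segment already contains 0, so replacing the factor \<open>{0}\<close> by the empty
  \<open>PA 0 B\<close> changes nothing.\<close>

lemma dsum_zero_seg: "dsum 0 {0} seg = PA 1 (dg 0 B)"
proof -
  have "dsum 0 {0} seg = dsum 0 (PA 0 B) seg"
    using zero_in_seg_shift[of 0] by (simp add: dsum_def PA_def insert_absorb)
  then show ?thesis by (simp add: dsum_PA_seg)
qed

lemma dsum_seg_zero: "dsum 1 seg {0} = PA 1 (dg1 B)"
proof -
  have "dsum 1 seg {0} = dsum 1 seg (PA 0 B)"
    using zero_in_seg by (simp add: dsum_def PA_def shift_zero insert_absorb)
  then show ?thesis using dsum_seg_PA[of 0 B] by simp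
qed

text \<open>The convex hull of no points is empty, so \<open>PA 0 B\<close> is not the point polytope.\<close>

definition block_polytope :: "nat \<Rightarrow> imat \<Rightarrow> pt set" where
  "block_polytope n B = (if n = 0 then {0} else PA n B)"

lemma PA_dg_self: "PA n (dg n B) = PA n B"
  by (rule PA_cong) (simp add: eqm_def dg_def)

text \<open>The hypothesis excludes the bare point \<open>{0}\<close>, which is not the empty
  \<open>PA 0\<close>. For \<open>n = 0\<close> the first segment is attached to \<open>{0}\<close>,
  all later ones to a \<open>PA\<close>.\<close>

lemma add_segs_block:
  assumes "n + r \<ge> 1"
  shows "add_segs n (block_polytope n B) r = PA (n + r) (dg n B)"
  using assms
proof (induction r)
  case 0
  then show ?case by (simp add: block_polytope_def PA_dg_self)
next
  case (Suc r)
  show ?case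
  proof (cases "n + r = 0")
    case True
    then show ?thesis using dsum_zero_seg[of B] by (simp add: block_polytope_def)
  next
    case False
    then have "add_segs n (block_polytope n B) (Suc r) = dsum (n + r) (PA (n + r) (dg n B)) seg"
      using Suc.IH False by (metis One_nat_def Suc_leI add_segs.simps(2) bot_nat_0.not_eq_extremum)
    then show ?thesis by (simp add: dsum_PA_seg dg_dg)
  qed
qed

lemma dsum_seg_block: "dsum 1 seg (block_polytope m B) = PA (Suc m) (dg1 B)"
  using dsum_seg_PA dsum_seg_zero by (cases "m = 0") (auto simp: block_polytope_def)

lemma mat_equiv_dg1: "mat_equiv (Suc m) (dg m B) (dg1 B)"
proof (rule mat_equiv_permute)
  \<comment> \<open>The cyclic shift that takes index 0 to the last index \<open>m\<close> and
    lowers the others by one.\<close>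
  define \<pi> where "\<pi> k = (if k = 0 then m else if k \<le> m then k - 1 else k)" for k
  have "inj_on \<pi> {..<Suc m}" by (auto simp: \<pi>_def inj_on_def)
  moreover have "\<pi> ` {..<Suc m} \<subseteq> {..<Suc m}" by (auto simp: \<pi>_def)
  ultimately have "bij_betw \<pi> {..<Suc m} {..<Suc m}"
    by (simp add: bij_betw_def endo_inj_surj)
  then show "\<pi> permutes {..<Suc m}" by (rule bij_imp_permutes) (auto simp: \<pi>_def)
  show "dg1 B i j = dg m B (\<pi> i) (\<pi> j)" if "i < Suc m" "j < Suc m" for i j
    using that by (auto simp: dg1_def dg_def \<pi>_def)
qed

lemma sum_less_split:
  fixes g :: "nat \<Rightarrow> 'a::comm_monoid_add"
  assumes "n \<le> d"
  shows "(\<Sum>k<d. g k) = (\<Sum>k<n. g k) + (\<Sum>k\<in>{n..<d}. g k)"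
  using sum.atLeastLessThan_concat[of 0 n d g] assms by (simp add: atLeast0LessThan)

text \<open>Block sums with an identity multiply blockwise (\<open>mul\<close>), so \<open>U\<close>
  and its inverse extend by \<open>dg n\<close>, and the permutation extends by fixed
  points.\<close>

lemma mat_equiv_dg:
  assumes "n \<le> d" "mat_equiv n A B"
  shows "mat_equiv d (dg n A) (dg n B)"
proof -
  obtain U \<sigma> W where \<sigma>: "\<sigma> permutes {..<n}" and B: "eqm n B (mmul n U (\<lambda>i j. A i (\<sigma> j)))"
    and W: "eqm n (mmul n U W) idm" "eqm n (mmul n W U) idm"
    using assms unfolding mat_equiv_iff unimodular_iff by blast
  have mul: "eqm d (mmul d (dg n C) (dg n D)) (dg n (mmul n C D))" for C D
    unfolding eqm_def
  proof (intro allI impI)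
    fix i j assume ij: "i < d" "j < d"
    show "mmul d (dg n C) (dg n D) i j = dg n (mmul n C D) i j"
    proof (cases "i < n")
      case True
      have "(\<Sum>k\<in>{n..<d}. dg n C i k * dg n D k j) = 0"
        using True by (intro sum.neutral) (auto simp: dg_def)
      moreover have "(\<Sum>k<n. dg n C i k * dg n D k j) = (\<Sum>k<n. if j < n then C i k * D k j else 0)"
        using True by (intro sum.cong) (auto simp: dg_def)
      ultimately show ?thesis
        using True assms(1) by (simp add: mmul_def sum_less_split[of n d] dg_def)
    next
      case False
      have "mmul d (dg n C) (dg n D) i j = (\<Sum>k<d. (if i = k then 1 else 0) * dg n D k j)"
        unfolding mmul_def by (rule sum.cong) (use False in \<open>auto simp: dg_def\<close>)
      then show ?thesis using ij False by (simp add: sum_delta_mult) (simp add: dg_def)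
    qed
  qed
  have cong: "eqm d (dg n C) (dg n D)" if "eqm n C D" for C D
    using that by (auto simp: eqm_def dg_def)
  have id: "dg n idm = idm" by (intro ext) (auto simp: dg_def idm_def)
  have "eqm d (mmul d (dg n U) (dg n W)) idm" "eqm d (mmul d (dg n W) (dg n U)) idm"
    using eqm_trans[OF mul cong[OF W(1)]] eqm_trans[OF mul cong[OF W(2)]] by (simp_all add: id)
  then have "unimodular d (dg n U)" unfolding unimodular_iff by blast
  moreover have "\<sigma> permutes {..<d}" using permutes_subset[OF \<sigma>] assms(1) by auto
  moreover have "eqm d (dg n (\<lambda>i j. A i (\<sigma> j))) (\<lambda>i j. dg n A i (\<sigma> j))"
  proof -
    have "\<sigma> j < n \<longleftrightarrow> j < n" for j using permutes_less[OF \<sigma>] .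
    moreover have "\<sigma> j = j" if "\<not> j < n" for j using that permutes_not_in[OF \<sigma>, of j] by simp
    ultimately show ?thesis unfolding eqm_def dg_def by (smt (verit))
  qed
  then have "eqm d (dg n B) (mmul d (dg n U) (\<lambda>i j. dg n A i (\<sigma> j)))"
    using eqm_trans[OF cong[OF B] eqm_sym[OF mul]] mmul_cong[OF eqm_refl] eqm_trans by blast
  ultimately show ?thesis unfolding mat_equiv_iff by blast
qed

section \<open>Zero rows of the block \<open>C\<close>, minimal blocks and the reduction\<close>

lemma single_one_rows_wirth:
  assumes A: "wirth_f d f A"
  shows "single_one_rows d A = {i. f \<le> i \<and> i < d \<and> (\<forall>j<f. A i j = 0)}"
proof -
  note D = wirth_fD[OF A]
  have "card {j. j < d \<and> A i j = 1} = 1 \<longleftrightarrow> f \<le> i \<and> (\<forall>j<f. A i j = 0)" if i: "i < d" for i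
  proof (cases "i < f")
    case True
    then have "{j. j < d \<and> A i j = 1} = {}" using i D(2) by auto
    then have "card {j. j < d \<and> A i j = 1} = 0" by (simp only: card.empty)
    then show ?thesis using True by linarith
  next
    case False
    \<comment> \<open>Such a row has its diagonal 1 besides the ones in \<open>C\<close>, so a
      single 1 means a zero row of \<open>C\<close>.\<close>
    have eq: "{j. j < d \<and> A i j = 1} = insert i {j. j < f \<and> A i j = 1}"
      using False i D(1,3) by (auto split: if_splits) (metis not_less zero_neq_one)
    have "card {j. j < d \<and> A i j = 1} = Suc (card {j. j < f \<and> A i j = 1})"
      unfolding eq using False by (subst card_insert_disjoint) auto
    then have "card {j. j < d \<and> A i j = 1} = 1 \<longleftrightarrow> {j. j < f \<and> A i j = 1} = {}"
      by (simp add: card_eq_0_iff)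
    also have "\<dots> \<longleftrightarrow> (\<forall>j<f. A i j = 0)" using D(4)[of i] False i by fastforce
    finally show ?thesis using False by simp
  qed
  then show ?thesis by (auto simp: single_one_rows_def)
qed

lemma one_minimal_iff:
  "one_minimal d A \<longleftrightarrow> wirth d A \<and> single_one_rows d A = {}"
proof
  assume "one_minimal d A"
  then obtain f where f: "wirth_f d f A" "\<forall>i. f \<le> i \<and> i < d \<longrightarrow> (\<exists>j<f. A i j = 1)"
    by (auto simp: one_minimal_def)
  have "single_one_rows d A = {}"
    unfolding single_one_rows_wirth[OF f(1)] using f(2) by fastforce
  then show "wirth d A \<and> single_one_rows d A = {}" using f(1) by (auto simp: wirth_def)
next
  assume *: "wirth d A \<and> single_one_rows d A = {}"
  then obtain f where f: "wirth_f d f A" by (auto simp: wirth_def)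
  have "\<exists>j<f. A i j = 1" if i: "f \<le> i" "i < d" for i
  proof -
    have "i \<notin> single_one_rows d A" using * by simp
    then obtain j where "j < f" "A i j \<noteq> 0" unfolding single_one_rows_wirth[OF f] using i by auto
    then show ?thesis using wirth_fD(4)[OF f i(2) _ i(1)] by blast
  qed
  then show "one_minimal d A" unfolding one_minimal_def using f by blast
qed

definition min_block :: "nat \<Rightarrow> imat \<Rightarrow> bool" where
  "min_block n B \<longleftrightarrow> n = 0 \<or> one_minimal n B"

text \<open>The added indices only contribute zero rows to \<open>C\<close>: \<open>f\<close> and
  the column counts stay, and by minimality there are no other zero rows.\<close>

lemma min_block_dg:
  assumes d: "d \<ge> 1" and n: "n \<le> d" and B: "min_block n B"
  shows "wirth d (dg n B)" "single_one_rows d (dg n B) = {n..<d}"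
proof -
  have "\<exists>f. wirth_f d f (dg n B) \<and> f \<le> n \<and> (\<forall>i. f \<le> i \<and> i < n \<longrightarrow> (\<exists>j<f. B i j = 1))"
  proof (cases "n = 0")
    case True
    have "wirth_f d 0 (dg n B)" using d True by (auto simp: wirth_f_def dg_def)
    then show ?thesis using True by auto
  next
    case False
    then obtain f where f: "wirth_f n f B" "\<forall>i. f \<le> i \<and> i < n \<longrightarrow> (\<exists>j<f. B i j = 1)"
      using B by (auto simp: min_block_def one_minimal_def)
    note D = wirth_fD[OF f(1)]
    have "wirth_f d f (dg n B)"
      unfolding wirth_f_def
    proof (intro conjI allI impI)
      fix j assume j: "j < f"
      have "{i. f \<le> i \<and> i < d \<and> dg n B i j = 1} = {i. f \<le> i \<and> i < n \<and> B i j = 1}"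
        using j D(1) n by (auto simp: dg_def split: if_splits)
      then show "odd (card {i. f \<le> i \<and> i < d \<and> dg n B i j = 1})" using D(5)[OF j] by simp
    next
      fix i j assume ij: "i < d" "j < d"
      show "dg n B i j = (if i = j then 2 else 0)" if "i < f"
        using that ij D(1) D(2)[of i j] by (auto simp: dg_def)
      show "dg n B i j = (if i = j then 1 else 0)" if "f \<le> i \<and> f \<le> j"
        using that ij D(3)[of i j] by (auto simp: dg_def)
      show "dg n B i j \<in> {0, 1}" if "f \<le> i \<and> j < f"
        using that ij D(4)[of i j] by (auto simp: dg_def)
    qed (use D(1) n in simp)
    then show ?thesis using f(2) D(1) by (intro exI[of _ f]) auto
  qed
  then obtain f where f: "wirth_f d f (dg n B)" "f \<le> n" "\<forall>i. f \<le> i \<and> i < n \<longrightarrow> (\<exists>j<f. B i j = 1)"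
    by blast
  show "wirth d (dg n B)" using f(1) by (auto simp: wirth_def)
  have zero_row: "(\<forall>j<f. dg n B i j = 0) \<longleftrightarrow> n \<le> i" if i: "f \<le> i" "i < d" for i
  proof (cases "i < n")
    case True
    then obtain j where "j < f" "B i j = 1" using f(3) i by blast
    then have "dg n B i j \<noteq> 0" "j < f" using True f(2) by (auto simp: dg_def)
    then show ?thesis using True by auto
  next
    case False
    then show ?thesis using f(2) by (auto simp: dg_def)
  qed
  show "single_one_rows d (dg n B) = {n..<d}"
  proof (rule set_eqI)
    fix i
    show "i \<in> single_one_rows d (dg n B) \<longleftrightarrow> i \<in> {n..<d}"
      unfolding single_one_rows_wirth[OF f(1)] using zero_row[of i] f(2) by fastforce
  qed
qed

text \<open>At a zero row of \<open>C\<close> both the row and the column of that index are unit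
  vectors, so moving these indices to the end makes \<open>A\<close> block diagonal.\<close>

lemma reduction_equiv:
  assumes "wirth d A" and n: "n = d - card (single_one_rows d A)"
  shows "min_block n (reduction d A)" "mat_equiv d A (dg n (reduction d A))"
    "card (single_one_rows d A) \<le> d"
proof -
  let ?S = "single_one_rows d A"
  obtain f where A: "wirth_f d f A" using assms by (auto simp: wirth_def)
  note D = wirth_fD[OF A]
  note S = single_one_rows_wirth[OF A]
  define R where "R = reduction d A"
  define J where "J = {..<d} - ?S"
  define ks where "ks = sorted_list_of_set J"
  have Sd: "?S \<subseteq> {..<d}" by (auto simp: S)
  have finJ: "finite J" by (simp add: J_def)
  show "card ?S \<le> d" using card_mono[OF _ Sd] by simp
  have cJ: "card J = n" using Sd finite_subset[OF Sd] by (simp add: J_def n card_Diff_subset)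
  have len: "length ks = n" by (simp add: ks_def cJ)
  have R: "R i j = A (ks ! i) (ks ! j)" for i j
    by (simp add: R_def reduction_def ks_def J_def Let_def)
  have "J \<subseteq> {..<d}" by (auto simp: J_def)
  from sorting_permutation[OF this] obtain \<pi> where \<pi>: "\<pi> permutes {..<d}"
    and \<pi>ks: "\<And>k. k < n \<Longrightarrow> \<pi> k = ks ! k" and \<pi>J: "\<And>k. k < d \<Longrightarrow> \<pi> k \<in> J \<longleftrightarrow> k < n"
    unfolding cJ ks_def[symmetric] by metis
  have \<pi>d: "\<pi> k < d \<longleftrightarrow> k < d" for k using permutes_less[OF \<pi>] .
  have \<pi>inj: "\<pi> i = \<pi> j \<longleftrightarrow> i = j" for i j using permutes_inj[OF \<pi>] by (simp add: inj_eq)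
  have nd: "n \<le> d" by (simp add: n)
  show "mat_equiv d A (dg n (reduction d A))"
  proof (rule mat_equiv_permute[OF \<pi>])
    fix i j assume ij: "i < d" "j < d"
    have in_S: "f \<le> \<pi> k \<and> (\<forall>l<f. A (\<pi> k) l = 0)" if "k < d" "\<not> k < n" for k
      using that \<pi>J[of k] \<pi>d[of k] by (auto simp: J_def S)
    show "dg n (reduction d A) i j = A (\<pi> i) (\<pi> j)"
    proof (cases "i < n \<and> j < n")
      case True
      then show ?thesis using R \<pi>ks by (simp add: dg_def R_def)
    next
      case False
      have "A (\<pi> i) (\<pi> j) = (if i = j then 1 else 0)"
      proof (cases "i < n")
        case True
        then have "f \<le> \<pi> j" "i \<noteq> j" using False in_S[of j] ij by auto
        then show ?thesis
          using D(2)[of "\<pi> i" "\<pi> j"] D(3)[of "\<pi> i" "\<pi> j"] ij \<pi>d \<pi>inj by (cases "\<pi> i < f") auto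
      next
        case iN: False
        show ?thesis
          using in_S[OF ij(1) iN] D(3)[of "\<pi> i" "\<pi> j"] ij \<pi>d \<pi>inj by (cases "\<pi> j < f") auto
      qed
      then show ?thesis using False by (auto simp: dg_def)
    qed
  qed
  define J2 where "J2 = J - {..<f}"
  have Jf: "{..<f} \<subseteq> J" using D(1) by (auto simp: J_def S)
  \<comment> \<open>The first \<open>f\<close> indices all survive and keep their places, so the
    reduction is a Wirth matrix with the same \<open>f\<close>.\<close>
  have ks: "ks = [0..<f] @ sorted_list_of_set J2"
    unfolding ks_def
  proof (rule sorted_distinct_set_unique)
    show "sorted ([0..<f] @ sorted_list_of_set J2)"
      unfolding sorted_append using finJ by (auto simp: J2_def)
    show "distinct ([0..<f] @ sorted_list_of_set J2)" using finJ by (auto simp: J2_def)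
    show "set (sorted_list_of_set J) = set ([0..<f] @ sorted_list_of_set J2)"
      using finJ Jf by (auto simp: J2_def)
  qed (use finJ in auto)
  have dist: "distinct ks" using finJ by (simp add: ks_def)
  have fn: "f \<le> n" using len ks by auto
  have lo: "ks ! i = i" if "i < f" for i using that by (simp add: ks nth_append)
  have hi: "ks ! i \<in> J2" if "f \<le> i" "i < n" for i
  proof -
    have "ks ! i = sorted_list_of_set J2 ! (i - f)" using that by (simp add: ks nth_append)
    moreover have "i - f < length (sorted_list_of_set J2)" using that len by (simp add: ks)
    ultimately show ?thesis using nth_mem finJ set_sorted_list_of_set[of J2] by (metis J2_def finite_Diff)
  qed
  have J2: "f \<le> l \<and> l < d \<and> (\<exists>j<f. A l j = 1)" if "l \<in> J2" for l
  proof -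
    have "f \<le> l" "l < d" "l \<notin> ?S" using that by (auto simp: J2_def J_def)
    then obtain j where "j < f" "A l j \<noteq> 0" by (auto simp: S)
    then show ?thesis using \<open>f \<le> l\<close> \<open>l < d\<close> D(4)[of l j] by blast
  qed
  have "one_minimal n R" if n0: "n \<noteq> 0"
    unfolding one_minimal_def
  proof (rule exI[of _ f], intro conjI allI impI)
    \<comment> \<open>Needed for \<open>f < n\<close>: a column of \<open>C\<close> has odd weight,
      so some row of \<open>C\<close> is nonzero and survives.\<close>
    have "J2 \<noteq> {}"
    proof
      assume "J2 = {}"
      then have "J = {..<f}" using Jf by (auto simp: J2_def)
      then have "f > 0" using n0 cJ by auto
      have "{i. f \<le> i \<and> i < d \<and> A i 0 = 1} \<noteq> {}"
      proof
        assume "{i. f \<le> i \<and> i < d \<and> A i 0 = 1} = {}"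
        then show False using D(5)[OF \<open>f > 0\<close>] by (simp only: card.empty even_zero not_True_eq_False)
      qed
      then obtain i where "f \<le> i" "i < d" "A i 0 = 1" by auto
      then have "i \<in> J2" using \<open>f > 0\<close> by (auto simp: J2_def J_def S)
      then show False using \<open>J2 = {}\<close> by simp
    qed
    then have "f < n" using len ks finJ by (auto simp: J2_def card_gt_0_iff)
    show "wirth_f n f R"
      unfolding wirth_f_def
    proof (intro conjI allI impI)
      fix i j assume ij: "i < n" "j < n"
      have "ks ! i \<in> J" "ks ! j \<in> J" using ij len finJ nth_mem[of _ ks] by (auto simp: ks_def)
      then have d: "ks ! i < d" "ks ! j < d" by (auto simp: J_def)
      have eq: "ks ! i = ks ! j \<longleftrightarrow> i = j" using ij len dist by (simp add: nth_eq_iff_index_eq)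
      show "R i j = (if i = j then 2 else 0)" if "i < f"
        using that d eq D(2)[of "ks ! i" "ks ! j"] lo[OF that] by (simp add: R)
      show "R i j = (if i = j then 1 else 0)" if "f \<le> i \<and> f \<le> j"
        using that d eq D(3)[of "ks ! i" "ks ! j"] J2[OF hi[of i]] J2[OF hi[of j]] ij by (simp add: R)
      show "R i j \<in> {0, 1}" if "f \<le> i \<and> j < f"
        using that d D(4)[of "ks ! i" "ks ! j"] J2[OF hi[of i]] lo[of j] ij by (auto simp: R)
    next
      fix j assume j: "j < f"
      \<comment> \<open>The deleted rows vanish in \<open>C\<close>, so no 1 of column
        \<open>j\<close> is lost.\<close>
      have "(!) ks ` {i. f \<le> i \<and> i < n \<and> R i j = 1} = {i. f \<le> i \<and> i < d \<and> A i j = 1}"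
      proof (intro subset_antisym subsetI)
        fix l assume l: "l \<in> {i. f \<le> i \<and> i < d \<and> A i j = 1}"
        then have "l \<in> J" using j by (auto simp: J_def S)
        then have "l \<in> set ks" using finJ by (simp add: ks_def)
        then obtain i where i: "i < n" "l = ks ! i" using len by (auto simp: in_set_conv_nth)
        have "f \<le> i" using i l lo[of i] by (cases "i < f") auto
        then show "l \<in> (!) ks ` {i. f \<le> i \<and> i < n \<and> R i j = 1}"
          using i l lo[OF j] by (intro image_eqI[of _ _ i]) (auto simp: R)
      qed (use J2 hi lo[OF j] in \<open>auto simp: R\<close>)
      moreover have "inj_on ((!) ks) {i. f \<le> i \<and> i < n \<and> R i j = 1}"
        using dist len by (auto simp: inj_on_def nth_eq_iff_index_eq)
      ultimately have "card {i. f \<le> i \<and> i < n \<and> R i j = 1} = card {i. f \<le> i \<and> i < d \<and> A i j = 1}"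
        using card_image[of "(!) ks" "{i. f \<le> i \<and> i < n \<and> R i j = 1}"] by simp
      then show "odd (card {i. f \<le> i \<and> i < n \<and> R i j = 1})"
        using D(5)[OF j] by simp
    qed (rule \<open>f < n\<close>)
    show "\<exists>j<f. R i j = 1" if i: "f \<le> i \<and> i < n" for i
    proof -
      have "ks ! i \<in> J2" using hi i by simp
      then obtain j where j: "j < f" "A (ks ! i) j = 1" using J2 by blast
      then show ?thesis using lo[OF j(1)] by (intro exI[of _ j]) (simp add: R)
    qed
  qed
  then show "min_block n (reduction d A)" by (auto simp: min_block_def R_def)
qed

text \<open>From \<open>f\<close> on the columns are unit vectors, so \<open>y k\<close> is known
  there: \<open>s\<close> at \<open>j0\<close> and 0 elsewhere. On a column \<open>j < f\<close> the
  top entry 2 drops out modulo 2, leaving \<open>s * A j0 j\<close> if \<open>f \<le> j0\<close> and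
  0 otherwise. Oddness of \<open>s\<close> then excludes \<open>j0 < f\<close> and makes row
  \<open>j0\<close> of \<open>C\<close> vanish.\<close>

lemma split_column_wirth:
  assumes A: "wirth_f d f A" and j0: "j0 < d" and "odd s"
    and y: "\<And>j. j < d \<Longrightarrow> (\<Sum>k<d. y k * A k j) = (if j = j0 then s else 0)"
  shows "j0 \<in> single_one_rows d A"
proof -
  note D = wirth_fD[OF A]
  have hi: "y k = (if k = j0 then s else 0)" if k: "f \<le> k" "k < d" for k
  proof -
    have "(\<Sum>l<d. y l * A l k) = (\<Sum>l<d. y l * (if l = k then 1 else 0))"
    proof (rule sum.cong)
      fix l assume "l \<in> {..<d}"
      then show "y l * A l k = y l * (if l = k then 1 else 0)"
        using k D(2)[of l k] D(3)[of l k] by (cases "l < f") auto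
    qed simp
    also have "\<dots> = y k" using k(2) by (rule sum_delta_mult)
    finally show ?thesis using y[OF k(2)] by simp
  qed
  have par: "even (\<Sum>k<d. y k * A k j) \<longleftrightarrow> even (if f \<le> j0 then s * A j0 j else 0)" if j: "j < f" for j
  proof -
    have "(\<Sum>k<d. y k * A k j) = (\<Sum>k<f. y k * A k j) + (\<Sum>k\<in>{f..<d}. y k * A k j)"
      using D(1) by (intro sum_less_split) simp
    moreover have "even (\<Sum>k<f. y k * A k j)"
      using j D(1,2) by (intro dvd_sum dvd_mult) auto
    moreover have "(\<Sum>k\<in>{f..<d}. y k * A k j) = (\<Sum>k\<in>{f..<d}. if k = j0 then s * A j0 j else 0)"
      by (rule sum.cong) (auto simp: hi)
    moreover have "\<dots> = (if f \<le> j0 then s * A j0 j else 0)" using j0 by simp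
    ultimately show ?thesis by simp
  qed
  have f0: "f \<le> j0"
  proof (rule ccontr)
    assume "\<not> f \<le> j0"
    then show False using par[of j0] y[OF j0] \<open>odd s\<close> by simp
  qed
  have "A j0 j = 0" if "j < f" for j
  proof -
    have "even (s * A j0 j)" using par[OF that] y[of j] that D(1) f0 by auto
    then show ?thesis using D(4)[OF j0 that f0] \<open>odd s\<close> by auto
  qed
  then show ?thesis unfolding single_one_rows_wirth[OF A] using f0 j0 by simp
qed

lemma single_one_rows_row:
  assumes A: "wirth_f d f A" and i: "i \<in> single_one_rows d A" and j: "j < d"
  shows "A i j = (if j = i then 1 else 0)"
  using i j wirth_fD(1)[OF A] wirth_fD(3)[OF A, of i j] unfolding single_one_rows_wirth[OF A]
  by (cases "j < f") auto

text \<open>Row \<open>j\<close> of \<open>B\<close> is a unit vector, so row \<open>j\<close> of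
  \<open>U\<close> is an integral functional that is 1 on one column of \<open>A\<close> and 0 on
  the others; \<open>split_column_wirth\<close> applies with \<open>s = 1\<close>.\<close>

lemma mat_equiv_single_one_rows:
  assumes A: "wirth d A" and B: "wirth d B" and \<sigma>: "\<sigma> permutes {..<d}"
    and eq: "eqm d B (mmul d U (\<lambda>i j. A i (\<sigma> j)))" and j: "j \<in> single_one_rows d B"
  shows "\<sigma> j \<in> single_one_rows d A"
proof -
  obtain f g where A: "wirth_f d f A" and B: "wirth_f d g B" using A B by (auto simp: wirth_def)
  have jd: "j < d" using j by (auto simp: single_one_rows_def)
  show ?thesis
  proof (rule split_column_wirth[OF A, of _ 1])
    show "\<sigma> j < d" using permutes_less[OF \<sigma>] jd by simp
    fix l assume l: "l < d"
    have l': "inv \<sigma> l < d" "\<sigma> (inv \<sigma> l) = l"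
      using permutes_less[OF permutes_inv[OF \<sigma>]] permutes_inverses(1)[OF \<sigma>] l by auto
    have "(\<Sum>k<d. U j k * A k l) = B j (inv \<sigma> l)"
      using eq jd l' by (simp add: eqm_def mmul_def)
    also have "\<dots> = (if inv \<sigma> l = j then 1 else 0)" by (rule single_one_rows_row[OF B j l'(1)])
    finally show "(\<Sum>k<d. U j k * A k l) = (if l = \<sigma> j then 1 else 0)"
      using permutes_inv_eq[OF \<sigma>] by metis
  qed simp
qed

lemma mat_equiv_card_single_one_rows:
  assumes "wirth d A" "wirth d B" "mat_equiv d A B"
  shows "card (single_one_rows d A) = card (single_one_rows d B)"
proof -
  have "card (single_one_rows d B) \<le> card (single_one_rows d A)"
    if "wirth d A" "wirth d B" "mat_equiv d A B" for A B
  proof -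
    note AB = that
    obtain U \<sigma> where \<sigma>: "\<sigma> permutes {..<d}" and eq: "eqm d B (mmul d U (\<lambda>i j. A i (\<sigma> j)))"
      using AB(3) unfolding mat_equiv_iff by blast
    have "\<sigma> ` single_one_rows d B \<subseteq> single_one_rows d A"
      using mat_equiv_single_one_rows[OF AB(1,2) \<sigma> eq] by blast
    then show ?thesis
      using card_inj_on_le[of \<sigma> "single_one_rows d B"] inj_on_subset[OF permutes_inj[OF \<sigma>]]
      by (simp add: single_one_rows_def)
  qed
  from this[OF assms] this[OF assms(2,1) mat_equiv_sym[OF assms(3)]] show ?thesis by simp
qed

text \<open>The count of zero rows of \<open>C\<close> fixes \<open>n\<close>, and the permutation
  preserves the set of these indices. This forces \<open>U\<close> to be block diagonal, and its
  upper left block carries \<open>B\<close> to \<open>B'\<close>.\<close>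

lemma mat_equiv_dg_cancel:
  assumes d: "d \<ge> 1" and n: "n \<le> d" "n' \<le> d" and B: "min_block n B" "min_block n' B'"
    and equiv: "mat_equiv d (dg n B) (dg n' B')"
  shows "n = n'" "mat_equiv n B B'"
proof -
  note w = min_block_dg(1)[OF d n(1) B(1)] and w' = min_block_dg(1)[OF d n(2) B(2)]
  note s = min_block_dg(2)[OF d n(1) B(1)] and s' = min_block_dg(2)[OF d n(2) B(2)]
  show nn: "n = n'" using mat_equiv_card_single_one_rows[OF w w' equiv] n by (simp add: s s')
  obtain U \<sigma> W where \<sigma>: "\<sigma> permutes {..<d}" and eq: "eqm d (dg n' B') (mmul d U (\<lambda>i j. dg n B i (\<sigma> j)))"
    and W: "eqm d (mmul d U W) idm" "eqm d (mmul d W U) idm"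
    using equiv unfolding mat_equiv_iff unimodular_iff by blast
  have \<sigma>d: "\<sigma> j < d \<longleftrightarrow> j < d" for j using permutes_less[OF \<sigma>] .
  have "\<sigma> ` {n..<d} \<subseteq> {n..<d}"
    using mat_equiv_single_one_rows[OF w w' \<sigma> eq, unfolded s s'] nn by blast
  then have img: "\<sigma> ` {n..<d} = {n..<d}"
    using inj_on_subset[OF permutes_inj[OF \<sigma>]] by (intro endo_inj_surj) auto
  have \<sigma>n: "\<sigma> j < n \<longleftrightarrow> j < n" if "j < d" for j
  proof -
    have "\<sigma> j \<in> \<sigma> ` {n..<d} \<longleftrightarrow> j \<in> {n..<d}"
      by (rule inj_image_mem_iff[OF permutes_inj[OF \<sigma>]])
    then show ?thesis using that \<sigma>d[of j] by (auto simp: img)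
  qed
  have ent: "dg n B' i j = (\<Sum>k<d. U i k * dg n B k (\<sigma> j))" if "i < d" "j < d" for i j
    using eq that nn by (simp add: eqm_def mmul_def)
  \<comment> \<open>Column \<open>k\<close> of \<open>dg n B\<close> is a unit vector, so
    \<open>U i k\<close> is an entry of \<open>dg n B'\<close> in its zero block.\<close>
  have upper: "U i k = 0" if i: "i < n" and k: "n \<le> k" "k < d" for i k
  proof -
    have "k \<in> \<sigma> ` {n..<d}" unfolding img using k by simp
    then obtain j where j: "j \<in> {n..<d}" "k = \<sigma> j" by blast
    have "(\<Sum>l<d. U i l * dg n B l (\<sigma> j)) = (\<Sum>l<d. U i l * (if l = k then 1 else 0))"
      using k j by (intro sum.cong) (auto simp: dg_def)
    also have "\<dots> = U i k" using k(2) by (rule sum_delta_mult)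
    finally show ?thesis using ent[of i j] i j n by (auto simp: dg_def)
  qed
  have low_sum: "(\<Sum>k<d. U i k * dg n B k (\<sigma> j)) = (\<Sum>k<n. U i k * B k (\<sigma> j))" if "j < n" for i j
  proof -
    have "\<sigma> j < n" using \<sigma>n[of j] that n by simp
    then have "(\<Sum>k\<in>{n..<d}. U i k * dg n B k (\<sigma> j)) = 0" "(\<Sum>k<n. U i k * dg n B k (\<sigma> j)) = (\<Sum>k<n. U i k * B k (\<sigma> j))"
      by (auto intro!: sum.neutral sum.cong simp: dg_def)
    then show ?thesis
      using sum_less_split[OF n(1), of "\<lambda>k. U i k * dg n B k (\<sigma> j)"] by simp
  qed
  have lower: "U i k = 0" if i: "n \<le> i" "i < d" and k: "k < n" for i k
  proof -
    obtain Y where Y: "half_inverse d (dg n B) Y"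
      using reflexive_mat_wirth[OF w] by (auto simp: reflexive_mat_def)
    \<comment> \<open>The row of \<open>U\<close> cut off at \<open>n\<close> annihilates all
      columns of \<open>dg n B\<close>, so \<open>half_inverse_kernel\<close> makes it zero.\<close>
    define y where "y k = (if k < n then U i k else 0)" for k
    have "(\<Sum>l<d. y l * dg n B l j) = 0" if j: "j < d" for j
    proof (cases "j < n")
      case True
      have "j \<in> \<sigma> ` {..<d}" unfolding permutes_image[OF \<sigma>] using j by simp
      then obtain j' where j': "j' < d" "j = \<sigma> j'" by blast
      then have "j' < n" using True \<sigma>n by simp
      have "(\<Sum>l<d. y l * dg n B l j) = (\<Sum>l<d. U i l * dg n B l (\<sigma> j'))"
        using True j' by (intro sum.cong) (auto simp: y_def dg_def)
      also have "\<dots> = dg n B' i j'" using ent[OF i(2) j'(1)] by simp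
      also have "\<dots> = 0" using \<open>j' < n\<close> i by (simp add: dg_def)
      finally show ?thesis .
    next
      case False
      then show ?thesis by (intro sum.neutral) (auto simp: y_def dg_def)
    qed
    from half_inverse_kernel[OF Y this, of k] show ?thesis using k n by (simp add: y_def)
  qed
  have "eqm n (mmul n U W) idm"
    unfolding eqm_def
  proof (intro allI impI)
    fix i k assume ik: "i < n" "k < n"
    have "(\<Sum>j\<in>{n..<d}. U i j * W j k) = 0" using ik upper by (intro sum.neutral) auto
    then have "mmul n U W i k = mmul d U W i k" by (simp add: mmul_def sum_less_split[OF n(1)])
    then show "mmul n U W i k = idm i k" using W(1) ik n by (simp add: eqm_def)
  qed
  moreover have "eqm n (mmul n W U) idm"
    unfolding eqm_def
  proof (intro allI impI)
    fix i k assume ik: "i < n" "k < n"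
    have "(\<Sum>j\<in>{n..<d}. W i j * U j k) = 0" using ik lower by (intro sum.neutral) auto
    then have "mmul n W U i k = mmul d W U i k" by (simp add: mmul_def sum_less_split[OF n(1)])
    then show "mmul n W U i k = idm i k" using W(2) ik n by (simp add: eqm_def)
  qed
  ultimately have U: "unimodular n U" unfolding unimodular_iff by blast
  define \<tau> where "\<tau> j = (if j < n then \<sigma> j else j)" for j
  have "inj_on \<sigma> {..<n}" using inj_on_subset[OF permutes_inj[OF \<sigma>]] by blast
  then have "inj_on \<tau> {..<n}" by (simp add: \<tau>_def inj_on_def)
  moreover have "\<tau> ` {..<n} \<subseteq> {..<n}" using \<sigma>n n by (auto simp: \<tau>_def)
  ultimately have "bij_betw \<tau> {..<n} {..<n}" by (simp add: bij_betw_def endo_inj_surj)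
  then have \<tau>: "\<tau> permutes {..<n}" by (rule bij_imp_permutes) (simp add: \<tau>_def)
  have "eqm n B' (mmul n U (\<lambda>i j. B i (\<tau> j)))"
    unfolding eqm_def
  proof (intro allI impI)
    fix i j assume ij: "i < n" "j < n"
    then have "B' i j = (\<Sum>k<d. U i k * dg n B k (\<sigma> j))" using ent[of i j] n by (simp add: dg_def)
    then show "B' i j = mmul n U (\<lambda>i j. B i (\<tau> j)) i j"
      using low_sum[OF ij(2)] ij by (simp add: mmul_def \<tau>_def)
  qed
  then show "mat_equiv n B B'" unfolding mat_equiv_iff using U \<tau> by blast
qed

section \<open>The correspondence\<close>

text \<open>If a segment split off, the first coordinate of the target would be an integral
  functional that is 1 and -1 on one pair of vertices and 0 on all others. Pulled back to
  \<open>A\<close>, it yields a zero row of \<open>C\<close>.\<close>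

lemma one_minimal_one_irreducible:
  assumes d: "d \<ge> 1" and A: "one_minimal d A"
  shows "one_irreducible d (PA d A)"
  unfolding one_irreducible_def
proof (rule notI, elim exE conjE)
  fix P2 assume "iso d (PA d A) (dsum 1 seg P2)"
  then obtain U where U: "unimodular d U" and eq: "lin d U ` vertices (PA d A) = vertices (dsum 1 seg P2)"
    by (auto simp: iso_def)
  obtain W where W: "eqm d (mmul d U W) idm" "eqm d (mmul d W U) idm"
    using U unfolding unimodular_iff by blast
  obtain f where f: "wirth_f d f A" and wA: "wirth d A" and empty: "single_one_rows d A = {}"
    using A unfolding one_minimal_iff by (auto simp: wirth_def)
  have r: "reflexive_mat d A" using reflexive_mat_wirth[OF wA] .
  obtain Y where Y: "half_inverse d A Y" using r by (auto simp: reflexive_mat_def)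
  define e0 where "e0 = vec 1 (\<lambda>_. 1)"
  have neg: "vec 1 (\<lambda>_. -1) = - e0"
    unfolding e0_def by (rule poly_mapping_eqI) (simp add: lookup_pt)
  have "dsum 1 seg P2 = convex hull ({e0, - e0} \<union> shift 1 ` P2)"
    unfolding dsum_def seg_def neg e0_def[symmetric] by (rule hull_Un_left[symmetric])
  then have vert: "vertices (dsum 1 seg P2) \<subseteq> {e0, - e0} \<union> shift 1 ` P2"
    unfolding vertices_def by (auto dest!: extreme_point_of_convex_hull)
  define y where "y = U 0"
  define p where "p j = (\<Sum>k<d. y k * A k j)" for j
  have lookup0: "Poly_Mapping.lookup (lin d U (col d A j)) 0 = real_of_int (p j)" for j
    unfolding lin_col using d by (simp add: col_def lookup_vec mmul_def p_def y_def)
  have img: "lin d U (col d A j) = e0 \<or> lin d U (col d A j) = - e0" if j: "j < d" "p j \<noteq> 0" for j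
  proof -
    have "lin d U (col d A j) \<in> vertices (dsum 1 seg P2)"
      unfolding eq[symmetric] vertices_PA[OF d r] using j by blast
    moreover have "lin d U (col d A j) \<notin> shift 1 ` P2"
    proof
      assume "lin d U (col d A j) \<in> shift 1 ` P2"
      then have "Poly_Mapping.lookup (lin d U (col d A j)) 0 = 0" by (auto simp: lookup_shift)
      then show False using lookup0[of j] j by simp
    qed
    ultimately show ?thesis using vert by blast
  qed
  \<comment> \<open>Otherwise row 0 of \<open>U\<close> would vanish, against the entry 1 of
    \<open>U W\<close> at position 0, 0.\<close>
  have "\<exists>j<d. p j \<noteq> 0"
  proof (rule ccontr)
    assume "\<not> (\<exists>j<d. p j \<noteq> 0)"
    then have y0: "y k = 0" if "k < d" for k
      using half_inverse_kernel[OF Y, of y k] that by (simp add: p_def)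
    have "(\<Sum>k<d. U 0 k * W k 0) = 1" using W(1) d by (simp add: eqm_def mmul_def idm_def)
    moreover have "(\<Sum>k<d. U 0 k * W k 0) = 0" using y0 by (intro sum.neutral) (auto simp: y_def)
    ultimately show False by simp
  qed
  then obtain j0 where j0: "j0 < d" "p j0 \<noteq> 0" by blast
  have "Poly_Mapping.lookup e0 0 = 1" by (simp add: e0_def lookup_vec)
  then have "real_of_int (p j0) = 1 \<or> real_of_int (p j0) = -1"
    using img[OF j0] lookup0[of j0] by (auto simp: lookup_uminus)
  then have "p j0 = 1 \<or> p j0 = -1" by linarith
  then have "odd (p j0)" by auto
  \<comment> \<open>A second column with nonzero value would also go to \<open>e0\<close> or
    \<open>- e0\<close> and hence be proportional to column \<open>j0\<close>.\<close>
  moreover have "p j = (if j = j0 then p j0 else 0)" if j: "j < d" for j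
  proof (rule ccontr)
    assume "p j \<noteq> (if j = j0 then p j0 else 0)"
    then have ne: "j \<noteq> j0" "p j \<noteq> 0" by (auto split: if_splits)
    have "lin d U (col d A j) = lin d U (col d A j0) \<or> lin d U (col d A j) = - lin d U (col d A j0)"
      using img[OF j ne(2)] img[OF j0] by auto
    then have "lin d U (col d A j) = lin d U (1 *\<^sub>R col d A j0) \<or>
        lin d U (col d A j) = lin d U ((-1) *\<^sub>R col d A j0)"
      by (simp add: linear_neg[OF linear_lin])
    then have "\<exists>c::real. c \<noteq> 0 \<and> lin d U (col d A j) = lin d U (c *\<^sub>R col d A j0)"
      by (elim disjE) (rule exI[of _ 1], simp, rule exI[of _ "-1"], simp)
    then obtain c :: real where c: "c \<noteq> 0" "lin d U (col d A j) = lin d U (c *\<^sub>R col d A j0)"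
      by blast
    have inv: "lin d W (lin d U x) = x" if "x \<in> Rd d" for x
      using lin_eqm_idm[OF W(2) that] by (simp add: lin_mmul)
    have "col d A j = lin d W (lin d U (col d A j))" by (rule inv[symmetric]) (simp add: col_def)
    also have "\<dots> = c *\<^sub>R col d A j0"
      unfolding c(2) by (rule inv, intro subspace_scale subspace_Rd) (simp add: col_def)
    finally show False using col_signed_eq[OF d r j j0(1) c(1)] ne by blast
  qed
  ultimately have "j0 \<in> single_one_rows d A"
    using split_column_wirth[OF f j0(1), of "p j0" y] unfolding p_def by blast
  then show False using empty by simp
qed

text \<open>Any zero row of \<open>C\<close> leaves a diagonal 1 at the end of the reduced block
  form; the cyclic shift brings it to the front, as a split segment.\<close>

lemma one_irreducible_one_minimal:
  assumes d: "d \<ge> 1" and V: "reflexive_mat d V" and irr: "one_irreducible d (PA d V)"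
    and A: "wirth d A" and AV: "mat_equiv d A V"
  shows "one_minimal d A"
proof (rule ccontr)
  assume "\<not> one_minimal d A"
  then have ne: "single_one_rows d A \<noteq> {}" using A by (simp add: one_minimal_iff)
  define n where "n = d - card (single_one_rows d A)"
  \<comment> \<open>Read in size \<open>d\<close> it is equivalent to \<open>A\<close>; read in size
    \<open>m = d - 1\<close> it describes the complementary factor.\<close>
  define G where "G = dg n (reduction d A)"
  note red = reduction_equiv[OF A n_def]
  have "card (single_one_rows d A) > 0" using ne by (simp add: card_gt_0_iff single_one_rows_def)
  then obtain m where m: "d = Suc m" "n \<le> m" using d by (cases d) (auto simp: n_def)
  have "mat_equiv d V (dg1 G)"
    using mat_equiv_trans[OF mat_equiv_sym[OF AV] red(2)] mat_equiv_dg1[of m G] mat_equiv_trans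
    unfolding G_def m(1) dg_dg[OF m(2)] by blast
  moreover from this have "reflexive_mat d (dg1 G)" using reflexive_mat_equiv[OF V] by blast
  ultimately have iso: "iso d (PA d V) (dsum 1 seg (block_polytope m G))"
    unfolding dsum_seg_block m(1)[symmetric] using iso_PA_iff[OF d V] by blast
  have "fano_factor m (block_polytope m G)"
  proof (cases "m = 0")
    case False
    then have "wirth m G" unfolding G_def using min_block_dg(1)[OF _ m(2) red(1)] by simp
    then have "reflexive m (PA m G)" using reflexive_PA(1)[OF _ reflexive_mat_wirth] False by simp
    then show ?thesis using False by (simp add: fano_factor_def block_polytope_def reflexive_def)
  qed (simp add: fano_factor_def block_polytope_def)
  then show False using irr iso d m(1) unfolding one_irreducible_def by auto
qed

lemma irr_factorE:
  assumes "irr_factor n Q"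
  obtains V B where "Q = block_polytope n V" "min_block n B" "mat_equiv n B V" "n \<ge> 1 \<Longrightarrow> reflexive_mat n V"
proof (cases "n = 0")
  case True
  \<comment> \<open>In dimension 0 every matrix gives \<open>{0}\<close>; \<open>idm\<close> is a
    placeholder.\<close>
  then show thesis
    using assms that[of idm idm] mat_equiv_refl by (simp add: irr_factor_def block_polytope_def min_block_def)
next
  case False
  then have n: "n \<ge> 1" and Q: "reflexive n Q" "cs_cross n Q" "one_irreducible n Q"
    using assms by (auto simp: irr_factor_def)
  obtain V where V: "reflexive_mat n V" "Q = PA n V" using reflexive_cs_crossE[OF n Q(1,2)] .
  obtain B where B: "wirth n B" "mat_equiv n B V" using reflexive_mat_wirth_form[OF n V(1)] .
  have "one_minimal n B"
    using one_irreducible_one_minimal[OF n V(1) _ B] Q(3) V(2) by simp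
  then show thesis
    using that[of V B] V B n False by (simp add: block_polytope_def min_block_def)
qed

lemma irr_factor_block:
  assumes "min_block n B"
  shows "irr_factor n (block_polytope n B)"
proof (cases "n = 0")
  case False
  then have n: "n \<ge> 1" and B: "one_minimal n B" using assms by (auto simp: min_block_def)
  have "reflexive_mat n B" using B reflexive_mat_wirth by (auto simp: one_minimal_iff)
  then show ?thesis
    using reflexive_PA[OF n] one_minimal_one_irreducible[OF n B] n
    by (simp add: irr_factor_def block_polytope_def)
qed (simp add: irr_factor_def block_polytope_def)

lemma iso_zero: "iso 0 {0} {0}"
proof -
  have "vertices {0 :: pt} = {0}" by (auto simp: vertices_def)
  moreover have "unimodular 0 idm" by (rule unimodular_idm)
  ultimately show ?thesis
    unfolding iso_def by (intro exI[of _ idm]) (simp add: linear_0[OF linear_lin])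
qed

lemma iso_block:
  assumes "n \<ge> 1 \<Longrightarrow> reflexive_mat n A" "n \<ge> 1 \<Longrightarrow> reflexive_mat n B" "mat_equiv n A B"
  shows "iso n (block_polytope n A) (block_polytope n B)"
  using assms iso_zero iso_PA_iff[of n A B] by (cases "n = 0") (auto simp: block_polytope_def)

text \<open>The signs that select the facet are absorbed into the columns. The polytope stays the
  same, and the normal form of the new matrix then has exactly the facet vertices as its transformed
  columns.\<close>

lemma facet_wirth_form:
  assumes d: "d \<ge> 1" and V: "reflexive_mat d V" and F: "is_facet d F (PA d V)"
  shows "\<exists>U A. unimodular d U \<and> wirth d A \<and> vertices F = lin d U ` col d A ` {..<d} \<and>
    lin d U ` PA d A = PA d V"
proof -
  obtain X where "dual_bases d (col d V) X" using reflexive_mat_dual_bases[OF d V] .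
  from dual_bases.facet_vertices[OF this, of F] F
  obtain e where e: "\<And>j. j < d \<Longrightarrow> e j = 1 \<or> e j = (-1::int)"
    and vert: "vertices F = (\<lambda>j. e j *\<^sub>R col d V j) ` {..<d}"
    unfolding PA_cross by metis
  define V' where "V' = (\<lambda>i j. V i j * e j)"
  have col: "col d V' j = e j *\<^sub>R col d V j" for j
    unfolding V'_def by (rule poly_mapping_eqI) (simp add: col_def lookup_pt)
  have PV': "PA d V' = PA d V"
    unfolding PA_cross using cross_signed[of d "\<lambda>j. real_of_int (e j)" "col d V"] e
    by (simp add: col[abs_def] cross_def) force
  obtain Y where "half_inverse d V Y" using V by (auto simp: reflexive_mat_def)
  then have "mat_equiv d V V'" unfolding V'_def using e by (rule mat_equiv_flip)
  then have "reflexive_mat d V'" using reflexive_mat_equiv[OF V] by blast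
  then obtain A where A: "wirth d A" "mat_equiv d A V'" using reflexive_mat_wirth_form[OF d] by blast
  then obtain U \<sigma> where U: "unimodular d U" "\<sigma> permutes {..<d}"
    "eqm d V' (mmul d U (\<lambda>i j. A i (\<sigma> j)))"
    unfolding mat_equiv_iff by blast
  have "vertices F = lin d U ` col d A ` {..<d}"
    unfolding vert col_image_equiv[OF U(2,3), symmetric] using col by (intro image_cong) auto
  moreover have "lin d U ` PA d A = PA d V" using PA_equiv[OF U(2,3)] PV' by simp
  ultimately show ?thesis using U(1) A(1) by blast
qed

text \<open>Existence comes from the reduction of a Wirth form. Any competing splitting is again a
  block sum with an identity, so cancellation compares the two blocks.\<close>

lemma unique_splitting:
  assumes d: "d \<ge> 1" and V: "reflexive_mat d V"
  shows "\<exists>r P'. r \<le> d \<and> irr_factor (d - r) P' \<and> iso d (PA d V) (add_segs (d - r) P' r)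
      \<and> (\<forall>s Q. s \<le> d \<and> irr_factor (d - s) Q \<and> iso d (PA d V) (add_segs (d - s) Q s)
               \<longrightarrow> s = r \<and> iso (d - r) Q P')
      \<and> (\<forall>A. wirth d A \<and> iso d (PA d A) (PA d V) \<longrightarrow>
             r = card (single_one_rows d A)
           \<and> (r < d \<longrightarrow> one_minimal (d - r) (reduction d A)
                       \<and> iso (d - r) (PA (d - r) (reduction d A)) P'))"
proof -
  obtain A where A: "wirth d A" "mat_equiv d A V" using reflexive_mat_wirth_form[OF d V] .
  have split: "card (single_one_rows d A) \<le> d \<and> min_block (d - card (single_one_rows d A)) (reduction d A) \<and>
      iso d (PA d V) (add_segs (d - card (single_one_rows d A))
        (block_polytope (d - card (single_one_rows d A)) (reduction d A)) (card (single_one_rows d A)))"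
    if A: "wirth d A" and AV: "mat_equiv d A V" for A
  proof -
    let ?r = "card (single_one_rows d A)"
    note red = reduction_equiv[OF A refl]
    have "mat_equiv d V (dg (d - ?r) (reduction d A))"
      using mat_equiv_trans[OF mat_equiv_sym[OF AV] red(2)] .
    then have "iso d (PA d V) (PA d (dg (d - ?r) (reduction d A)))"
      using iso_PA_iff[OF d V reflexive_mat_equiv[OF V]] by simp
    then show ?thesis using add_segs_block[of "d - ?r" ?r "reduction d A"] red d by simp
  qed
  define r where "r = card (single_one_rows d A)"
  define n where "n = d - r"
  define R where "R = reduction d A"
  define P' where "P' = block_polytope n R"
  have rd: "r \<le> d" and R: "min_block n R" and iso: "iso d (PA d V) (add_segs n P' r)"
    using split[OF A] by (auto simp: r_def n_def R_def P'_def)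
  have nd: "n \<le> d" "n + r = d" using rd by (auto simp: n_def)
  have mono: "n \<ge> 1 \<Longrightarrow> reflexive_mat n R"
    using R reflexive_mat_wirth by (auto simp: min_block_def one_minimal_iff)
  have VR: "mat_equiv d V (dg n R)"
    using mat_equiv_trans[OF mat_equiv_sym[OF A(2)] reduction_equiv(2)[OF A(1)]] by (simp add: n_def r_def R_def)
  have unique: "s = r \<and> iso n Q P'"
    if sd: "s \<le> d" and Q: "irr_factor (d - s) Q" and isoQ: "iso d (PA d V) (add_segs (d - s) Q s)" for s Q
  proof -
    define k where "k = d - s"
    have kd: "k \<le> d" "k + s = d" using sd by (auto simp: k_def)
    obtain C B where CB: "Q = block_polytope k C" "min_block k B" "mat_equiv k B C" "k \<ge> 1 \<Longrightarrow> reflexive_mat k C"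
      using irr_factorE[OF Q] unfolding k_def by metis
    have "mat_equiv d (dg k B) (dg k C)" using mat_equiv_dg[OF kd(1) CB(3)] .
    moreover have "reflexive_mat d (dg k B)"
      using reflexive_mat_wirth min_block_dg(1)[OF d kd(1) CB(2)] by blast
    ultimately have rC: "reflexive_mat d (dg k C)" and BC: "mat_equiv d (dg k B) (dg k C)"
      using reflexive_mat_equiv by auto
    have "add_segs k Q s = PA d (dg k C)" using add_segs_block[of k s C] kd d CB(1) by simp
    then have "mat_equiv d V (dg k C)"
      using isoQ iso_PA_iff[OF d V rC] unfolding k_def[symmetric] by simp
    \<comment> \<open>Cancellation works with minimal blocks, so \<open>C\<close> has been traded
      for the equivalent \<open>B\<close>.\<close>
    then have "mat_equiv d (dg k B) (dg n R)"
      using mat_equiv_trans[OF BC] mat_equiv_trans[OF mat_equiv_sym VR] by simp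
    then have "k = n" "mat_equiv k B R"
      using mat_equiv_dg_cancel[OF d kd(1) nd(1) CB(2) R] by blast+
    then have "mat_equiv n C R" using mat_equiv_trans[OF mat_equiv_sym[OF CB(3)]] by simp
    then have "iso n Q P'"
      unfolding P'_def using CB(1,4) \<open>k = n\<close> mono iso_block[of n C R] by simp
    then show ?thesis using \<open>k = n\<close> kd nd by simp
  qed
  \<comment> \<open>The reduction of any other Wirth matrix of the polytope also gives a splitting,
    so uniqueness identifies it.\<close>
  have wirth: "r = card (single_one_rows d A') \<and> (r < d \<longrightarrow> one_minimal n (reduction d A') \<and>
      iso n (PA n (reduction d A')) P')"
    if A': "wirth d A'" "iso d (PA d A') (PA d V)" for A'
  proof -
    have "mat_equiv d A' V" using iso_PA_iff[OF d reflexive_mat_wirth[OF A'(1)] V] A'(2) by simp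
    note sp = split[OF A'(1) this]
    then have u: "card (single_one_rows d A') = r \<and> iso n (block_polytope (d - card (single_one_rows d A')) (reduction d A')) P'"
      by (intro unique irr_factor_block) auto
    then have "min_block n (reduction d A')" using sp by (simp add: n_def)
    then show ?thesis using u by (auto simp: n_def min_block_def block_polytope_def)
  qed
  show ?thesis
  proof (rule exI[of _ r], rule exI[of _ P'], unfold n_def[symmetric], intro conjI[of "_ \<le> _"] conjI[of "irr_factor _ _"]
      conjI[of "iso _ _ _"] conjI[of "All _"] allI impI; (elim conjE)?)
    show "irr_factor n P'" unfolding P'_def by (rule irr_factor_block[OF R])
    show "s = r \<and> iso n Q P'"
      if "s \<le> d" "irr_factor (d - s) Q" "iso d (PA d V) (add_segs (d - s) Q s)" for s Q
      using that by (rule unique)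
    show "r = card (single_one_rows d A) \<and> (r < d \<longrightarrow> one_minimal n (reduction d A) \<and>
        iso n (PA n (reduction d A)) P')"
      if "wirth d A" "iso d (PA d A) (PA d V)" for A
      using that by (rule wirth)
  qed (rule rd iso)+
qed

theorem theorem2p2:
  fixes d :: nat
  assumes "d \<ge> 1"
  shows
    \<comment> \<open>(1) correspondence between Wirth matrices and reflexive cs-crosspolytopes\<close>
    "(\<forall>A. wirth d A \<longrightarrow> reflexive d (PA d A) \<and> cs_cross d (PA d A))
   \<and> (\<forall>A B. wirth d A \<longrightarrow> wirth d B \<longrightarrow>
        (mat_equiv d A B \<longleftrightarrow> iso d (PA d A) (PA d B)))
   \<and> (\<forall>P. reflexive d P \<and> cs_cross d P \<longrightarrow> (\<exists>A. wirth d A \<and> iso d (PA d A) P))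
   \<and> (\<forall>P F. reflexive d P \<and> cs_cross d P \<and> is_facet d F P \<longrightarrow>
        (\<exists>U A. unimodular d U \<and> wirth d A \<and>
               vertices F = lin d U ` col d A ` {..<d} \<and>
               lin d U ` PA d A = P))
    \<comment> \<open>(2) 1-minimal Wirth matrices vs. 1-irreducible polytopes\<close>
   \<and> (\<forall>A. one_minimal d A \<longrightarrow> one_irreducible d (PA d A))
   \<and> (\<forall>P. reflexive d P \<and> cs_cross d P \<and> one_irreducible d P \<longrightarrow>
        (\<exists>A. one_minimal d A \<and> iso d (PA d A) P))
    \<comment> \<open>(2) unique splitting off of copies of [-1,1]\<close>
   \<and> (\<forall>P. reflexive d P \<and> cs_cross d P \<longrightarrow>
        (\<exists>r P'. r \<le> d \<and> irr_factor (d - r) P' \<and> iso d P (add_segs (d - r) P' r)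
          \<and> (\<forall>s Q. s \<le> d \<and> irr_factor (d - s) Q \<and> iso d P (add_segs (d - s) Q s)
                   \<longrightarrow> s = r \<and> iso (d - r) Q P')
          \<and> (\<forall>A. wirth d A \<and> iso d (PA d A) P \<longrightarrow>
                 r = card (single_one_rows d A)
               \<and> (r < d \<longrightarrow> one_minimal (d - r) (reduction d A)
                           \<and> iso (d - r) (PA (d - r) (reduction d A)) P'))))"
proof (intro conjI; intro allI impI; (elim conjE)?)
  note d = assms
  have mat: "\<exists>V. reflexive_mat d V \<and> P = PA d V" if "reflexive d P" "cs_cross d P" for P
    using reflexive_cs_crossE[OF d that] by blast
  have form: "\<exists>A. wirth d A \<and> mat_equiv d A V \<and> iso d (PA d A) (PA d V)" if V: "reflexive_mat d V" for V
  proof -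
    obtain A where A: "wirth d A" "mat_equiv d A V" using reflexive_mat_wirth_form[OF d V] .
    then show ?thesis using iso_PA_iff[OF d reflexive_mat_wirth V] by blast
  qed
  show "reflexive d (PA d A) \<and> cs_cross d (PA d A)" if "wirth d A" for A
    using reflexive_PA[OF d reflexive_mat_wirth[OF that]] by blast
  show "mat_equiv d A B \<longleftrightarrow> iso d (PA d A) (PA d B)" if "wirth d A" "wirth d B" for A B
    using iso_PA_iff[OF d reflexive_mat_wirth[OF that(1)] reflexive_mat_wirth[OF that(2)]] by simp
  show "\<exists>A. wirth d A \<and> iso d (PA d A) P" if "reflexive d P" "cs_cross d P" for P
    using mat[OF that] form by blast
  show "\<exists>U A. unimodular d U \<and> wirth d A \<and> vertices F = lin d U ` col d A ` {..<d} \<and> lin d U ` PA d A = P"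
    if "reflexive d P" "cs_cross d P" "is_facet d F P" for P F
    using mat[OF that(1,2)] facet_wirth_form[OF d] that(3) by blast
  show "one_irreducible d (PA d A)" if "one_minimal d A" for A
    by (rule one_minimal_one_irreducible[OF d that])
  show "\<exists>A. one_minimal d A \<and> iso d (PA d A) P"
    if "reflexive d P" "cs_cross d P" "one_irreducible d P" for P
    using mat[OF that(1,2)] form one_irreducible_one_minimal[OF d] that(3) by blast
  show "\<exists>r P'. r \<le> d \<and> irr_factor (d - r) P' \<and> iso d P (add_segs (d - r) P' r)
      \<and> (\<forall>s Q. s \<le> d \<and> irr_factor (d - s) Q \<and> iso d P (add_segs (d - s) Q s)
               \<longrightarrow> s = r \<and> iso (d - r) Q P')
      \<and> (\<forall>A. wirth d A \<and> iso d (PA d A) P \<longrightarrow>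
             r = card (single_one_rows d A)
           \<and> (r < d \<longrightarrow> one_minimal (d - r) (reduction d A)
                       \<and> iso (d - r) (PA (d - r) (reduction d A)) P'))"
    if P: "reflexive d P" "cs_cross d P" for P
  proof -
    obtain V where V: "reflexive_mat d V" "P = PA d V" using mat[OF P] by blast
    show ?thesis unfolding V(2) by (rule unique_splitting[OF d V(1)])
  qed
qed

end
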